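(* Let $[M;\mathcal L]$ be an axiomatized mathematical system with restricted argument lists, $M=[S;A_M;P_M;B_M]$. (i) The set $\tilde\Pi(M;\mathcal L):=\{\tilde F: F\in\Pi(M;\mathcal L)\}\subseteq A_{17}^+$ is recursively enumerable. (ii) Suppose that the first 11 symbols of $A_M$ coincide with the alphabet $A_{11}$ and that $\mathcal L\supset A_{11}^+$. Suppose there is a formula $G$ of $[M;\mathcal L]$ with $\mathrm{free}(G)=\{x\}$ such that $G\frac{\lambda}{x}$ is provable in $[M;\mathcal L]$ for each 1-ary $S_{11}$-theorem $\lambda\in A_{11}^+$, and $G\frac{\lambda}{x}$ is not provable in $[M;\mathcal L]$ for each 1-ary $S_{11}$-statement $\lambda\in A_{11}^+$ which is not an $S_{11}$-theorem. Then there is a 1-ary $S_{11}$-statement $\lambda\in A_{11}^+$ such that neither $G\frac{\lambda}{x}$ nor $\neg G\frac{\lambda}{x}$ is provable in $[M;\mathcal L]$.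
   Context: Mathematical systems. Formulas are in Polish notation over pairwise disjoint symbols: constant/operation symbols $A_M$, predicate symbols $P_M$, countably many variables $X=[\mathbf x_1,\mathbf x_2,\dots]$, and $\sim,(,),\,,\,,\to,\neg,\leftrightarrow,\&,\vee,\forall,\exists$. Lists: $a\in A_M$, $x\in X$, $f(\lambda)$, concatenations. Prime formulas $\sim\lambda,\mu$, $p\,\lambda_1,..,\lambda_n$; formulas via $\neg$, $J\in\{\to,\leftrightarrow,\&,\vee\}$, $\forall x$, $\exists x$; argument lists are maximal lists not immediately after a quantifier; $F\frac{\mu}{x}=\mathrm{SbF}(F;\mu;x)$ replaces free occurrences of $x$; $\mathrm{CF}$ is the usual collision-freeness condition (true for prime formulas, passes through connectives, $\mathrm{CF}(QyF;\mu;x)$ iff $x\notin\mathrm{free}(F)\setminus\{y\}$ or ($y\notin\mathrm{var}(\mu)$ and $\mathrm{CF}(F;\mu;x)$)). $M=[S;A_M;P_M;B_M]$ with recursive system $S=[A_S;P_S;B_S]$ (finite $A_S\subseteq A_M$, $P_S\subseteq P_M$, finite list $B_S$ of formulas $\to F_1\dots\to F_r\,G$ with prime $F_j,G$; $G$ the R-conclusion) and basis axioms $B_M\supseteq B_S$. Axioms: tautology instances, equality axioms ($\sim x,x$; $\to\mathrm{SbF}(\sim\lambda,\mu;x;y)\to\sim x,y\ \sim\lambda,\mu$; $\to\sim x_1,y_1..\to\sim x_n,y_n\to p\,x_1..x_n\ p\,y_1..y_n$), quantifier axioms ($\to\forall xF\,F$; $\to\forall x\to FG\to F\forall xG$ if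 $x\notin\mathrm{free}(F)$; $\leftrightarrow\neg\forall x\neg F\ \exists xF$), and $B_M$. Rules: axiom, modus ponens, substitution under CF, generalization, Induction (for $p\in P_S$, distinct $x_1..x_i$, $G$ with variables not in $B_S$: if for each $F\in B_S$ with $i$-ary $p$-conclusion the formula obtained by replacing each $i$-ary $p\,\lambda_1..\lambda_i$ by $G\frac{\lambda_1}{x_1}\cdots\frac{\lambda_i}{x_i}$ is a step, append $\to p\,x_1..x_i\,G$). Restricted argument lists $\mathcal L$: $X\subseteq\mathcal L$, closed under $\lambda\frac{\mu}{x}$, containing argument lists of $B_M$; $[M;\mathcal L]$ restricts all formulas in proofs to argument lists in $\mathcal L$ and substituted lists to $\mathcal L$; $\Pi(M;\mathcal L)$ = provable formulas. Axiomatized systems: $A_M=[\mathbf a_1,\mathbf a_2,\dots]$, $P_M=[\mathbf p_1,\mathbf p_2,\dots]$ are countably infinite, with $A_S=[\mathbf a_1..\mathbf a_k]$, $P_S=[\mathbf p_1..\mathbf p_l]$ initial segments. $A_{17}=[a,v,p,\Box,{}',*,\underline\sim,\underline(,\underline),\underline,,\underline\to,\underline\neg,\underline\leftrightarrow,\underline\&,\underline\vee,\underline\forall,\underline\exists]$ and the first 17 symbols of $A_M$ are these, in this order. The encoding $\tilde\lambda,\tilde F\in A_{17}^+$ replaces $\mathbf a_i$ by $a$ followed by $i$ accents, $\mathbf p_i$ by $p$ followed by $i$ accents, $\mathbf x_j$ by $v$ followed by $j$ accents, and each logical symbol by its underlined version. $[M;\mathcal L]$ is axiomatized if $\{\tilde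 F:F\in B_M\}$ and $\{\tilde\lambda:\lambda\in\mathcal L\}$ are recursively enumerable. A set $T$ of nonempty strings over a finite alphabet $\Gamma$ is recursively enumerable if some recursive system $S'$ with $\Gamma\subseteq A_{S'}$ and predicate $q$ satisfies: $s\in T$ iff $q\,s$ is R-derivable in $S'$ (R-derivable: generated from the basis R-axioms and the equality R-axioms by modus ponens and substitution of arbitrary lists for variables). $S_{11}$-statements: $A_{11}$ consists of the first 11 symbols $a,v,p,\Box,{}',*,\underline\sim,\underline(,\underline),\underline,,\underline\to$ of $A_{17}$. For a recursive system $T$ with ordered symbol lists $[\mathbf a_1..\mathbf a_k]$, $[\mathbf p_1..\mathbf p_l]$ and basis R-axioms $[F_1..F_m]$, its R-basis string is $u*w*\tilde F_1*\dots*\tilde F_m*$ (or $u*w*\Box*$ if $m=0$), with $u=\Box$ if $k=0$ else $k$ accents, $w$ likewise for $l$. A 1-ary $S_{11}$-statement is a string $yz$ with $y$ the R-basis string of a recursive system $T$ and $z$ the encoding of an elementary (variable-free) 1-ary prime R-formula $\mathbf p_i\,\lambda$ (any indices); it is an $S_{11}$-theorem if $z$ encodes an elementary prime R-formula over the symbols of $T$ which is R-derivable in $T$. Strings over $A_{11}$ are regarded as lists (concatenations of constants of $A_M$). *)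

theory Defs
  imports Main
begin

text \<open>
  Symbols are represented by their position in the fixed enumerations: the constant or operation
  symbol \<open>a\<^sub>i\<close> is the number \<open>i - 1\<close>, and likewise for the predicate symbol \<open>p\<^sub>i\<close> and the
  variable \<open>x\<^sub>i\<close>; the constructors below keep the three kinds apart. Lists and formulas are syntax
  trees instead of strings; their strings in Polish notation are uniquely readable, and \<open>enc_list\<close>,
  \<open>enc_fm\<close> below produce these strings in encoded form.
\<close>

section \<open>Lists and formulas\<close>

datatype item = Cst nat | Var nat | Op nat "item list"

text \<open>A list is a nonempty concatenation of items; \<open>Op f l\<close> stands for \<open>f(l)\<close>.\<close>

inductive_set list_terms :: "nat set \<Rightarrow> item list set" for A :: "nat set" where
  cst: "a \<in> A \<Longrightarrow> [Cst a] \<in> list_terms A"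
| var: "[Var x] \<in> list_terms A"
| op: "f \<in> A \<Longrightarrow> l \<in> list_terms A \<Longrightarrow> [Op f l] \<in> list_terms A"
| conc: "l \<in> list_terms A \<Longrightarrow> m \<in> list_terms A \<Longrightarrow> l @ m \<in> list_terms A"

fun var_item :: "item \<Rightarrow> nat set" where
  "var_item (Cst a) = {}"
| "var_item (Var x) = {x}"
| "var_item (Op f l) = (\<Union>t\<in>set l. var_item t)"

definition var_list :: "item list \<Rightarrow> nat set" where
  "var_list l = (\<Union>t\<in>set l. var_item t)"

fun sb_item :: "item list \<Rightarrow> nat \<Rightarrow> item \<Rightarrow> item list" where
  "sb_item m x (Cst a) = [Cst a]"
| "sb_item m x (Var y) = (if y = x then m else [Var y])"
| "sb_item m x (Op f l) = [Op f (concat (map (sb_item m x) l))]"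

text \<open>\<open>sbL l m x\<close> replaces \<open>x\<close> by \<open>m\<close> in \<open>l\<close>.\<close>

definition sbL :: "item list \<Rightarrow> item list \<Rightarrow> nat \<Rightarrow> item list" where
  "sbL l m x = concat (map (sb_item m x) l)"

datatype conn = CImp | CIff | CAnd | COr
datatype quant = QAll | QEx

datatype fm =
    Eq "item list" "item list"
  | Prd nat "item list list"
  | Neg fm
  | Bin conn fm fm
  | Qu quant nat fm

abbreviation Imp :: "fm \<Rightarrow> fm \<Rightarrow> fm" where "Imp \<equiv> Bin CImp"

fun is_prime :: "nat set \<Rightarrow> nat set \<Rightarrow> fm \<Rightarrow> bool" where
  "is_prime A P (Eq l m) \<longleftrightarrow> l \<in> list_terms A \<and> m \<in> list_terms A"
| "is_prime A P (Prd p ls) \<longleftrightarrow> p \<in> P \<and> set ls \<subseteq> list_terms A"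
| "is_prime A P _ \<longleftrightarrow> False"

fun formula :: "nat set \<Rightarrow> nat set \<Rightarrow> fm \<Rightarrow> bool" where
  "formula A P (Neg F) \<longleftrightarrow> formula A P F"
| "formula A P (Bin J F G) \<longleftrightarrow> formula A P F \<and> formula A P G"
| "formula A P (Qu Q x F) \<longleftrightarrow> formula A P F"
| "formula A P F \<longleftrightarrow> is_prime A P F"

fun args :: "fm \<Rightarrow> item list set" where
  "args (Eq l m) = {l, m}"
| "args (Prd p ls) = set ls"
| "args (Neg F) = args F"
| "args (Bin J F G) = args F \<union> args G"
| "args (Qu Q x F) = args F"

fun var_fm :: "fm \<Rightarrow> nat set" where
  "var_fm (Eq l m) = var_list l \<union> var_list m"
| "var_fm (Prd p ls) = (\<Union>l\<in>set ls. var_list l)"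
| "var_fm (Neg F) = var_fm F"
| "var_fm (Bin J F G) = var_fm F \<union> var_fm G"
| "var_fm (Qu Q x F) = insert x (var_fm F)"

fun free :: "fm \<Rightarrow> nat set" where
  "free (Eq l m) = var_list l \<union> var_list m"
| "free (Prd p ls) = (\<Union>l\<in>set ls. var_list l)"
| "free (Neg F) = free F"
| "free (Bin J F G) = free F \<union> free G"
| "free (Qu Q x F) = free F - {x}"

text \<open>\<open>sbF F m x\<close> replaces the free occurrences of \<open>x\<close> by \<open>m\<close> in \<open>F\<close>.\<close>

fun sbF :: "fm \<Rightarrow> item list \<Rightarrow> nat \<Rightarrow> fm" where
  "sbF (Eq k l) m x = Eq (sbL k m x) (sbL l m x)"
| "sbF (Prd p ls) m x = Prd p (map (\<lambda>l. sbL l m x) ls)"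
| "sbF (Neg F) m x = Neg (sbF F m x)"
| "sbF (Bin J F G) m x = Bin J (sbF F m x) (sbF G m x)"
| "sbF (Qu Q y F) m x = (if y = x then Qu Q y F else Qu Q y (sbF F m x))"

fun CF :: "fm \<Rightarrow> item list \<Rightarrow> nat \<Rightarrow> bool" where
  "CF (Eq k l) m x \<longleftrightarrow> True"
| "CF (Prd p ls) m x \<longleftrightarrow> True"
| "CF (Neg F) m x \<longleftrightarrow> CF F m x"
| "CF (Bin J F G) m x \<longleftrightarrow> CF F m x \<and> CF G m x"
| "CF (Qu Q y F) m x \<longleftrightarrow> x \<notin> free F - {y} \<or> (y \<notin> var_list m \<and> CF F m x)"

section \<open>Recursive systems and R-derivability\<close>

definition r_formula :: "nat set \<Rightarrow> nat set \<Rightarrow> fm \<Rightarrow> bool" where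
  "r_formula A P F \<longleftrightarrow>
     (\<exists>Fs G. (\<forall>E\<in>set Fs. is_prime A P E) \<and> is_prime A P G \<and> F = foldr Imp Fs G)"

fun r_conclusion :: "fm \<Rightarrow> fm" where
  "r_conclusion (Bin CImp F G) = r_conclusion G"
| "r_conclusion F = F"

record rec_sys =
  rA :: "nat set"
  rP :: "nat set"
  rB :: "fm list"

definition recursive_system :: "rec_sys \<Rightarrow> bool" where
  "recursive_system S \<longleftrightarrow>
     finite (rA S) \<and> finite (rP S) \<and> (\<forall>F\<in>set (rB S). r_formula (rA S) (rP S) F)"

inductive_set eq_axioms :: "nat set \<Rightarrow> nat set \<Rightarrow> fm set" for A P :: "nat set" where
  eq_refl: "Eq [Var x] [Var x] \<in> eq_axioms A P"
| eq_subst: "l \<in> list_terms A \<Longrightarrow> m \<in> list_terms A \<Longrightarrow>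
    Imp (sbF (Eq l m) [Var x] y) (Imp (Eq [Var x] [Var y]) (Eq l m)) \<in> eq_axioms A P"
| eq_pred: "p \<in> P \<Longrightarrow> xs \<noteq> [] \<Longrightarrow> length xs = length ys \<Longrightarrow>
    foldr Imp (map2 (\<lambda>x y. Eq [Var x] [Var y]) xs ys)
      (Imp (Prd p (map (\<lambda>x. [Var x]) xs)) (Prd p (map (\<lambda>y. [Var y]) ys))) \<in> eq_axioms A P"

inductive_set r_derivable :: "rec_sys \<Rightarrow> fm set" for S :: rec_sys where
  basis: "F \<in> set (rB S) \<Longrightarrow> F \<in> r_derivable S"
| equality: "F \<in> eq_axioms (rA S) (rP S) \<Longrightarrow> F \<in> r_derivable S"
| mp: "F \<in> r_derivable S \<Longrightarrow> Imp F G \<in> r_derivable S \<Longrightarrow> G \<in> r_derivable S"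
| subst: "F \<in> r_derivable S \<Longrightarrow> l \<in> list_terms (rA S) \<Longrightarrow> sbF F l x \<in> r_derivable S"

definition strings :: "nat set \<Rightarrow> nat list set" where
  "strings \<Gamma> = {s. s \<noteq> [] \<and> set s \<subseteq> \<Gamma>}"

abbreviation as_list :: "nat list \<Rightarrow> item list" where
  "as_list s \<equiv> map Cst s"

definition rec_enum :: "nat set \<Rightarrow> nat list set \<Rightarrow> bool" where
  "rec_enum \<Gamma> T \<longleftrightarrow> T \<subseteq> strings \<Gamma> \<and>
     (\<exists>S q. recursive_system S \<and> \<Gamma> \<subseteq> rA S \<and> q \<in> rP S \<and>
        (\<forall>s\<in>strings \<Gamma>. s \<in> T \<longleftrightarrow> Prd q [as_list s] \<in> r_derivable S))"

section \<open>Mathematical systems with restricted argument lists\<close>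

record math_sys =
  mS :: rec_sys
  mA :: "nat set"
  mP :: "nat set"
  mB :: "fm set"

definition mathematical_system :: "math_sys \<Rightarrow> bool" where
  "mathematical_system M \<longleftrightarrow>
     recursive_system (mS M) \<and> rA (mS M) \<subseteq> mA M \<and> rP (mS M) \<subseteq> mP M \<and>
     set (rB (mS M)) \<subseteq> mB M \<and> (\<forall>F\<in>mB M. formula (mA M) (mP M) F)"

definition restricted_arglists :: "math_sys \<Rightarrow> item list set \<Rightarrow> bool" where
  "restricted_arglists M L \<longleftrightarrow>
     L \<subseteq> list_terms (mA M) \<and> (\<forall>x. [Var x] \<in> L) \<and>
     (\<forall>l\<in>L. \<forall>m\<in>L. \<forall>x. sbL l m x \<in> L) \<and> (\<forall>F\<in>mB M. args F \<subseteq> L)"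

definition formula_in :: "math_sys \<Rightarrow> item list set \<Rightarrow> fm \<Rightarrow> bool" where
  "formula_in M L F \<longleftrightarrow> formula (mA M) (mP M) F \<and> args F \<subseteq> L"

datatype pform = PVar nat | PNeg pform | PBin conn pform pform

fun conn_eval :: "conn \<Rightarrow> bool \<Rightarrow> bool \<Rightarrow> bool" where
  "conn_eval CImp a b = (a \<longrightarrow> b)"
| "conn_eval CIff a b = (a \<longleftrightarrow> b)"
| "conn_eval CAnd a b = (a \<and> b)"
| "conn_eval COr a b = (a \<or> b)"

fun prop_eval :: "(nat \<Rightarrow> bool) \<Rightarrow> pform \<Rightarrow> bool" where
  "prop_eval v (PVar n) = v n"
| "prop_eval v (PNeg a) = (\<not> prop_eval v a)"
| "prop_eval v (PBin J a b) = conn_eval J (prop_eval v a) (prop_eval v b)"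

fun prop_inst :: "(nat \<Rightarrow> fm) \<Rightarrow> pform \<Rightarrow> fm" where
  "prop_inst \<sigma> (PVar n) = \<sigma> n"
| "prop_inst \<sigma> (PNeg a) = Neg (prop_inst \<sigma> a)"
| "prop_inst \<sigma> (PBin J a b) = Bin J (prop_inst \<sigma> a) (prop_inst \<sigma> b)"

text \<open>Well-formedness of the formulas below is imposed where the axioms are used.\<close>

inductive_set axioms_of :: "math_sys \<Rightarrow> fm set" for M :: math_sys where
  taut: "(\<And>v. prop_eval v a) \<Longrightarrow> prop_inst \<sigma> a \<in> axioms_of M"
| equality: "F \<in> eq_axioms (mA M) (mP M) \<Longrightarrow> F \<in> axioms_of M"
| all_elim: "Imp (Qu QAll x F) F \<in> axioms_of M"
| all_imp: "x \<notin> free F \<Longrightarrow>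
    Imp (Qu QAll x (Imp F G)) (Imp F (Qu QAll x G)) \<in> axioms_of M"
| ex_def: "Bin CIff (Neg (Qu QAll x (Neg F))) (Qu QEx x F) \<in> axioms_of M"
| basis: "F \<in> mB M \<Longrightarrow> F \<in> axioms_of M"

text \<open>
  \<open>ind_inst p xs G F\<close> replaces each subformula \<open>Prd p ls\<close> of \<open>F\<close> with \<open>length ls = length xs\<close>
  by the result of successively substituting the members of \<open>ls\<close> for those of \<open>xs\<close> in \<open>G\<close>.
\<close>

fun ind_inst :: "nat \<Rightarrow> nat list \<Rightarrow> fm \<Rightarrow> fm \<Rightarrow> fm" where
  "ind_inst p xs G (Eq l m) = Eq l m"
| "ind_inst p xs G (Prd q ls) =
     (if q = p \<and> length ls = length xs
      then fold (\<lambda>(x, l) H. sbF H l x) (zip xs ls) G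
      else Prd q ls)"
| "ind_inst p xs G (Neg F) = Neg (ind_inst p xs G F)"
| "ind_inst p xs G (Bin J F H) = Bin J (ind_inst p xs G F) (ind_inst p xs G H)"
| "ind_inst p xs G (Qu Q y F) = Qu Q y (ind_inst p xs G F)"

inductive_set provable :: "math_sys \<Rightarrow> item list set \<Rightarrow> fm set"
  for M :: math_sys and L :: "item list set" where
  ax: "F \<in> axioms_of M \<Longrightarrow> formula_in M L F \<Longrightarrow> F \<in> provable M L"
| mp: "F \<in> provable M L \<Longrightarrow> Imp F G \<in> provable M L \<Longrightarrow> G \<in> provable M L"
| subst: "F \<in> provable M L \<Longrightarrow> l \<in> L \<Longrightarrow> CF F l x \<Longrightarrow> sbF F l x \<in> provable M L"
| gen: "F \<in> provable M L \<Longrightarrow> Qu QAll x F \<in> provable M L"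
| induction: "p \<in> rP (mS M) \<Longrightarrow> distinct xs \<Longrightarrow> formula_in M L G \<Longrightarrow>
    (\<And>F. F \<in> set (rB (mS M)) \<Longrightarrow> var_fm F \<inter> (set xs \<union> var_fm G) = {}) \<Longrightarrow>
    (\<And>F ls. F \<in> set (rB (mS M)) \<Longrightarrow> r_conclusion F = Prd p ls \<Longrightarrow> length ls = length xs \<Longrightarrow>
       ind_inst p xs G F \<in> provable M L) \<Longrightarrow>
    Imp (Prd p (map (\<lambda>x. [Var x]) xs)) G \<in> provable M L"

section \<open>Encoding\<close>

text \<open>The first 17 constant symbols in their fixed order; the underlined logical symbols start with
  \<open>c_eq\<close>. In particular \<open>A11\<close> consists of the first 11 constant symbols of every system whose
  constant symbols are all the \<open>a\<^sub>i\<close>.\<close>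

abbreviation (input) c_a :: nat where "c_a \<equiv> 0"
abbreviation (input) c_v :: nat where "c_v \<equiv> 1"
abbreviation (input) c_p :: nat where "c_p \<equiv> 2"
abbreviation (input) c_box :: nat where "c_box \<equiv> 3"
abbreviation (input) c_accent :: nat where "c_accent \<equiv> 4"
abbreviation (input) c_star :: nat where "c_star \<equiv> 5"
abbreviation (input) c_eq :: nat where "c_eq \<equiv> 6"
abbreviation (input) c_lpar :: nat where "c_lpar \<equiv> 7"
abbreviation (input) c_rpar :: nat where "c_rpar \<equiv> 8"
abbreviation (input) c_comma :: nat where "c_comma \<equiv> 9"
abbreviation (input) c_imp :: nat where "c_imp \<equiv> 10"
abbreviation (input) c_neg :: nat where "c_neg \<equiv> 11"
abbreviation (input) c_iff :: nat where "c_iff \<equiv> 12"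
abbreviation (input) c_and :: nat where "c_and \<equiv> 13"
abbreviation (input) c_or :: nat where "c_or \<equiv> 14"
abbreviation (input) c_all :: nat where "c_all \<equiv> 15"
abbreviation (input) c_ex :: nat where "c_ex \<equiv> 16"

definition A11 :: "nat set" where
  "A11 = {c_a, c_v, c_p, c_box, c_accent, c_star, c_eq, c_lpar, c_rpar, c_comma, c_imp}"

definition A17 :: "nat set" where
  "A17 = A11 \<union> {c_neg, c_iff, c_and, c_or, c_all, c_ex}"

text \<open>Number \<open>i\<close> is the \<open>(i + 1)\<close>-st symbol of its kind, hence gets \<open>i + 1\<close> accents.\<close>

definition enc_index :: "nat \<Rightarrow> nat \<Rightarrow> nat list" where
  "enc_index c i = c # replicate (Suc i) c_accent"

fun enc_item :: "item \<Rightarrow> nat list" where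
  "enc_item (Cst a) = enc_index c_a a"
| "enc_item (Var x) = enc_index c_v x"
| "enc_item (Op f l) = enc_index c_a f @ [c_lpar] @ concat (map enc_item l) @ [c_rpar]"

definition enc_list :: "item list \<Rightarrow> nat list" where
  "enc_list l = concat (map enc_item l)"

fun comma_sep :: "nat list list \<Rightarrow> nat list" where
  "comma_sep [] = []"
| "comma_sep [s] = s"
| "comma_sep (s # t # ss) = s @ [c_comma] @ comma_sep (t # ss)"

fun enc_conn :: "conn \<Rightarrow> nat" where
  "enc_conn CImp = c_imp"
| "enc_conn CIff = c_iff"
| "enc_conn CAnd = c_and"
| "enc_conn COr = c_or"

fun enc_quant :: "quant \<Rightarrow> nat" where
  "enc_quant QAll = c_all"
| "enc_quant QEx = c_ex"

fun enc_fm :: "fm \<Rightarrow> nat list" where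
  "enc_fm (Eq l m) = [c_eq] @ enc_list l @ [c_comma] @ enc_list m"
| "enc_fm (Prd p ls) = enc_index c_p p @ comma_sep (map enc_list ls)"
| "enc_fm (Neg F) = [c_neg] @ enc_fm F"
| "enc_fm (Bin J F G) = [enc_conn J] @ enc_fm F @ enc_fm G"
| "enc_fm (Qu Q x F) = [enc_quant Q] @ enc_index c_v x @ enc_fm F"

section \<open>Axiomatized systems\<close>

definition axiomatized :: "math_sys \<Rightarrow> item list set \<Rightarrow> bool" where
  "axiomatized M L \<longleftrightarrow>
     mA M = UNIV \<and> mP M = UNIV \<and>
     (\<exists>k l. rA (mS M) = {..<k} \<and> rP (mS M) = {..<l}) \<and>
     rec_enum A17 (enc_fm ` mB M) \<and> rec_enum A17 (enc_list ` L)"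

section \<open>1-ary \<open>S\<^sub>1\<^sub>1\<close>-statements\<close>

definition initial_sys :: "nat \<Rightarrow> nat \<Rightarrow> fm list \<Rightarrow> rec_sys" where
  "initial_sys k l B = \<lparr>rA = {..<k}, rP = {..<l}, rB = B\<rparr>"

definition tally :: "nat \<Rightarrow> nat list" where
  "tally k = (if k = 0 then [c_box] else replicate k c_accent)"

definition basis_string :: "nat \<Rightarrow> nat \<Rightarrow> fm list \<Rightarrow> nat list" where
  "basis_string k l B = tally k @ [c_star] @ tally l @ [c_star] @
     (if B = [] then [c_box, c_star] else concat (map (\<lambda>F. enc_fm F @ [c_star]) B))"

definition represents :: "nat \<Rightarrow> nat \<Rightarrow> fm list \<Rightarrow> nat \<Rightarrow> item list \<Rightarrow> nat list \<Rightarrow> bool" where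
  "represents k l B i m s \<longleftrightarrow>
     recursive_system (initial_sys k l B) \<and> m \<in> list_terms UNIV \<and> var_list m = {} \<and>
     s = basis_string k l B @ enc_fm (Prd i [m])"

definition S11_statement :: "nat list \<Rightarrow> bool" where
  "S11_statement s \<longleftrightarrow> (\<exists>k l B i m. represents k l B i m s)"

definition S11_theorem :: "nat list \<Rightarrow> bool" where
  "S11_theorem s \<longleftrightarrow> (\<exists>k l B i m. represents k l B i m s \<and>
     is_prime {..<k} {..<l} (Prd i [m]) \<and> Prd i [m] \<in> r_derivable (initial_sys k l B))"

end

theory Submission
  imports Defs "HOL-Library.Countable"
begin

text \<open>
  Syntax is coded by binary trees, and enumerability is established for finite Horn clause programs
  over trees; such a program turns into a recursive system when trees are written as lists with one
  operation symbol. Provability in \<open>[M; L]\<close> is the least fixed point of such a program, tautologies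
  being recognized by splitting on truth values. The recursive systems that enumerate \<open>B\<^sub>M\<close> and \<open>L\<close>
  are not merged with it, which would entangle their equations; instead they are data of an
  interpreter for R-derivability. Unique readability of the encoding links strings and trees, and a
  model in the item lists shows that the resulting recursive system derives nothing more.

  For the second part, let \<open>T\<close> be a recursive system in which \<open>p\<^sub>3\<close> holds of a string \<open>y\<close> iff the negation
  of \<open>G\<close>, applied to the statement that \<open>p\<^sub>3\<close> holds of \<open>y\<close> in the system with R-basis string \<open>y\<close>,
  is provable. For the R-basis string of \<open>T\<close> itself this statement is a theorem iff its negated
  instance of \<open>G\<close> is provable, so by consistency it is no theorem and the instance is undecided.
\<close>

text \<open>Concatenation of lists can be undone in many ways, whereas a tree decomposes uniquely;
  this is what lets a clause be read as a rule of an inductive definition. Horn clauses have no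
  negation, so each negative condition of the calculus (distinct variables, a variable that is not
  free, a basis R-axiom with another conclusion) must first receive a positive inductive
  description. A recursive system derives more than its clauses suggest: equality axioms are always
  present, and any list may replace a variable. Hence the transfer has two unlike halves, ground
  instances for completeness and an interpretation over all lists for soundness. The diagonal
  argument rests on a uniformity: every system constructed here has 17 constants and 3 predicates,
  and the predicate that matters always has number 2. So the statement about \<open>y\<close> can be
  written down before the system itself is known. Consistency of \<open>[M; L]\<close> comes from
  the assumption on \<open>G\<close>: some statement is no theorem, and its instance of
  \<open>G\<close> is an unprovable formula.\<close>

datatype tree = Lf | Nd tree tree (infixr "\<cdot>" 65)

datatype pat = V nat | K tree | Pn pat pat (infixr "\<bullet>" 65)

fun inst :: "(nat \<Rightarrow> tree) \<Rightarrow> pat \<Rightarrow> tree" where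
  "inst v (V i) = v i"
| "inst v (K t) = t"
| "inst v (p \<bullet> q) = inst v p \<cdot> inst v q"

text \<open>\<open>Ora j\<close> queries the \<open>j\<close>-th set of a given list, while
  \<open>Own\<close> refers to the set being defined. Oracles let programs be composed through their
  specifications alone; they are eliminated once and for all in \<open>tree_re_ind\<close>.\<close>

datatype prem = Own pat | Ora nat pat

type_synonym clause = "prem list \<times> pat"

fun prem_holds :: "tree set list \<Rightarrow> tree set \<Rightarrow> (nat \<Rightarrow> tree) \<Rightarrow> prem \<Rightarrow> bool" where
  "prem_holds Os X v (Own p) \<longleftrightarrow> inst v p \<in> X"
| "prem_holds Os X v (Ora j p) \<longleftrightarrow> j < length Os \<and> inst v p \<in> Os ! j"

definition closed :: "tree set list \<Rightarrow> clause list \<Rightarrow> tree set \<Rightarrow> bool" where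
  "closed Os P X \<longleftrightarrow>
     (\<forall>(ps, c)\<in>set P. \<forall>v. (\<forall>q\<in>set ps. prem_holds Os X v q) \<longrightarrow> inst v c \<in> X)"

definition ind :: "tree set list \<Rightarrow> clause list \<Rightarrow> tree set" where
  "ind Os P = \<Inter>{X. closed Os P X}"

lemma prem_holds_mono: "prem_holds Os X v q \<Longrightarrow> X \<subseteq> Y \<Longrightarrow> prem_holds Os Y v q"
  by (cases q) auto

lemma ind_least: "closed Os P X \<Longrightarrow> ind Os P \<subseteq> X"
  by (auto simp: ind_def)

text \<open>Premises are positive, so a premise that holds in the intersection holds in every closed
  set.\<close>

lemma closed_ind: "closed Os P (ind Os P)"
  unfolding closed_def
proof (clarify)
  fix ps c v
  assume c: "(ps, c) \<in> set P" and h: "\<forall>q\<in>set ps. prem_holds Os (ind Os P) v q"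
  have "inst v c \<in> X" if "closed Os P X" for X
    using that c h prem_holds_mono[OF _ ind_least[OF that]] unfolding closed_def by fast
  then show "inst v c \<in> ind Os P" by (auto simp: ind_def)
qed

lemma closedD:
  "closed Os P X \<Longrightarrow> (ps, c) \<in> set P \<Longrightarrow> (\<And>q. q \<in> set ps \<Longrightarrow> prem_holds Os X v q) \<Longrightarrow> inst v c \<in> X"
  unfolding closed_def by fast

text \<open>Ten pattern variables suffice for every program below; instantiating the valuation by a list
  turns closedness into first-order rules.\<close>

definition rules :: "tree set list \<Rightarrow> clause list \<Rightarrow> tree set \<Rightarrow> bool" where
  [simp]: "rules Os P X \<longleftrightarrow>
    list_all (\<lambda>(ps, c). \<forall>x0 x1 x2 x3 x4 x5 x6 x7 x8 x9.
      (\<forall>q\<in>set ps. prem_holds Os X (nth [x0, x1, x2, x3, x4, x5, x6, x7, x8, x9]) q) \<longrightarrow>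
      inst (nth [x0, x1, x2, x3, x4, x5, x6, x7, x8, x9]) c \<in> X) P"

lemma closed_rules: "closed Os P X \<Longrightarrow> rules Os P X"
  unfolding closed_def rules_def list_all_iff by fast

section \<open>Typed data\<close>

text \<open>\<open>of_tree\<close> is total and need not be injective: each tree denotes some
  object, so soundness of a clause can be stated by decoding whatever trees its variables
  receive.\<close>

class tree_coded =
  fixes tree_of :: "'a \<Rightarrow> tree"
    and of_tree :: "tree \<Rightarrow> 'a"
  assumes of_tree_tree_of [simp]: "of_tree (tree_of x) = x"

instantiation nat :: tree_coded
begin
primrec tree_of_nat :: "nat \<Rightarrow> tree" where
  "tree_of_nat 0 = Lf"
| "tree_of_nat (Suc n) = Lf \<cdot> tree_of_nat n"
primrec of_tree_nat :: "tree \<Rightarrow> nat" where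
  "of_tree_nat Lf = 0"
| "of_tree_nat (a \<cdot> b) = Suc (of_tree_nat b)"
instance
proof
  show "of_tree (tree_of x) = x" for x :: nat by (induction x) auto
qed
end

text \<open>Tags stay folded, so that \<open>K (tree_of n)\<close> in a pattern and the tag in the
  code of an object agree literally.\<close>

declare tree_of_nat.simps [simp del]

instantiation prod :: (tree_coded, tree_coded) tree_coded
begin
definition tree_of_prod :: "'a \<times> 'b \<Rightarrow> tree" where
  "tree_of_prod p = tree_of (fst p) \<cdot> tree_of (snd p)"
definition of_tree_prod :: "tree \<Rightarrow> 'a \<times> 'b" where
  "of_tree_prod t = (case t of Lf \<Rightarrow> (of_tree Lf, of_tree Lf) | a \<cdot> b \<Rightarrow> (of_tree a, of_tree b))"
instance
  by standard (simp add: tree_of_prod_def of_tree_prod_def)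
end

lemma prod_coding [simp]:
  "tree_of (a, b) = tree_of a \<cdot> tree_of b" "of_tree (s \<cdot> t) = (of_tree s, of_tree t)"
  by (simp_all add: tree_of_prod_def of_tree_prod_def)

instantiation list :: (tree_coded) tree_coded
begin
primrec tree_of_list :: "'a list \<Rightarrow> tree" where
  "tree_of_list [] = Lf"
| "tree_of_list (x # xs) = tree_of x \<cdot> tree_of xs"
primrec of_tree_list :: "tree \<Rightarrow> 'a list" where
  "of_tree_list Lf = []"
| "of_tree_list (a \<cdot> b) = of_tree a # of_tree b"
instance
proof
  show "of_tree (tree_of x) = x" for x :: "'a list" by (induction x) auto
qed
end

primrec lft :: "tree \<Rightarrow> tree" where
  "lft Lf = Lf"
| "lft (a \<cdot> b) = a"

primrec rgt :: "tree \<Rightarrow> tree" where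
  "rgt Lf = Lf"
| "rgt (a \<cdot> b) = b"

lemma size_rgt: "size (rgt t) \<le> size t" and size_lft: "size (lft t) \<le> size t"
  by (cases t; simp)+

text \<open>The decoders of items and formulas reach their arguments by the total projections
  \<open>lft\<close> and \<open>rgt\<close>; these bounds show that they terminate.\<close>

lemma size_subtree [termination_simp]:
  "size (rgt t) < Suc (n + size t)" "size (lft (rgt t)) < Suc (n + size t)"
  "size (rgt (rgt t)) < Suc (n + size t)"
  using size_rgt[of t] size_lft[of "rgt t"] size_rgt[of "rgt t"] by linarith+

text \<open>Tags of datatype constructors are numbers; 1 is avoided because the simplifier would rewrite
  it to \<open>Suc 0\<close>.\<close>

fun tree_item :: "item \<Rightarrow> tree" where
  "tree_item (Cst a) = tree_of (0::nat) \<cdot> tree_of a"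
| "tree_item (Var x) = tree_of (2::nat) \<cdot> tree_of x"
| "tree_item (Op f l) = tree_of (3::nat) \<cdot> tree_of f \<cdot> foldr (\<cdot>) (map tree_item l) Lf"

fun item_tree :: "tree \<Rightarrow> item" and items_tree :: "tree \<Rightarrow> item list" where
  "item_tree Lf = Cst 0"
| "item_tree (s \<cdot> t) =
     (if of_tree s = (0::nat) then Cst (of_tree t)
      else if of_tree s = (2::nat) then Var (of_tree t)
      else Op (of_tree (lft t)) (items_tree (rgt t)))"
| "items_tree Lf = []"
| "items_tree (s \<cdot> t) = item_tree s # items_tree t"

lemma items_tree_foldr:
  "items_tree (foldr (\<cdot>) (map tree_item l) Lf) = map (\<lambda>i. item_tree (tree_item i)) l"
  by (induction l) auto

instantiation item :: tree_coded
begin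
definition tree_of_item :: "item \<Rightarrow> tree" where "tree_of_item = tree_item"
definition of_tree_item :: "tree \<Rightarrow> item" where "of_tree_item = item_tree"
instance
proof
  have "item_tree (tree_item i) = i" for i
  proof (induction i)
    case (Op f l)
    then have "map (\<lambda>i. item_tree (tree_item i)) l = l" by (simp add: map_idI)
    then show ?case by (simp add: items_tree_foldr)
  qed auto
  then show "of_tree (tree_of x) = x" for x :: item
    by (simp add: of_tree_item_def tree_of_item_def)
qed
end

text \<open>Codes of item lists had to be written out by hand above, because the list instance
  presupposes the item instance. From here on the two agree, and only the generic form is
  used.\<close>

lemma items_tree_eq: "items_tree t = of_tree t"
  by (induction t) (auto simp: of_tree_item_def)

lemma tree_items_eq: "foldr (\<cdot>) (map tree_item l) Lf = tree_of l"
  by (induction l) (auto simp: tree_of_item_def)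

lemma item_coding [simp]:
  "tree_of (Cst a) = tree_of (0::nat) \<cdot> tree_of a"
  "tree_of (Var x) = tree_of (2::nat) \<cdot> tree_of x"
  "tree_of (Op f l) = tree_of (3::nat) \<cdot> tree_of f \<cdot> tree_of l"
  "of_tree (tree_of (0::nat) \<cdot> t) = Cst (of_tree t)"
  "of_tree (tree_of (2::nat) \<cdot> t) = Var (of_tree t)"
  "of_tree (tree_of (3::nat) \<cdot> s \<cdot> t) = Op (of_tree s) (of_tree t)"
  by (simp_all add: of_tree_item_def tree_of_item_def tree_items_eq items_tree_eq)

instantiation conn :: tree_coded
begin
primrec tree_of_conn :: "conn \<Rightarrow> tree" where
  "tree_of_conn CImp = tree_of (0::nat)"
| "tree_of_conn CIff = tree_of (2::nat)"
| "tree_of_conn CAnd = tree_of (3::nat)"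
| "tree_of_conn COr = tree_of (4::nat)"
definition of_tree_conn :: "tree \<Rightarrow> conn" where
  "of_tree_conn t = (let n = of_tree t :: nat in
     if n = 0 then CImp else if n = 2 then CIff else if n = 3 then CAnd else COr)"
instance
proof
  show "of_tree (tree_of x) = x" for x :: conn by (cases x) (auto simp: of_tree_conn_def)
qed
end

instantiation quant :: tree_coded
begin
primrec tree_of_quant :: "quant \<Rightarrow> tree" where
  "tree_of_quant QAll = tree_of (0::nat)"
| "tree_of_quant QEx = tree_of (2::nat)"
definition of_tree_quant :: "tree \<Rightarrow> quant" where
  "of_tree_quant t = (if of_tree t = (0::nat) then QAll else QEx)"
instance
proof
  show "of_tree (tree_of x) = x" for x :: quant by (cases x) (auto simp: of_tree_quant_def)
qed
end

declare tree_of_conn.simps [simp del] tree_of_quant.simps [simp del]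

instantiation bool :: tree_coded
begin
definition tree_of_bool :: "bool \<Rightarrow> tree" where
  "tree_of_bool b = (if b then Lf \<cdot> Lf else Lf)"
definition of_tree_bool :: "tree \<Rightarrow> bool" where
  "of_tree_bool t \<longleftrightarrow> t \<noteq> Lf"
instance
  by standard (simp add: tree_of_bool_def of_tree_bool_def)
end

instantiation fm :: tree_coded
begin
fun tree_of_fm :: "fm \<Rightarrow> tree" where
  "tree_of_fm (Eq l m) = tree_of (0::nat) \<cdot> tree_of l \<cdot> tree_of m"
| "tree_of_fm (Prd p ls) = tree_of (2::nat) \<cdot> tree_of p \<cdot> tree_of ls"
| "tree_of_fm (Neg F) = tree_of (3::nat) \<cdot> tree_of_fm F"
| "tree_of_fm (Bin J F G) = tree_of (4::nat) \<cdot> tree_of J \<cdot> tree_of_fm F \<cdot> tree_of_fm G"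
| "tree_of_fm (Qu Q x F) = tree_of (5::nat) \<cdot> tree_of Q \<cdot> tree_of x \<cdot> tree_of_fm F"
fun of_tree_fm :: "tree \<Rightarrow> fm" where
  "of_tree_fm Lf = Eq [] []"
| "of_tree_fm (s \<cdot> t) =
    (if of_tree s = (0::nat) then Eq (of_tree (lft t)) (of_tree (rgt t))
     else if of_tree s = (2::nat) then Prd (of_tree (lft t)) (of_tree (rgt t))
     else if of_tree s = (3::nat) then Neg (of_tree_fm t)
     else if of_tree s = (4::nat)
       then Bin (of_tree (lft t)) (of_tree_fm (lft (rgt t))) (of_tree_fm (rgt (rgt t)))
     else Qu (of_tree (lft t)) (of_tree (lft (rgt t))) (of_tree_fm (rgt (rgt t))))"
instance
proof
  show "of_tree (tree_of x) = x" for x :: fm by (induction x) auto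
qed
end

declare of_tree_fm.simps [simp del]

lemma of_tree_fm_simps [simp]:
  "of_tree (tree_of (0::nat) \<cdot> s \<cdot> t) = Eq (of_tree s) (of_tree t)"
  "of_tree (tree_of (2::nat) \<cdot> s \<cdot> t) = Prd (of_tree s) (of_tree t)"
  "of_tree (tree_of (3::nat) \<cdot> s) = Neg (of_tree s)"
  "of_tree (tree_of (4::nat) \<cdot> r \<cdot> s \<cdot> t) = Bin (of_tree r) (of_tree s) (of_tree t)"
  "of_tree (tree_of (5::nat) \<cdot> r \<cdot> s \<cdot> t) = Qu (of_tree r) (of_tree s) (of_tree t)"
  by (simp_all add: of_tree_fm.simps)

section \<open>Recursively enumerable sets of trees\<close>

text \<open>A least fixed point may define several relations simultaneously; the tag selects one of
  them.\<close>

definition tree_re :: "tree set \<Rightarrow> bool" where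
  "tree_re T \<longleftrightarrow> (\<exists>P tag. T = {t. tag \<cdot> t \<in> ind [] P})"

text \<open>Each program moves under a root of its own. A query to oracle \<open>j\<close> goes to
  the root \<open>Lf \<cdot> tree_of j\<close>, below which \<open>tags j\<close> selects the wanted
  relation of that oracle's program.\<close>

fun relocate :: "(nat \<Rightarrow> tree) \<Rightarrow> tree \<Rightarrow> prem \<Rightarrow> prem" where
  "relocate tags own (Own p) = Own (K own \<bullet> p)"
| "relocate tags own (Ora j p) = Own (K (Lf \<cdot> tree_of j) \<bullet> K (tags j) \<bullet> p)"

text \<open>The programs of the oracles are put side by side under distinct tags.\<close>

lemma tree_re_ind:
  assumes "\<forall>T\<in>set Os. tree_re T"
  shows "tree_re (ind Os P)"
proof -
  have "\<forall>j. \<exists>Q tag. j < length Os \<longrightarrow> Os ! j = {t. tag \<cdot> t \<in> ind [] Q}"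
    using assms unfolding tree_re_def by (metis nth_mem)
  then obtain Q tags where Os: "\<And>j. j < length Os \<Longrightarrow> Os ! j = {t. tags j \<cdot> t \<in> ind [] (Q j)}"
    by metis
  define loc where "loc own = (\<lambda>(ps, c). (map (relocate tags own) ps, K own \<bullet> c))" for own
  define own where "own j = Lf \<cdot> tree_of (j::nat)" for j
  \<comment> \<open>Clauses with a premise that no available oracle can satisfy never fire. They are
    dropped: relocated, a query \<open>Ora i\<close> inside the program of an oracle could succeed
    under the root of oracle \<open>i\<close>.\<close>
  define P' where "P' = map (loc Lf) (filter (\<lambda>(ps, c). \<forall>j p. Ora j p \<in> set ps \<longrightarrow> j < length Os) P) @
    concat (map (\<lambda>j. map (loc (own j)) (filter (\<lambda>(ps, c). \<forall>i p. Ora i p \<notin> set ps) (Q j))) [0..<length Os])"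
  have own_inj: "own i = own j \<longleftrightarrow> i = j" for i j
    by (metis of_tree_tree_of own_def tree.inject)
  have mem: "(ps, c) \<in> set P' \<longleftrightarrow>
      (\<exists>qs d. (qs, d) \<in> set P \<and> (\<forall>j p. Ora j p \<in> set qs \<longrightarrow> j < length Os) \<and>
        ps = map (relocate tags Lf) qs \<and> c = K Lf \<bullet> d) \<or>
      (\<exists>j<length Os. \<exists>qs d. (qs, d) \<in> set (Q j) \<and> (\<forall>i p. Ora i p \<notin> set qs) \<and>
        ps = map (relocate tags (own j)) qs \<and> c = K (own j) \<bullet> d)" for ps c
  proof -
    have "set P' = loc Lf ` {(qs, d) \<in> set P. \<forall>j p. Ora j p \<in> set qs \<longrightarrow> j < length Os} \<union>
        (\<Union>j\<in>{..<length Os}. loc (own j) ` {(qs, d) \<in> set (Q j). \<forall>i p. Ora i p \<notin> set qs})"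
      by (simp add: P'_def atLeast0LessThan split_def)
    moreover have "(ps, c) \<in> loc t ` {(qs, d) \<in> A. R qs} \<longleftrightarrow>
        (\<exists>qs d. (qs, d) \<in> A \<and> R qs \<and> ps = map (relocate tags t) qs \<and> c = K t \<bullet> d)" for t A R
      by (auto simp: loc_def)
    ultimately show ?thesis by (simp add: Bex_def)
  qed
  \<comment> \<open>The disjoint union of the intended sets is closed, which bounds
    \<open>ind [] P'\<close> from above; the converse inclusions run each program inside
    \<open>P'\<close>.\<close>
  define X where "X = {Lf \<cdot> t | t. t \<in> ind Os P} \<union>
    {own j \<cdot> t | j t. j < length Os \<and> t \<in> ind [] (Q j)}"
  have "closed [] P' X"
    unfolding closed_def
  proof (clarify)
    fix ps c v
    assume c: "(ps, c) \<in> set P'" and h: "\<forall>q\<in>set ps. prem_holds [] X v q"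
    from c[unfolded mem] consider
      (P) qs d where "(qs, d) \<in> set P" "\<forall>j p. Ora j p \<in> set qs \<longrightarrow> j < length Os"
        "ps = map (relocate tags Lf) qs" "c = K Lf \<bullet> d"
    | (Q) j qs d where "j < length Os" "(qs, d) \<in> set (Q j)" "\<forall>i p. Ora i p \<notin> set qs"
        "ps = map (relocate tags (own j)) qs" "c = K (own j) \<bullet> d"
      by blast
    then show "inst v c \<in> X"
    proof cases
      case P
      have "prem_holds Os (ind Os P) v q" if q: "q \<in> set qs" for q
      proof (cases q)
        case (Own p)
        then show ?thesis using q h P by (force simp: X_def own_def)
      next
        case (Ora j p)
        then have "j < length Os" "own j \<cdot> tags j \<cdot> inst v p \<in> X" using q h P by (auto simp: own_def)
        then show ?thesis using Ora by (auto simp: X_def Os own_inj) (auto simp: own_def)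
      qed
      then have "inst v d \<in> ind Os P" using closedD[OF closed_ind] P by blast
      then show ?thesis using P by (simp add: X_def)
    next
      case Q
      have "prem_holds [] (ind [] (Q j)) v q" if q: "q \<in> set qs" for q
      proof (cases q)
        case (Own p)
        then have "own j \<cdot> inst v p \<in> X" using q h Q by auto
        then show ?thesis using Own by (auto simp: X_def own_inj) (auto simp: own_def)
      qed (use q Q in auto)
      then have "inst v d \<in> ind [] (Q j)" using closedD[OF closed_ind] Q by blast
      then show ?thesis using Q by (auto simp: X_def)
    qed
  qed
  then have le: "ind [] P' \<subseteq> X" by (rule ind_least)
  have Q_sub: "own j \<cdot> t \<in> ind [] P'" if j: "j < length Os" and "t \<in> ind [] (Q j)" for j t
  proof -
    have "closed [] (Q j) {t. own j \<cdot> t \<in> ind [] P'}"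
      unfolding closed_def
    proof (clarify)
      fix qs d v
      assume d: "(qs, d) \<in> set (Q j)" and h: "\<forall>q\<in>set qs. prem_holds [] {t. own j \<cdot> t \<in> ind [] P'} v q"
      have c: "(map (relocate tags (own j)) qs, K (own j) \<bullet> d) \<in> set P'"
        unfolding mem using d h j by fastforce
      have "prem_holds [] (ind [] P') v (relocate tags (own j) q)" if "q \<in> set qs" for q
        using h that by (cases q) auto
      then have "inst v (K (own j) \<bullet> d) \<in> ind [] P'"
        by (intro closedD[OF closed_ind c]) auto
      then show "own j \<cdot> inst v d \<in> ind [] P'" by simp
    qed
    then show ?thesis using ind_least that by blast
  qed
  have "closed Os P {t. Lf \<cdot> t \<in> ind [] P'}"
    unfolding closed_def
  proof (clarify)
    fix qs d v
    assume d: "(qs, d) \<in> set P" and h: "\<forall>q\<in>set qs. prem_holds Os {t. Lf \<cdot> t \<in> ind [] P'} v q"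
    have c: "(map (relocate tags Lf) qs, K Lf \<bullet> d) \<in> set P'"
      unfolding mem using d h by fastforce
    have "prem_holds [] (ind [] P') v (relocate tags Lf q)" if "q \<in> set qs" for q
      using bspec[OF h that] Q_sub by (cases q) (auto simp: Os own_def)
    then have "inst v (K Lf \<bullet> d) \<in> ind [] P'"
      by (intro closedD[OF closed_ind c]) auto
    then show "Lf \<cdot> inst v d \<in> ind [] P'" by simp
  qed
  from ind_least[OF this] le have "ind Os P = {t. Lf \<cdot> t \<in> ind [] P'}"
    by (auto simp: X_def own_def)
  then show ?thesis unfolding tree_re_def by blast
qed

lemma tree_re_instance:
  assumes "tree_re T"
  shows "tree_re {t. tag \<cdot> t \<in> T}"
proof -
  have "ind [T] [([Ora 0 (K tag \<bullet> V 0)], V 0)] = {t. tag \<cdot> t \<in> T}" (is "ind _ ?P = _")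
  proof
    show "ind [T] ?P \<subseteq> {t. tag \<cdot> t \<in> T}"
      by (rule ind_least) (simp add: closed_def)
    show "{t. tag \<cdot> t \<in> T} \<subseteq> ind [T] ?P"
      using closed_rules[OF closed_ind[of "[T]" ?P]] by auto
  qed
  then show ?thesis
    using tree_re_ind[of "[T]"] assms by (metis empty_iff empty_set insertE list.simps(15))
qed

section \<open>Recursively enumerable sets of coded objects\<close>

text \<open>The trees accepted by a program need not be codes, but all of them must decode to members;
  so no program has to check that its input is well-formed.\<close>

definition RE :: "'a::tree_coded set \<Rightarrow> bool" where
  "RE R \<longleftrightarrow> (\<exists>T. tree_re T \<and> (\<forall>t\<in>T. of_tree t \<in> R) \<and> (\<forall>x\<in>R. tree_of x \<in> T))"

lemma RE_E:
  assumes "RE R"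
  obtains T where "tree_re T" "\<And>t. t \<in> T \<Longrightarrow> of_tree t \<in> R" "\<And>x. x \<in> R \<Longrightarrow> tree_of x \<in> T"
  using assms unfolding RE_def by blast

text \<open>The scheme of nearly all correctness proofs below. Soundness: the trees that decode into
  \<open>R\<close> are closed under the clauses. Completeness: every set \<open>X\<close> satisfying
  the rules contains the codes of \<open>R\<close>, shown by induction on the object with the
  simplified rules as introduction rules.\<close>

lemma RE_I:
  assumes "\<forall>T\<in>set Os. tree_re T"
    and "closed Os P {t. of_tree t \<in> R}"
    and "\<And>X x. rules Os P X \<Longrightarrow> x \<in> R \<Longrightarrow> tree_of x \<in> X"
  shows "RE R"
  unfolding RE_def
  using tree_re_ind[OF assms(1)] ind_least[OF assms(2)] assms(3)[OF closed_rules[OF closed_ind]]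
  by blast

text \<open>For programs with auxiliary relations under other tags; the invariant \<open>X\<close>
  has to describe these relations too.\<close>

lemma RE_I_tag:
  assumes "\<forall>T\<in>set Os. tree_re T"
    and "closed Os P X"
    and "\<And>t. tag \<cdot> t \<in> X \<Longrightarrow> of_tree t \<in> R"
    and "\<And>X x. rules Os P X \<Longrightarrow> x \<in> R \<Longrightarrow> tag \<cdot> tree_of x \<in> X"
  shows "RE R"
  unfolding RE_def
  using tree_re_instance[OF tree_re_ind[OF assms(1)]] ind_least[OF assms(2)] assms(3)
    assms(4)[OF closed_rules[OF closed_ind]]
  by blast

lemma RE_UNIV: "RE (UNIV :: 'a::tree_coded set)"
  by (rule RE_I[where Os = "[]" and P = "[([], V 0)]"]) (auto simp: closed_def)

lemma RE_Int:
  assumes "RE A" "RE B"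
  shows "RE (A \<inter> B)"
proof -
  obtain S where S: "tree_re S" "\<And>t. t \<in> S \<Longrightarrow> of_tree t \<in> A" "\<And>x. x \<in> A \<Longrightarrow> tree_of x \<in> S"
    using assms(1) by (rule RE_E) blast
  obtain T where T: "tree_re T" "\<And>t. t \<in> T \<Longrightarrow> of_tree t \<in> B" "\<And>x. x \<in> B \<Longrightarrow> tree_of x \<in> T"
    using assms(2) by (rule RE_E) blast
  show ?thesis
    by (rule RE_I[where Os = "[S, T]" and P = "[([Ora 0 (V 0), Ora 1 (V 0)], V 0)]"])
      (use S T in \<open>auto simp: closed_def\<close>)
qed

lemma RE_Un:
  assumes "RE A" "RE B"
  shows "RE (A \<union> B)"
proof -
  obtain S where S: "tree_re S" "\<And>t. t \<in> S \<Longrightarrow> of_tree t \<in> A" "\<And>x. x \<in> A \<Longrightarrow> tree_of x \<in> S"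
    using assms(1) by (rule RE_E) blast
  obtain T where T: "tree_re T" "\<And>t. t \<in> T \<Longrightarrow> of_tree t \<in> B" "\<And>x. x \<in> B \<Longrightarrow> tree_of x \<in> T"
    using assms(2) by (rule RE_E) blast
  show ?thesis
    by (rule RE_I[where Os = "[S, T]" and P = "[([Ora 0 (V 0)], V 0), ([Ora 1 (V 0)], V 0)]"])
      (use S T in \<open>auto simp: closed_def\<close>)
qed

lemma RE_finite:
  assumes "finite A"
  shows "RE A"
proof -
  obtain xs where xs: "A = set xs" using assms finite_list by blast
  show ?thesis
    by (rule RE_I[where Os = "[]" and P = "map (\<lambda>x. ([], K (tree_of x))) xs"])
      (auto simp: closed_def xs list_all_iff)
qed

section \<open>Programs for the syntactic operations\<close>

text \<open>Inequality is generated from below on unary numerals: zero differs from every successor,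
  and successors inherit inequality. All other negative tests are built on such comparisons or on
  substitution.\<close>

lemma RE_neq: "RE {(m::nat, n). m \<noteq> n}"
proof (rule RE_I[where Os = "[]" and P = "[([], K Lf \<bullet> K Lf \<bullet> V 0), ([], (K Lf \<bullet> V 0) \<bullet> K Lf),
    ([Own (V 0 \<bullet> V 1)], (K Lf \<bullet> V 0) \<bullet> K Lf \<bullet> V 1)]"], goal_cases)
  case (3 X x)
  note r = 3(1)[simplified]
  have "m \<noteq> n \<Longrightarrow> tree_of m \<cdot> tree_of n \<in> X" for m n :: nat
  proof (induction m arbitrary: n)
    case 0
    then show ?case using r by (cases n) (auto simp: tree_of_nat.simps)
  next
    case (Suc m)
    then show ?case using r by (cases n) (auto simp: tree_of_nat.simps)
  qed
  then show ?case using 3(2) by auto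
qed (simp_all add: closed_def)

lemma RE_append: "RE {(l :: 'a::tree_coded list, m, r). r = l @ m}"
proof (rule RE_I[where Os = "[]" and P = "[([], K Lf \<bullet> V 0 \<bullet> V 0),
    ([Own (V 0 \<bullet> V 1 \<bullet> V 2)], (V 3 \<bullet> V 0) \<bullet> V 1 \<bullet> V 3 \<bullet> V 2)]"], goal_cases)
  case (3 X x)
  note r = 3(1)[simplified]
  have "tree_of l \<cdot> tree_of m \<cdot> tree_of (l @ m) \<in> X" for l m :: "'a list"
    by (induction l) (use r in auto)
  then show ?case using 3(2) by auto
qed (simp_all add: closed_def)

text \<open>The elimination rules for tuples give oracles in curried form, matching the patterns of
  the clauses that query them.\<close>

lemma RE_E1:
  assumes "RE {a. P a}"
  obtains T where "tree_re T" "\<And>a. a \<in> T \<Longrightarrow> P (of_tree a)" "\<And>a. P a \<Longrightarrow> tree_of a \<in> T"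
  using assms by (fastforce elim!: RE_E)

lemma RE_E2:
  assumes "RE {(a, b). P a b}"
  obtains T where "tree_re T" "\<And>a b. a \<cdot> b \<in> T \<Longrightarrow> P (of_tree a) (of_tree b)"
    "\<And>a b. P a b \<Longrightarrow> tree_of a \<cdot> tree_of b \<in> T"
  using assms by (fastforce elim!: RE_E)

lemma RE_E3:
  assumes "RE {(a, b, c). P a b c}"
  obtains T where "tree_re T"
    "\<And>a b c. a \<cdot> b \<cdot> c \<in> T \<Longrightarrow> P (of_tree a) (of_tree b) (of_tree c)"
    "\<And>a b c. P a b c \<Longrightarrow> tree_of a \<cdot> tree_of b \<cdot> tree_of c \<in> T"
  using assms by (fastforce elim!: RE_E)

lemma RE_E4:
  assumes "RE {(a, b, c, d). P a b c d}"
  obtains T where "tree_re T"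
    "\<And>a b c d. a \<cdot> b \<cdot> c \<cdot> d \<in> T \<Longrightarrow> P (of_tree a) (of_tree b) (of_tree c) (of_tree d)"
    "\<And>a b c d. P a b c d \<Longrightarrow> tree_of a \<cdot> tree_of b \<cdot> tree_of c \<cdot> tree_of d \<in> T"
  using assms by (fastforce elim!: RE_E)

lemma RE_E5:
  assumes "RE {(a, b, c, d, e). P a b c d e}"
  obtains T where "tree_re T"
    "\<And>a b c d e. a \<cdot> b \<cdot> c \<cdot> d \<cdot> e \<in> T \<Longrightarrow> P (of_tree a) (of_tree b) (of_tree c) (of_tree d) (of_tree e)"
    "\<And>a b c d e. P a b c d e \<Longrightarrow> tree_of a \<cdot> tree_of b \<cdot> tree_of c \<cdot> tree_of d \<cdot> tree_of e \<in> T"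
proof -
  obtain T where T: "tree_re T" "\<And>t. t \<in> T \<Longrightarrow> of_tree t \<in> {(a, b, c, d, e). P a b c d e}"
    "\<And>x. x \<in> {(a, b, c, d, e). P a b c d e} \<Longrightarrow> tree_of x \<in> T"
    using assms by (rule RE_E) blast
  show thesis
  proof (rule that[OF T(1)])
    show "P (of_tree a) (of_tree b) (of_tree c) (of_tree d) (of_tree e)" if "a \<cdot> b \<cdot> c \<cdot> d \<cdot> e \<in> T" for a b c d e
      using T(2)[OF that] by simp
    show "tree_of a \<cdot> tree_of b \<cdot> tree_of c \<cdot> tree_of d \<cdot> tree_of e \<in> T" if "P a b c d e" for a b c d e
      using T(3)[of "(a, b, c, d, e)"] that by simp
  qed
qed

abbreviation pTag :: "nat \<Rightarrow> pat" where "pTag n \<equiv> K (tree_of n)"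
abbreviation pNil :: pat where "pNil \<equiv> K Lf"
abbreviation pCst :: "pat \<Rightarrow> pat" where "pCst p \<equiv> pTag 0 \<bullet> p"
abbreviation pVar :: "pat \<Rightarrow> pat" where "pVar p \<equiv> pTag 2 \<bullet> p"
abbreviation pOp :: "pat \<Rightarrow> pat \<Rightarrow> pat" where "pOp p q \<equiv> pTag 3 \<bullet> p \<bullet> q"
abbreviation pEq :: "pat \<Rightarrow> pat \<Rightarrow> pat" where "pEq p q \<equiv> pTag 0 \<bullet> p \<bullet> q"
abbreviation pPrd :: "pat \<Rightarrow> pat \<Rightarrow> pat" where "pPrd p q \<equiv> pTag 2 \<bullet> p \<bullet> q"
abbreviation pNeg :: "pat \<Rightarrow> pat" where "pNeg p \<equiv> pTag 3 \<bullet> p"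
abbreviation pBin :: "pat \<Rightarrow> pat \<Rightarrow> pat \<Rightarrow> pat" where "pBin j p q \<equiv> pTag 4 \<bullet> j \<bullet> p \<bullet> q"
abbreviation pImp :: "pat \<Rightarrow> pat \<Rightarrow> pat" where "pImp \<equiv> pBin (K (tree_of CImp))"
abbreviation pQu :: "pat \<Rightarrow> pat \<Rightarrow> pat \<Rightarrow> pat" where "pQu r p q \<equiv> pTag 5 \<bullet> r \<bullet> p \<bullet> q"

section \<open>Substitution, occurrence of variables and collision-freeness\<close>

lemma sbL_simps [simp]:
  "sbL [] m x = []"
  "sbL (i # l) m x = sb_item m x i @ sbL l m x"
  by (simp_all add: sbL_def)

lemma sbL_append [simp]: "sbL (l @ k) m x = sbL l m x @ sbL k m x"
  by (induction l) auto

lemma sb_item_Op [simp]: "sb_item m x (Op f l) = [Op f (sbL l m x)]"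
  by (simp add: sbL_def)

declare sb_item.simps(3) [simp del]

text \<open>\<open>Op\<close> nests lists inside items. Induction on the total size yields
  hypotheses both for the rest of the list and for the argument of \<open>Op\<close>, so properties
  of lists need no companion statement about items.\<close>

lemma items_induct [case_names Nil Cst Var Op]:
  assumes "P []" "\<And>a l. P l \<Longrightarrow> P (Cst a # l)" "\<And>x l. P l \<Longrightarrow> P (Var x # l)"
    "\<And>f k l. P k \<Longrightarrow> P l \<Longrightarrow> P (Op f k # l)"
  shows "P l"
proof (induction "size_list size l" arbitrary: l rule: less_induct)
  case less
  show ?case
  proof (cases l)
    case (Cons i k)
    then show ?thesis using assms less by (cases i) auto
  qed (use assms in auto)
qed

lemma RE_sbL: "RE {(l, m, x, r). r = sbL l m x}"
proof -
  obtain N where N: "tree_re N" "\<And>a b. a \<cdot> b \<in> N \<Longrightarrow> (of_tree a :: nat) \<noteq> of_tree b"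
    "\<And>a b :: nat. a \<noteq> b \<Longrightarrow> tree_of a \<cdot> tree_of b \<in> N"
    using RE_neq by (rule RE_E2) blast
  obtain A where A: "tree_re A"
    "\<And>a b c. a \<cdot> b \<cdot> c \<in> A \<Longrightarrow> (of_tree c :: item list) = of_tree a @ of_tree b"
    "\<And>a b c :: item list. c = a @ b \<Longrightarrow> tree_of a \<cdot> tree_of b \<cdot> tree_of c \<in> A"
    using RE_append by (rule RE_E3) blast
  show ?thesis
  proof (rule RE_I[where Os = "[N, A]" and P = "[
      ([], pNil \<bullet> V 0 \<bullet> V 1 \<bullet> pNil),
      ([Own (V 0 \<bullet> V 1 \<bullet> V 2 \<bullet> V 3)], (pCst (V 4) \<bullet> V 0) \<bullet> V 1 \<bullet> V 2 \<bullet> pCst (V 4) \<bullet> V 3),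
      ([Own (V 0 \<bullet> V 1 \<bullet> V 2 \<bullet> V 3), Ora 1 (V 1 \<bullet> V 3 \<bullet> V 4)],
        (pVar (V 2) \<bullet> V 0) \<bullet> V 1 \<bullet> V 2 \<bullet> V 4),
      ([Own (V 0 \<bullet> V 1 \<bullet> V 2 \<bullet> V 3), Ora 0 (V 4 \<bullet> V 2)],
        (pVar (V 4) \<bullet> V 0) \<bullet> V 1 \<bullet> V 2 \<bullet> pVar (V 4) \<bullet> V 3),
      ([Own (V 0 \<bullet> V 1 \<bullet> V 2 \<bullet> V 3), Own (V 4 \<bullet> V 1 \<bullet> V 2 \<bullet> V 5)],
        (pOp (V 6) (V 4) \<bullet> V 0) \<bullet> V 1 \<bullet> V 2 \<bullet> pOp (V 6) (V 5) \<bullet> V 3)]"], goal_cases)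
    case 1
    show ?case using N(1) A(1) by simp
  next
    case 2
    then show ?case using N(2) A(2) by (auto simp: closed_def)
  next
    case (3 X y)
    note r = 3(1)[simplified]
    have "tree_of l \<cdot> tree_of m \<cdot> tree_of x \<cdot> tree_of (sbL l m x) \<in> X" for l m x
    proof (induction l rule: items_induct)
      case (Var y l)
      show ?case
      proof (cases "y = x")
        case True
        then show ?thesis using r Var A(3)[of "m @ sbL l m x" m "sbL l m x"] by auto
      qed (use r Var N(3) in auto)
    qed (use r in auto)
    then show ?case using 3(2) by auto
  qed
qed

lemma RE_map_sbL: "RE {(ls, m, x, rs). rs = map (\<lambda>l. sbL l m x) ls}"
proof -
  obtain S where S: "tree_re S"
    "\<And>a b c d. a \<cdot> b \<cdot> c \<cdot> d \<in> S \<Longrightarrow> of_tree d = sbL (of_tree a) (of_tree b) (of_tree c)"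
    "\<And>a b c d. d = sbL a b c \<Longrightarrow> tree_of a \<cdot> tree_of b \<cdot> tree_of c \<cdot> tree_of d \<in> S"
    using RE_sbL by (rule RE_E4) blast
  show ?thesis
  proof (rule RE_I[where Os = "[S]" and P = "[
      ([], pNil \<bullet> V 0 \<bullet> V 1 \<bullet> pNil),
      ([Own (V 0 \<bullet> V 1 \<bullet> V 2 \<bullet> V 3), Ora 0 (V 4 \<bullet> V 1 \<bullet> V 2 \<bullet> V 5)],
        (V 4 \<bullet> V 0) \<bullet> V 1 \<bullet> V 2 \<bullet> V 5 \<bullet> V 3)]"], goal_cases)
    case 2
    then show ?case using S(2) by (auto simp: closed_def)
  next
    case (3 X y)
    note r = 3(1)[simplified]
    have "tree_of ls \<cdot> tree_of m \<cdot> tree_of x \<cdot> tree_of (map (\<lambda>l. sbL l m x) ls) \<in> X" for ls m x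
      by (induction ls) (use r S(3) in auto)
    then show ?case using 3(2) by auto
  qed (use S(1) in simp)
qed

lemma RE_sbF: "RE {(F, m, x, H). H = sbF F m x}"
proof -
  obtain N where N: "tree_re N" "\<And>a b. a \<cdot> b \<in> N \<Longrightarrow> (of_tree a :: nat) \<noteq> of_tree b"
    "\<And>a b :: nat. a \<noteq> b \<Longrightarrow> tree_of a \<cdot> tree_of b \<in> N"
    using RE_neq by (rule RE_E2) blast
  obtain S where S: "tree_re S"
    "\<And>a b c d. a \<cdot> b \<cdot> c \<cdot> d \<in> S \<Longrightarrow> of_tree d = sbL (of_tree a) (of_tree b) (of_tree c)"
    "\<And>a b c d. d = sbL a b c \<Longrightarrow> tree_of a \<cdot> tree_of b \<cdot> tree_of c \<cdot> tree_of d \<in> S"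
    using RE_sbL by (rule RE_E4) blast
  obtain W where W: "tree_re W"
    "\<And>a b c d. a \<cdot> b \<cdot> c \<cdot> d \<in> W \<Longrightarrow> of_tree d = map (\<lambda>l. sbL l (of_tree b) (of_tree c)) (of_tree a)"
    "\<And>a b c d. d = map (\<lambda>l. sbL l b c) a \<Longrightarrow> tree_of a \<cdot> tree_of b \<cdot> tree_of c \<cdot> tree_of d \<in> W"
    using RE_map_sbL by (rule RE_E4) blast
  show ?thesis
  proof (rule RE_I[where Os = "[N, S, W]" and P = "[
      ([Ora 1 (V 0 \<bullet> V 2 \<bullet> V 3 \<bullet> V 4), Ora 1 (V 1 \<bullet> V 2 \<bullet> V 3 \<bullet> V 5)],
        pEq (V 0) (V 1) \<bullet> V 2 \<bullet> V 3 \<bullet> pEq (V 4) (V 5)),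
      ([Ora 2 (V 0 \<bullet> V 2 \<bullet> V 3 \<bullet> V 4)], pPrd (V 1) (V 0) \<bullet> V 2 \<bullet> V 3 \<bullet> pPrd (V 1) (V 4)),
      ([Own (V 0 \<bullet> V 2 \<bullet> V 3 \<bullet> V 4)], pNeg (V 0) \<bullet> V 2 \<bullet> V 3 \<bullet> pNeg (V 4)),
      ([Own (V 0 \<bullet> V 2 \<bullet> V 3 \<bullet> V 4), Own (V 1 \<bullet> V 2 \<bullet> V 3 \<bullet> V 5)],
        pBin (V 6) (V 0) (V 1) \<bullet> V 2 \<bullet> V 3 \<bullet> pBin (V 6) (V 4) (V 5)),
      ([], pQu (V 0) (V 3) (V 1) \<bullet> V 2 \<bullet> V 3 \<bullet> pQu (V 0) (V 3) (V 1)),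
      ([Ora 0 (V 5 \<bullet> V 3), Own (V 1 \<bullet> V 2 \<bullet> V 3 \<bullet> V 4)],
        pQu (V 0) (V 5) (V 1) \<bullet> V 2 \<bullet> V 3 \<bullet> pQu (V 0) (V 5) (V 4))]"], goal_cases)
    case 1
    show ?case using N(1) S(1) W(1) by simp
  next
    case 2
    then show ?case using N(2) S(2) W(2) by (auto simp: closed_def)
  next
    case (3 X y)
    note r = 3(1)[simplified]
    have "tree_of F \<cdot> tree_of m \<cdot> tree_of x \<cdot> tree_of (sbF F m x) \<in> X" for F m x
      by (induction F) (use r N(3) S(3) W(3) in auto)
    then show ?case using 3(2) by auto
  qed
qed

lemma sbL_Cst_idem_iff: "sbL l [Cst 0] x = l \<longleftrightarrow> x \<notin> var_list l"
  by (induction l rule: items_induct) (auto simp: var_list_def)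

text \<open>Absence of a variable becomes a positive condition, which a program can test.\<close>

lemma sbF_Cst_idem_iff: "sbF F [Cst 0] x = F \<longleftrightarrow> x \<notin> free F"
proof (induction F)
  case (Prd p ls)
  show ?case by (induction ls) (auto simp: sbL_Cst_idem_iff)
qed (auto simp: sbL_Cst_idem_iff)

text \<open>In a prime formula every occurrence is free, so there the substitution test applies; a
  quantifier adds only a comparison with its variable.\<close>

lemma RE_notin_var: "RE {(x, F). x \<notin> var_fm F}"
proof -
  obtain N where N: "tree_re N" "\<And>a b. a \<cdot> b \<in> N \<Longrightarrow> (of_tree a :: nat) \<noteq> of_tree b"
    "\<And>a b :: nat. a \<noteq> b \<Longrightarrow> tree_of a \<cdot> tree_of b \<in> N"
    using RE_neq by (rule RE_E2) blast
  obtain S where S: "tree_re S"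
    "\<And>a b c d. a \<cdot> b \<cdot> c \<cdot> d \<in> S \<Longrightarrow> of_tree d = sbF (of_tree a) (of_tree b) (of_tree c)"
    "\<And>a b c d. d = sbF a b c \<Longrightarrow> tree_of a \<cdot> tree_of b \<cdot> tree_of c \<cdot> tree_of d \<in> S"
    using RE_sbF by (rule RE_E4) blast
  have S': "of_tree a \<notin> free (of_tree b)" if "b \<cdot> (tree_of [Cst 0]) \<cdot> a \<cdot> b \<in> S" for a b
    using S(2)[OF that] sbF_Cst_idem_iff by (metis of_tree_tree_of)
  note S' = S'[simplified]
  have S'': "tree_of F \<cdot> (tree_of [Cst 0]) \<cdot> tree_of x \<cdot> tree_of F \<in> S" if "x \<notin> free F" for x F
    by (rule S(3)) (metis that sbF_Cst_idem_iff)
  show ?thesis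
  proof (rule RE_I[where Os = "[N, S]" and P = "[
      ([Ora 1 (pEq (V 1) (V 2) \<bullet> K (tree_of [Cst 0]) \<bullet> V 0 \<bullet> pEq (V 1) (V 2))], V 0 \<bullet> pEq (V 1) (V 2)),
      ([Ora 1 (pPrd (V 1) (V 2) \<bullet> K (tree_of [Cst 0]) \<bullet> V 0 \<bullet> pPrd (V 1) (V 2))], V 0 \<bullet> pPrd (V 1) (V 2)),
      ([Own (V 0 \<bullet> V 1)], V 0 \<bullet> pNeg (V 1)),
      ([Own (V 0 \<bullet> V 1), Own (V 0 \<bullet> V 2)], V 0 \<bullet> pBin (V 3) (V 1) (V 2)),
      ([Own (V 0 \<bullet> V 1), Ora 0 (V 0 \<bullet> V 2)], V 0 \<bullet> pQu (V 3) (V 2) (V 1))]"], goal_cases)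
    case 2
    then show ?case by (auto simp: closed_def dest!: S' N(2))
  next
    case (3 X y)
    note r = 3(1)[simplified]
    have "x \<notin> var_fm F \<Longrightarrow> tree_of x \<cdot> tree_of F \<in> X" for F x
    proof (induction F)
      case (Eq l m)
      then show ?case using r S''[of x "Eq l m"] by auto
    next
      case (Prd p ls)
      then show ?case using r S''[of x "Prd p ls"] by auto
    qed (use r N(3) in auto)
    then show ?case using 3(2) by auto
  qed (use N(1) S(1) in simp)
qed

text \<open>The disjunction at a quantifier becomes two clauses. Its first alternative says that
  \<open>x\<close> is not free in the quantified formula itself. In the second, the formula
  \<open>Eq m m\<close> turns the condition \<open>y \<notin> var_list m\<close> into one about free
  variables, so the same substitution test serves both.\<close>

lemma RE_CF: "RE {(F, m, x). CF F m x}"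
proof -
  obtain S where S: "tree_re S"
    "\<And>a b c d. a \<cdot> b \<cdot> c \<cdot> d \<in> S \<Longrightarrow> of_tree d = sbF (of_tree a) (of_tree b) (of_tree c)"
    "\<And>a b c d. d = sbF a b c \<Longrightarrow> tree_of a \<cdot> tree_of b \<cdot> tree_of c \<cdot> tree_of d \<in> S"
    using RE_sbF by (rule RE_E4) blast
  have S': "of_tree a \<notin> free (of_tree b)" if "b \<cdot> (tree_of [Cst 0]) \<cdot> a \<cdot> b \<in> S" for a b
    using S(2)[OF that] sbF_Cst_idem_iff by (metis of_tree_tree_of)
  note S' = S'[simplified]
  have S'': "tree_of F \<cdot> (tree_of [Cst 0]) \<cdot> tree_of x \<cdot> tree_of F \<in> S" if "x \<notin> free F" for x F
    by (rule S(3)) (metis that sbF_Cst_idem_iff)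
  show ?thesis
  proof (rule RE_I[where Os = "[S]" and P = "[
      ([], pEq (V 0) (V 1) \<bullet> V 2 \<bullet> V 3),
      ([], pPrd (V 0) (V 1) \<bullet> V 2 \<bullet> V 3),
      ([Own (V 0 \<bullet> V 2 \<bullet> V 3)], pNeg (V 0) \<bullet> V 2 \<bullet> V 3),
      ([Own (V 0 \<bullet> V 2 \<bullet> V 3), Own (V 1 \<bullet> V 2 \<bullet> V 3)], pBin (V 4) (V 0) (V 1) \<bullet> V 2 \<bullet> V 3),
      ([Ora 0 (pQu (V 4) (V 5) (V 0) \<bullet> K (tree_of [Cst 0]) \<bullet> V 3 \<bullet> pQu (V 4) (V 5) (V 0))],
        pQu (V 4) (V 5) (V 0) \<bullet> V 2 \<bullet> V 3),
      ([Ora 0 (pEq (V 2) (V 2) \<bullet> K (tree_of [Cst 0]) \<bullet> V 5 \<bullet> pEq (V 2) (V 2)),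
        Own (V 0 \<bullet> V 2 \<bullet> V 3)], pQu (V 4) (V 5) (V 0) \<bullet> V 2 \<bullet> V 3)]"], goal_cases)
    case 2
    then show ?case by (auto simp: closed_def dest!: S')
  next
    case (3 X y)
    note r = 3(1)[simplified]
    have "CF F m x \<Longrightarrow> tree_of F \<cdot> tree_of m \<cdot> tree_of x \<in> X" for F m x
    proof (induction F)
      case (Qu Q y F)
      then show ?case
        using r S''[of x "Qu Q y F"] S''[of y "Eq m m"] by auto
    qed (use r in auto)
    then show ?case using 3(2) by auto
  qed (use S(1) in simp)
qed

section \<open>Encoding as a program\<close>

lemma enc_list_simps [simp]:
  "enc_list [] = []"
  "enc_list (i # l) = enc_item i @ enc_list l"
  "enc_list (l @ m) = enc_list l @ enc_list m"
  by (simp_all add: enc_list_def)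

lemma enc_item_Op [simp]:
  "enc_item (Op f l) = enc_index c_a f @ [c_lpar] @ enc_list l @ [c_rpar]"
  by (simp add: enc_list_def)

declare enc_item.simps(3) [simp del]

lemma RE_accents: "RE {(n, r, s). s = replicate n (Cst c_accent) @ r}"
proof (rule RE_I[where Os = "[]" and P = "[([], K Lf \<bullet> V 0 \<bullet> V 0),
    ([Own (V 0 \<bullet> V 1 \<bullet> V 2)], (K Lf \<bullet> V 0) \<bullet> V 1 \<bullet> K (tree_of (Cst c_accent)) \<bullet> V 2)]"], goal_cases)
  case (3 X x)
  note r = 3(1)[simplified]
  have "tree_of n \<cdot> tree_of r \<cdot> tree_of (replicate n (Cst c_accent) @ r) \<in> X" for n and r :: "item list"
    by (induction n) (use r in \<open>auto simp: tree_of_nat.simps\<close>)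
  then show ?case using 3(2) by auto
qed (simp_all add: closed_def)

text \<open>The encoding is written in front of an arbitrary rest \<open>r\<close>, so that
  encodings of consecutive pieces are chained without appending strings. Strings appear as lists of
  \<open>Cst\<close> items, the form in which R-derivations handle them. Only well-formed lists are
  accepted, which supplies the nonemptiness used when the relation is inverted.\<close>

lemma RE_enc_list: "RE {(l, r, s). l \<in> list_terms UNIV \<and> s = as_list (enc_list l) @ r}"
proof -
  obtain A where A: "tree_re A"
    "\<And>a b c. a \<cdot> b \<cdot> c \<in> A \<Longrightarrow> (of_tree c :: item list) = of_tree a @ of_tree b"
    "\<And>a b c :: item list. c = a @ b \<Longrightarrow> tree_of a \<cdot> tree_of b \<cdot> tree_of c \<in> A"
    using RE_append by (rule RE_E3) blast
  obtain I where I: "tree_re I"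
    "\<And>a b c. a \<cdot> b \<cdot> c \<in> I \<Longrightarrow> (of_tree c :: item list) = replicate (of_tree a) (Cst c_accent) @ of_tree b"
    "\<And>a b c. c = replicate a (Cst c_accent) @ b \<Longrightarrow> tree_of a \<cdot> tree_of b \<cdot> tree_of c \<in> I"
    using RE_accents by (rule RE_E3) blast
  let ?idx = "\<lambda>c p. K (tree_of (Cst c)) \<bullet> K (tree_of (Cst c_accent)) \<bullet> p"
  show ?thesis
  proof (rule RE_I[where Os = "[A, I]" and P = "[
      ([Ora 1 (V 0 \<bullet> V 1 \<bullet> V 2)], (pCst (V 0) \<bullet> pNil) \<bullet> V 1 \<bullet> ?idx c_a (V 2)),
      ([Ora 1 (V 0 \<bullet> V 1 \<bullet> V 2)], (pVar (V 0) \<bullet> pNil) \<bullet> V 1 \<bullet> ?idx c_v (V 2)),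
      ([Own (V 0 \<bullet> (K (tree_of (Cst c_rpar)) \<bullet> V 1) \<bullet> V 2),
        Ora 1 (V 3 \<bullet> (K (tree_of (Cst c_lpar)) \<bullet> V 2) \<bullet> V 4)],
        (pOp (V 3) (V 0) \<bullet> pNil) \<bullet> V 1 \<bullet> ?idx c_a (V 4)),
      ([Own (V 0 \<bullet> V 1 \<bullet> V 2), Own (V 3 \<bullet> V 2 \<bullet> V 4), Ora 0 (V 3 \<bullet> V 0 \<bullet> V 5)],
        V 5 \<bullet> V 1 \<bullet> V 4)]"], goal_cases)
    case 2
    show ?case
      by (auto simp: closed_def enc_index_def list_terms.intros dest!: A(2) I(2))
  next
    case (3 X y)
    note r = 3(1)[simplified]
    note atoms = r[THEN conjunct1] r[THEN conjunct2, THEN conjunct1]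
      r[THEN conjunct2, THEN conjunct2, THEN conjunct1]
    note conc_rule = r[THEN conjunct2, THEN conjunct2, THEN conjunct2, rule_format, OF conjI[OF _ conjI]]
    have "l \<in> list_terms UNIV \<Longrightarrow> tree_of l \<cdot> tree_of r \<cdot> tree_of (as_list (enc_list l) @ r) \<in> X" for l r
    proof (induction l arbitrary: r rule: list_terms.induct)
      case (op f l)
      have "tree_of l \<cdot> ((tree_of (0::nat) \<cdot> tree_of c_rpar) \<cdot> tree_of r) \<cdot>
          tree_of (as_list (enc_list l) @ Cst c_rpar # r) \<in> X"
        using op(3)[of "Cst c_rpar # r"] by simp
      moreover have "tree_of f \<cdot> ((tree_of (0::nat) \<cdot> tree_of c_lpar) \<cdot> tree_of (as_list (enc_list l) @ Cst c_rpar # r)) \<cdot>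
          tree_of (replicate f (Cst c_accent) @ Cst c_lpar # as_list (enc_list l) @ Cst c_rpar # r) \<in> I"
        using I(3)[OF refl, of f "Cst c_lpar # as_list (enc_list l) @ Cst c_rpar # r"] by simp
      ultimately show ?case
        using atoms(3)[rule_format, OF conjI] by (simp add: enc_index_def)
    next
      case (conc l m)
      show ?case
        using conc_rule[OF conc(4)[of r] conc(3)[of "as_list (enc_list m) @ r"] A(3)[OF refl, of l m]]
        by simp
    qed (use atoms(1,2) I(3) in \<open>auto simp: enc_index_def\<close>)
    then show ?case using 3(2) by auto
  qed (use A(1) I(1) in simp)
qed

lemma RE_enc_args:
  "RE {(ls, r, s). set ls \<subseteq> list_terms UNIV \<and> s = as_list (comma_sep (map enc_list ls)) @ r}"
proof -
  obtain E where E: "tree_re E"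
    "\<And>a b c. a \<cdot> b \<cdot> c \<in> E \<Longrightarrow> of_tree a \<in> list_terms UNIV \<and> of_tree c = as_list (enc_list (of_tree a)) @ of_tree b"
    "\<And>a b c. a \<in> list_terms UNIV \<and> c = as_list (enc_list a) @ b \<Longrightarrow> tree_of a \<cdot> tree_of b \<cdot> tree_of c \<in> E"
    using RE_enc_list by (rule RE_E3) blast
  show ?thesis
  proof (rule RE_I[where Os = "[E]" and P = "[
      ([], pNil \<bullet> V 0 \<bullet> V 0),
      ([Ora 0 (V 0 \<bullet> V 1 \<bullet> V 2)], (V 0 \<bullet> pNil) \<bullet> V 1 \<bullet> V 2),
      ([Own ((V 0 \<bullet> V 1) \<bullet> V 2 \<bullet> V 3), Ora 0 (V 4 \<bullet> (K (tree_of (Cst c_comma)) \<bullet> V 3) \<bullet> V 5)],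
        (V 4 \<bullet> V 0 \<bullet> V 1) \<bullet> V 2 \<bullet> V 5)]"], goal_cases)
    case 2
    then show ?case by (auto simp: closed_def dest!: E(2))
  next
    case (3 X y)
    note r = 3(1)[simplified]
    have "set ls \<subseteq> list_terms UNIV \<Longrightarrow>
      tree_of ls \<cdot> tree_of r \<cdot> tree_of (as_list (comma_sep (map enc_list ls)) @ r) \<in> X" for ls r
    proof (induction ls rule: induct_list012)
      case (3 l k ls)
      then show ?case using r
        E(3)[of l "as_list (enc_list l) @ Cst c_comma # as_list (comma_sep (map enc_list (k # ls))) @ r"
          "Cst c_comma # as_list (comma_sep (map enc_list (k # ls))) @ r"] by auto
    qed (use r E(3) in auto)
    then show ?case using 3(2) by auto
  qed (use E(1) in simp)
qed

lemma RE_enc_fm: "RE {(F, r, s). formula UNIV UNIV F \<and> s = as_list (enc_fm F) @ r}"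
proof -
  obtain I where I: "tree_re I"
    "\<And>a b c. a \<cdot> b \<cdot> c \<in> I \<Longrightarrow> (of_tree c :: item list) = replicate (of_tree a) (Cst c_accent) @ of_tree b"
    "\<And>a b c. c = replicate a (Cst c_accent) @ b \<Longrightarrow> tree_of a \<cdot> tree_of b \<cdot> tree_of c \<in> I"
    using RE_accents by (rule RE_E3) blast
  obtain E where E: "tree_re E"
    "\<And>a b c. a \<cdot> b \<cdot> c \<in> E \<Longrightarrow> of_tree a \<in> list_terms UNIV \<and> of_tree c = as_list (enc_list (of_tree a)) @ of_tree b"
    "\<And>a b c. a \<in> list_terms UNIV \<and> c = as_list (enc_list a) @ b \<Longrightarrow> tree_of a \<cdot> tree_of b \<cdot> tree_of c \<in> E"
    using RE_enc_list by (rule RE_E3) blast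
  obtain D where D: "tree_re D"
    "\<And>a b c. a \<cdot> b \<cdot> c \<in> D \<Longrightarrow> set (of_tree a) \<subseteq> list_terms UNIV \<and>
      of_tree c = as_list (comma_sep (map enc_list (of_tree a))) @ of_tree b"
    "\<And>a b c. set a \<subseteq> list_terms UNIV \<and> c = as_list (comma_sep (map enc_list a)) @ b \<Longrightarrow>
      tree_of a \<cdot> tree_of b \<cdot> tree_of c \<in> D"
    using RE_enc_args by (rule RE_E3) blast
  let ?c = "\<lambda>c. K (tree_of (Cst c))"
  show ?thesis
  proof (rule RE_I[where Os = "[I, E, D]" and P = "[
      ([Ora 1 (V 0 \<bullet> V 1 \<bullet> V 2), Ora 1 (V 3 \<bullet> (?c c_comma \<bullet> V 2) \<bullet> V 4)],
        pEq (V 3) (V 0) \<bullet> V 1 \<bullet> ?c c_eq \<bullet> V 4),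
      ([Ora 2 (V 0 \<bullet> V 1 \<bullet> V 2), Ora 0 (V 3 \<bullet> V 2 \<bullet> V 4)],
        pPrd (V 3) (V 0) \<bullet> V 1 \<bullet> ?c c_p \<bullet> ?c c_accent \<bullet> V 4),
      ([Own (V 0 \<bullet> V 1 \<bullet> V 2)], pNeg (V 0) \<bullet> V 1 \<bullet> ?c c_neg \<bullet> V 2)] @
      map (\<lambda>J. ([Own (V 0 \<bullet> V 1 \<bullet> V 2), Own (V 3 \<bullet> V 2 \<bullet> V 4)],
        pBin (K (tree_of J)) (V 3) (V 0) \<bullet> V 1 \<bullet> ?c (enc_conn J) \<bullet> V 4)) [CImp, CIff, CAnd, COr] @
      map (\<lambda>Q. ([Own (V 0 \<bullet> V 1 \<bullet> V 2), Ora 0 (V 3 \<bullet> V 2 \<bullet> V 4)],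
        pQu (K (tree_of Q)) (V 3) (V 0) \<bullet> V 1 \<bullet> ?c (enc_quant Q) \<bullet> ?c c_v \<bullet> ?c c_accent \<bullet> V 4)) [QAll, QEx]"],
      goal_cases)
    case 2
    then show ?case by (auto simp: closed_def enc_index_def dest!: I(2) E(2) D(2))
  next
    case (3 X y)
    note r = 3(1)[simplified]
    have "formula UNIV UNIV F \<Longrightarrow> tree_of F \<cdot> tree_of r \<cdot> tree_of (as_list (enc_fm F) @ r) \<in> X" for F r
    proof (induction F arbitrary: r)
      case (Eq l m)
      then show ?case using r E(3)[of m "as_list (enc_list m) @ r" r]
          E(3)[of l "as_list (enc_list l) @ Cst c_comma # as_list (enc_list m) @ r" "Cst c_comma # as_list (enc_list m) @ r"]
        by auto
    next
      case (Prd p ls)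
      then show ?case using r D(3)[of ls _ r] I(3)[OF refl, of p "as_list (comma_sep (map enc_list ls)) @ r"]
        by (auto simp: enc_index_def)
    next
      case (Bin J F G)
      have "a \<cdot> b \<cdot> c \<in> X \<Longrightarrow> d \<cdot> c \<cdot> e \<in> X \<Longrightarrow>
          (tree_of (4::nat) \<cdot> tree_of J \<cdot> d \<cdot> a) \<cdot> b \<cdot> tree_of (Cst (enc_conn J)) \<cdot> e \<in> X" for a b c d e
        using r by (cases J) simp_all
      from this[OF Bin(2)[of r] Bin(1)[of "as_list (enc_fm G) @ r"]] Bin(3) show ?case by simp
    next
      case (Qu Q x F)
      have "a \<cdot> b \<cdot> c \<in> X \<Longrightarrow> d \<cdot> c \<cdot> e \<in> I \<Longrightarrow> (tree_of (5::nat) \<cdot> tree_of Q \<cdot> d \<cdot> a) \<cdot> b \<cdot>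
          tree_of (Cst (enc_quant Q)) \<cdot> tree_of (Cst c_v) \<cdot> tree_of (Cst c_accent) \<cdot> e \<in> X" for a b c d e
        using r by (cases Q) simp_all
      from this[OF Qu(1)[of r] I(3)[OF refl, of x "as_list (enc_fm F) @ r"]] Qu(2)
      show ?case by (simp add: enc_index_def)
    qed (use r in auto)
    then show ?case using 3(2) by auto
  qed (use I(1) E(1) D(1) in simp)
qed

section \<open>Recursive systems as programs\<close>

lemma RE_list_terms:
  assumes "RE A"
  shows "RE (list_terms A)"
proof -
  obtain T where T: "tree_re T" "\<And>t. t \<in> T \<Longrightarrow> of_tree t \<in> A" "\<And>x. x \<in> A \<Longrightarrow> tree_of x \<in> T"
    using assms by (rule RE_E) blast
  obtain C where C: "tree_re C"
    "\<And>a b c. a \<cdot> b \<cdot> c \<in> C \<Longrightarrow> (of_tree c :: item list) = of_tree a @ of_tree b"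
    "\<And>a b c :: item list. c = a @ b \<Longrightarrow> tree_of a \<cdot> tree_of b \<cdot> tree_of c \<in> C"
    using RE_append by (rule RE_E3) blast
  show ?thesis
  proof (rule RE_I[where Os = "[T, C]" and P = "[
      ([Ora 0 (V 0)], pCst (V 0) \<bullet> pNil), ([], pVar (V 0) \<bullet> pNil),
      ([Ora 0 (V 0), Own (V 1)], pOp (V 0) (V 1) \<bullet> pNil),
      ([Own (V 0), Own (V 1), Ora 1 (V 0 \<bullet> V 1 \<bullet> V 2)], V 2)]"], goal_cases)
    case 2
    then show ?case by (auto simp: closed_def list_terms.intros dest!: T(2) C(2))
  next
    case (3 X l)
    note r = 3(1)[simplified]
    note atoms = r[THEN conjunct1] r[THEN conjunct2, THEN conjunct1]
      r[THEN conjunct2, THEN conjunct2, THEN conjunct1]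
    note conc_rule = r[THEN conjunct2, THEN conjunct2, THEN conjunct2, rule_format, OF conjI[OF _ conjI]]
    from 3(2) show ?case
    proof (induction rule: list_terms.induct)
      case (conc l m)
      then show ?case using conc_rule[OF conc(3,4) C(3)[OF refl, of l m]] by simp
    qed (use atoms T(3) in auto)
  qed (use T(1) C(1) in simp)
qed

text \<open>Builds both argument lists together with the chain of equations; \<open>B\<close> is a
  placeholder for the final implication between the two prime formulas, in which these very lists
  must recur.\<close>

lemma RE_eq_chain:
  "RE {(vs, ws, B, H). \<exists>xs ys. vs = map (\<lambda>x. [Var x]) xs \<and> ws = map (\<lambda>y. [Var y]) ys \<and>
    length xs = length ys \<and> H = foldr Imp (map2 (\<lambda>x y. Eq [Var x] [Var y]) xs ys) B}"
proof (rule RE_I[where Os = "[]" and P = "[([], pNil \<bullet> pNil \<bullet> V 0 \<bullet> V 0),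
    ([Own (V 0 \<bullet> V 1 \<bullet> V 2 \<bullet> V 3)], ((pVar (V 4) \<bullet> pNil) \<bullet> V 0) \<bullet> ((pVar (V 5) \<bullet> pNil) \<bullet> V 1) \<bullet>
      V 2 \<bullet> pImp (pEq (pVar (V 4) \<bullet> pNil) (pVar (V 5) \<bullet> pNil)) (V 3))]"], goal_cases)
  case 2
  show ?case
  proof (simp add: closed_def, clarify, goal_cases)
    case (1 v xs ys)
    show ?case
      by (rule exI[of _ "of_tree (v 4) # xs"], rule conjI, simp add: 1,
          rule exI[of _ "of_tree (v 5) # ys"], simp add: 1)
  qed
next
  case (3 X z)
  note r = 3(1)[simplified]
  have "length xs = length ys \<Longrightarrow> tree_of (map (\<lambda>x. [Var x]) xs) \<cdot> tree_of (map (\<lambda>x. [Var x]) ys) \<cdot>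
    tree_of B \<cdot> tree_of (foldr Imp (map2 (\<lambda>x y. Eq [Var x] [Var y]) xs ys) B) \<in> X" for xs ys B
    by (induction xs ys rule: list_induct2) (use r in auto)
  then show ?case using 3(2) by auto
qed simp

lemma RE_eq_axioms:
  assumes "RE A" "RE P"
  shows "RE (eq_axioms A P)"
proof -
  obtain T where T: "tree_re T" "\<And>t. t \<in> T \<Longrightarrow> of_tree t \<in> list_terms A"
    "\<And>x. x \<in> list_terms A \<Longrightarrow> tree_of x \<in> T"
    using RE_list_terms[OF assms(1)] by (rule RE_E) blast
  obtain Q where Q: "tree_re Q" "\<And>t. t \<in> Q \<Longrightarrow> of_tree t \<in> P" "\<And>x. x \<in> P \<Longrightarrow> tree_of x \<in> Q"
    using assms(2) by (rule RE_E) blast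
  obtain S where S: "tree_re S"
    "\<And>a b c d. a \<cdot> b \<cdot> c \<cdot> d \<in> S \<Longrightarrow> of_tree d = sbF (of_tree a) (of_tree b) (of_tree c)"
    "\<And>a b c d. d = sbF a b c \<Longrightarrow> tree_of a \<cdot> tree_of b \<cdot> tree_of c \<cdot> tree_of d \<in> S"
    using RE_sbF by (rule RE_E4) blast
  obtain Z where Z: "tree_re Z"
    "\<And>a b c d. a \<cdot> b \<cdot> c \<cdot> d \<in> Z \<Longrightarrow> \<exists>xs ys. of_tree a = map (\<lambda>x. [Var x]) xs \<and>
      of_tree b = map (\<lambda>y. [Var y]) ys \<and> length xs = length ys \<and>
      of_tree d = foldr Imp (map2 (\<lambda>x y. Eq [Var x] [Var y]) xs ys) (of_tree c)"
    "\<And>a b c d. \<exists>xs ys. a = map (\<lambda>x. [Var x]) xs \<and> b = map (\<lambda>y. [Var y]) ys \<and>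
      length xs = length ys \<and> d = foldr Imp (map2 (\<lambda>x y. Eq [Var x] [Var y]) xs ys) c \<Longrightarrow>
      tree_of a \<cdot> tree_of b \<cdot> tree_of c \<cdot> tree_of d \<in> Z"
    using RE_eq_chain by (rule RE_E4) blast
  let ?var = "\<lambda>p. pVar p \<bullet> pNil"
  show ?thesis
  proof (rule RE_I[where Os = "[T, Q, S, Z]" and P = "[
      ([], pEq (?var (V 0)) (?var (V 0))),
      ([Ora 0 (V 0), Ora 0 (V 1), Ora 2 (pEq (V 0) (V 1) \<bullet> ?var (V 2) \<bullet> V 3 \<bullet> V 4)],
        pImp (V 4) (pImp (pEq (?var (V 2)) (?var (V 3))) (pEq (V 0) (V 1)))),
      ([Ora 1 (V 0), Ora 3 ((V 1 \<bullet> V 2) \<bullet> V 3 \<bullet>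
        pImp (pPrd (V 0) (V 1 \<bullet> V 2)) (pPrd (V 0) (V 3)) \<bullet> V 4)], V 4)]"], goal_cases)
    case 2
    have "of_tree h \<in> eq_axioms A P" if q: "q \<in> Q" and chain:
      "(s \<cdot> t) \<cdot> u \<cdot> (tree_of (4::nat) \<cdot> tree_of CImp \<cdot> (tree_of (2::nat) \<cdot> q \<cdot> s \<cdot> t) \<cdot> tree_of (2::nat) \<cdot> q \<cdot> u) \<cdot> h \<in> Z" for q s t u h
    proof -
      obtain xs ys where h: "of_tree (s \<cdot> t) = map (\<lambda>x. [Var x]) xs"
        "of_tree u = map (\<lambda>y. [Var y]) ys" "length xs = length ys"
        "of_tree h = foldr Imp (map2 (\<lambda>x y. Eq [Var x] [Var y]) xs ys) (of_tree
          (tree_of (4::nat) \<cdot> tree_of CImp \<cdot> (tree_of (2::nat) \<cdot> q \<cdot> s \<cdot> t) \<cdot> tree_of (2::nat) \<cdot> q \<cdot> u))"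
        using Z(2)[OF chain] by blast
      \<comment> \<open>The clause writes the first argument list as a pair, which enforces the
        positive arity demanded by the axiom.\<close>
      have "xs \<noteq> []" using h(1) by auto
      moreover have "of_tree (tree_of (4::nat) \<cdot> tree_of CImp \<cdot> (tree_of (2::nat) \<cdot> q \<cdot> s \<cdot> t) \<cdot> tree_of (2::nat) \<cdot> q \<cdot> u) =
          Imp (Prd (of_tree q) (of_tree (s \<cdot> t))) (Prd (of_tree q) (of_tree u))"
        by simp
      ultimately show ?thesis
        using eq_pred[of "of_tree q" P xs ys A] Q(2)[OF q] h by (simp only:) simp
    qed
    then show ?case
      by (auto simp: closed_def intro: eq_axioms.eq_refl dest!: T(2) S(2) intro: eq_subst[simplified])
  next
    case (3 X F)
    note r = 3(1)[simplified]
    from 3(2) show ?case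
    proof (induction rule: eq_axioms.induct)
      case (eq_subst l m x y)
      then show ?case using r T(3) S(3)[OF refl, of "Eq l m" "[Var x]" y] by auto
    next
      case (eq_pred p xs ys)
      obtain x xs' where xs: "xs = x # xs'" using eq_pred by (cases xs) auto
      have "tree_of (map (\<lambda>x. [Var x]) xs) \<cdot> tree_of (map (\<lambda>x. [Var x]) ys) \<cdot>
        tree_of (Imp (Prd p (map (\<lambda>x. [Var x]) xs)) (Prd p (map (\<lambda>y. [Var y]) ys))) \<cdot>
        tree_of (foldr Imp (map2 (\<lambda>x y. Eq [Var x] [Var y]) xs ys)
          (Imp (Prd p (map (\<lambda>x. [Var x]) xs)) (Prd p (map (\<lambda>y. [Var y]) ys)))) \<in> Z"
        using eq_pred by (intro Z(3)) blast
      then show ?case using r Q(3)[OF eq_pred(1)] by (fastforce simp: xs)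
    qed (use r in auto)
  qed (use T(1) Q(1) S(1) Z(1) in simp)
qed

lemma RE_r_derivable:
  assumes "recursive_system S"
  shows "RE (r_derivable S)"
proof -
  obtain T where T: "tree_re T" "\<And>t. t \<in> T \<Longrightarrow> of_tree t \<in> list_terms (rA S)"
    "\<And>x. x \<in> list_terms (rA S) \<Longrightarrow> tree_of x \<in> T"
    using RE_list_terms[OF RE_finite, of "rA S"] assms by (auto simp: recursive_system_def elim: RE_E)
  have "RE (set (rB S) \<union> eq_axioms (rA S) (rP S))"
    using assms by (intro RE_Un RE_eq_axioms RE_finite) (auto simp: recursive_system_def)
  then obtain Q where Q: "tree_re Q"
    "\<And>t. t \<in> Q \<Longrightarrow> of_tree t \<in> set (rB S) \<union> eq_axioms (rA S) (rP S)"
    "\<And>x. x \<in> set (rB S) \<union> eq_axioms (rA S) (rP S) \<Longrightarrow> tree_of x \<in> Q"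
    by (rule RE_E) blast
  obtain W where W: "tree_re W"
    "\<And>a b c d. a \<cdot> b \<cdot> c \<cdot> d \<in> W \<Longrightarrow> of_tree d = sbF (of_tree a) (of_tree b) (of_tree c)"
    "\<And>a b c d. d = sbF a b c \<Longrightarrow> tree_of a \<cdot> tree_of b \<cdot> tree_of c \<cdot> tree_of d \<in> W"
    using RE_sbF by (rule RE_E4) blast
  show ?thesis
  proof (rule RE_I[where Os = "[T, Q, W]" and P = "[
      ([Ora 1 (V 0)], V 0),
      ([Own (V 0), Own (pImp (V 0) (V 1))], V 1),
      ([Own (V 0), Ora 0 (V 1), Ora 2 (V 0 \<bullet> V 1 \<bullet> V 2 \<bullet> V 3)], V 3)]"], goal_cases)
    case 2
    then show ?case
      using Q(2) by (auto simp: closed_def intro: r_derivable.intros dest!: T(2) W(2))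
  next
    case (3 X F)
    note r = 3(1)[simplified]
    from 3(2) show ?case
    proof (induction rule: r_derivable.induct)
      case (mp F G)
      then show ?case using r[THEN conjunct2, THEN conjunct1, rule_format, of "tree_of F" "tree_of G"] by simp
    next
      case (subst F l x)
      then show ?case
        using r[THEN conjunct2, THEN conjunct2, rule_format, OF conjI[OF _ conjI[OF _ W(3)[OF refl]]]] T(3) by blast
    qed (use r[THEN conjunct1] Q(3) in auto)
  qed (use T(1) Q(1) W(1) in simp)
qed

section \<open>Unique readability\<close>

lemma list_terms_mono: "l \<in> list_terms A \<Longrightarrow> A \<subseteq> B \<Longrightarrow> l \<in> list_terms B"
  by (induction rule: list_terms.induct) (auto intro: list_terms.intros)

lemma list_terms_nonempty: "l \<in> list_terms A \<Longrightarrow> l \<noteq> []"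
  by (induction rule: list_terms.induct) auto

lemma replicate_accents_unique:
  "replicate i a @ r = replicate j a @ s \<Longrightarrow> r = [] \<or> hd r \<noteq> a \<Longrightarrow> s = [] \<or> hd s \<noteq> a \<Longrightarrow>
    i = j \<and> r = s"
proof (induction i arbitrary: j)
  case 0
  then show ?case by (cases j) auto
next
  case (Suc i)
  then show ?case by (cases j) auto
qed

text \<open>The excluded symbols are those that could continue a list: the beginning of another
  item, a further accent, or the parenthesis that turns a preceding constant into an operation
  symbol.\<close>

definition list_stop :: "nat list \<Rightarrow> bool" where
  "list_stop r \<longleftrightarrow> r = [] \<or> hd r \<notin> {c_a, c_v, c_accent, c_lpar}"

lemma enc_list_append_hd:
  "list_stop r \<Longrightarrow> enc_list l @ r = [] \<or> hd (enc_list l @ r) \<notin> {c_accent, c_lpar}"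
  by (cases l rule: list.exhaust; cases "hd l") (auto simp: list_stop_def enc_index_def)

lemma enc_list_hd: "l \<noteq> [] \<Longrightarrow> enc_list l \<noteq> [] \<and> hd (enc_list l) \<in> {c_a, c_v}"
  by (cases l rule: list.exhaust; cases "hd l") (auto simp: enc_index_def)

text \<open>Rests are carried along because the argument of \<open>Op\<close> is read up to its
  closing parenthesis, a stop symbol. \<open>Cst\<close> and \<open>Op\<close> begin alike and are
  told apart by the symbol after the accents.\<close>

lemma enc_list_unique:
  "enc_list l @ r = enc_list l' @ r' \<Longrightarrow> list_stop r \<Longrightarrow> list_stop r' \<Longrightarrow> l = l' \<and> r = r'"
proof (induction l arbitrary: l' r r' rule: items_induct)
  case Nil
  then show ?case using enc_list_hd[of l'] by (cases "l' = []") (auto simp: list_stop_def)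
next
  case (Cst a l)
  from Cst.prems obtain i k where l': "l' = i # k"
    by (cases l') (auto simp: enc_index_def list_stop_def)
  show ?case
  proof (cases i)
    case (Cst b)
    then have "replicate a c_accent @ enc_list l @ r = replicate b c_accent @ enc_list k @ r'"
      using Cst.prems l' by (simp add: enc_index_def)
    from replicate_accents_unique[OF this] show ?thesis
      using Cst.IH[of r k r'] Cst.prems enc_list_append_hd[of r l] enc_list_append_hd[of r' k] Cst l' by auto
  next
    case (Op b k')
    then have "replicate a c_accent @ enc_list l @ r =
        replicate b c_accent @ c_lpar # enc_list k' @ c_rpar # enc_list k @ r'"
      using Cst.prems l' by (simp add: enc_index_def)
    from replicate_accents_unique[OF this] show ?thesis
      using Cst.prems enc_list_append_hd[of r l] by auto
  qed (use Cst.prems l' in \<open>auto simp: enc_index_def\<close>)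
next
  case (Var a l)
  from Var.prems obtain i k where l': "l' = i # k"
    by (cases l') (auto simp: enc_index_def list_stop_def)
  show ?case
  proof (cases i)
    case (Var b)
    then have "replicate a c_accent @ enc_list l @ r = replicate b c_accent @ enc_list k @ r'"
      using Var.prems l' by (simp add: enc_index_def)
    from replicate_accents_unique[OF this] show ?thesis
      using Var.IH[of r k r'] Var.prems enc_list_append_hd[of r l] enc_list_append_hd[of r' k] Var l' by auto
  qed (use Var.prems l' in \<open>auto simp: enc_index_def\<close>)
next
  case (Op a m l)
  from Op.prems obtain i k where l': "l' = i # k"
    by (cases l') (auto simp: enc_index_def list_stop_def)
  show ?case
  proof (cases i)
    case (Cst b)
    then have "replicate a c_accent @ c_lpar # enc_list m @ c_rpar # enc_list l @ r =
        replicate b c_accent @ enc_list k @ r'"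
      using Op.prems l' by (simp add: enc_index_def)
    from replicate_accents_unique[OF this]
    have "c_lpar # enc_list m @ c_rpar # enc_list l @ r = enc_list k @ r'"
      using Op.prems(3) enc_list_append_hd[of r' k] by auto
    then show ?thesis
      using Op.prems(3) enc_list_append_hd[of r' k] by (metis insertI1 insertI2 list.distinct(1) list.sel(1))
  next
    case (Op b k')
    then have "replicate a c_accent @ c_lpar # enc_list m @ c_rpar # enc_list l @ r =
        replicate b c_accent @ c_lpar # enc_list k' @ c_rpar # enc_list k @ r'"
      using Op.prems l' by (simp add: enc_index_def)
    from replicate_accents_unique[OF this]
    have "a = b" "enc_list m @ c_rpar # enc_list l @ r = enc_list k' @ c_rpar # enc_list k @ r'"
      by auto
    then show ?thesis
      using Op.IH(1)[of "c_rpar # enc_list l @ r" k' "c_rpar # enc_list k @ r'"] Op.IH(2)[of r k r'] Op.prems Op l'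
      by (auto simp: list_stop_def)
  qed (use Op.prems l' in \<open>auto simp: enc_index_def\<close>)
qed

text \<open>A comma is excluded in addition, since it would continue the argument list of a
  predicate.\<close>

definition fm_stop :: "nat list \<Rightarrow> bool" where
  "fm_stop r \<longleftrightarrow> r = [] \<or> hd r \<notin> {c_a, c_v, c_accent, c_lpar, c_comma}"

lemma comma_sep_Cons: "comma_sep (s # ss) = s @ concat (map ((#) c_comma) ss)"
  by (induction ss arbitrary: s) auto

lemma list_stop_commas:
  "fm_stop r \<Longrightarrow> list_stop (concat (map (\<lambda>l. c_comma # enc_list l) ls) @ r)"
  by (cases ls) (auto simp: fm_stop_def list_stop_def)

lemma commas_unique:
  "concat (map (\<lambda>l. c_comma # enc_list l) ls) @ r = concat (map (\<lambda>l. c_comma # enc_list l) ls') @ r' \<Longrightarrow>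
    fm_stop r \<Longrightarrow> fm_stop r' \<Longrightarrow> ls = ls' \<and> r = r'"
proof (induction ls arbitrary: ls')
  case Nil
  then show ?case by (cases ls') (auto simp: fm_stop_def)
next
  case (Cons l ls)
  let ?c = "\<lambda>ls. concat (map (\<lambda>l. c_comma # enc_list l) ls)"
  obtain k ks where ls': "ls' = k # ks"
    using Cons.prems by (cases ls') (auto simp: fm_stop_def)
  then have "enc_list l @ (?c ls @ r) = enc_list k @ (?c ks @ r')"
    using Cons.prems(1) by simp
  then have "l = k" "?c ls @ r = ?c ks @ r'"
    using enc_list_unique list_stop_commas Cons.prems(2,3) by blast+
  then show ?case
    using Cons.IH[of ks] Cons.prems(2,3) ls' by simp
qed

text \<open>Empty lists must be excluded: \<open>[]\<close> and \<open>[[]]\<close> would both be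
  encoded by the empty string.\<close>

lemma enc_args_unique:
  assumes eq: "comma_sep (map enc_list ls) @ r = comma_sep (map enc_list ls') @ r'"
    and "fm_stop r" "fm_stop r'" "[] \<notin> set ls" "[] \<notin> set ls'"
  shows "ls = ls' \<and> r = r'"
proof (cases ls)
  case Nil
  then show ?thesis
    using assms enc_list_hd[of "hd ls'"] by (cases ls') (auto simp: comma_sep_Cons fm_stop_def)
next
  case (Cons l ks)
  show ?thesis
  proof (cases ls')
    case Nil
    then show ?thesis
      using assms enc_list_hd[of "hd ls"] by (cases ls) (auto simp: comma_sep_Cons fm_stop_def)
  next
    case (Cons l' ks')
    then show ?thesis
      using assms \<open>ls = l # ks\<close> enc_list_unique[of l "concat (map (\<lambda>l. c_comma # enc_list l) ks) @ r" l'
        "concat (map (\<lambda>l. c_comma # enc_list l) ks') @ r'"] list_stop_commas commas_unique[of ks r ks' r']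
      by (auto simp: comma_sep_Cons comp_def)
  qed
qed

lemma comma_sep_hd:
  "[] \<notin> set ls \<Longrightarrow> fm_stop r \<Longrightarrow>
    comma_sep (map enc_list ls) @ r = [] \<or> hd (comma_sep (map enc_list ls) @ r) \<noteq> c_accent"
  using enc_list_hd[of "hd ls"] by (cases ls) (auto simp: comma_sep_Cons fm_stop_def)

lemma enc_fm_hd:
  "enc_fm F \<noteq> [] \<and>
    hd (enc_fm F) \<in> {c_eq, c_p, c_neg, c_imp, c_iff, c_and, c_or, c_all, c_ex}"
proof (cases F)
  case (Bin J G H)
  then show ?thesis by (cases J) auto
next
  case (Qu Q x G)
  then show ?thesis by (cases Q) auto
qed (auto simp: enc_index_def)

lemma fm_stop_enc_fm: "fm_stop (enc_fm F @ r)"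
  using enc_fm_hd[of F] by (auto simp: fm_stop_def)

lemma enc_conn_quant_neq: "enc_conn J \<notin> {c_eq, c_p, c_neg, c_all, c_ex}"
  "enc_quant Q \<notin> {c_eq, c_p, c_neg, c_imp, c_iff, c_and, c_or}" "enc_conn J \<noteq> enc_quant Q" "enc_quant Q \<noteq> enc_conn J"
  "enc_conn J = enc_conn J' \<longleftrightarrow> J = J'" "enc_quant Q = enc_quant Q' \<longleftrightarrow> Q = Q'"
  by (cases J; cases J'; cases Q; cases Q'; simp)+

lemma formula_args_nonempty: "formula A P (Prd p ls) \<Longrightarrow> [] \<notin> set ls"
  using list_terms_nonempty by auto

text \<open>Polish notation makes this work: the first symbol determines the constructor, and no
  formula begins with a symbol that could prolong the piece before it. Being a formula ensures that
  argument lists are nonempty.\<close>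

lemma enc_fm_unique:
  "enc_fm F @ r = enc_fm F' @ r' \<Longrightarrow> formula UNIV UNIV F \<Longrightarrow> formula UNIV UNIV F' \<Longrightarrow>
    fm_stop r \<Longrightarrow> fm_stop r' \<Longrightarrow> F = F' \<and> r = r'"
proof (induction F arbitrary: F' r r')
  case (Eq l m)
  then obtain l' m' where F': "F' = Eq l' m'"
    using enc_conn_quant_neq by (cases F') (auto simp: enc_index_def)
  then show ?case
    using Eq enc_list_unique[of l "c_comma # enc_list m @ r" l' "c_comma # enc_list m' @ r'"]
      enc_list_unique[of m r m' r'] by (auto simp: fm_stop_def list_stop_def)
next
  case (Prd p ls)
  then obtain p' ls' where F': "F' = Prd p' ls'"
    using enc_conn_quant_neq by (cases F') (auto simp: enc_index_def)
  have ne: "[] \<notin> set ls" "[] \<notin> set ls'"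
    using Prd(2,3) formula_args_nonempty unfolding F' by blast+
  have "replicate p c_accent @ comma_sep (map enc_list ls) @ r =
      replicate p' c_accent @ comma_sep (map enc_list ls') @ r'"
    using Prd(1) F' by (simp add: enc_index_def)
  from replicate_accents_unique[OF this] show ?case
    using enc_args_unique[of ls r ls' r'] ne Prd(4,5) comma_sep_hd F' by auto
next
  case (Neg F)
  from Neg.prems obtain G where F': "F' = Neg G"
    using enc_conn_quant_neq by (cases F') (auto simp: enc_index_def)
  show ?case using F' Neg.prems Neg.IH[of r G r'] by auto
next
  case (Bin J F G)
  from Bin.prems obtain J' K H where F': "F' = Bin J' K H"
    using enc_conn_quant_neq by (cases F') (auto simp: enc_index_def)
  show ?case
    using F' Bin.prems Bin.IH(1)[of "enc_fm G @ r" K "enc_fm H @ r'"] Bin.IH(2)[of r H r']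
    by (auto simp: enc_conn_quant_neq fm_stop_enc_fm)
next
  case (Qu Q x F)
  from Qu.prems obtain Q' y H where F': "F' = Qu Q' y H"
    using enc_conn_quant_neq by (cases F') (auto simp: enc_index_def)
  have "replicate x c_accent @ enc_fm F @ r = replicate y c_accent @ enc_fm H @ r'"
    using Qu.prems F' by (simp add: enc_index_def)
  from replicate_accents_unique[OF this] show ?case
    using Qu.prems Qu.IH[of r H r'] F' fm_stop_enc_fm[of F r] fm_stop_enc_fm[of H r']
    by (auto simp: enc_conn_quant_neq fm_stop_def)
qed

lemma enc_fm_inj: "formula UNIV UNIV F \<Longrightarrow> formula UNIV UNIV F' \<Longrightarrow> enc_fm F = enc_fm F' \<Longrightarrow> F = F'"
  using enc_fm_unique[of F "[]" F' "[]"] by (simp add: fm_stop_def)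

lemma enc_list_inj: "enc_list l = enc_list l' \<Longrightarrow> l = l'"
  using enc_list_unique[of l "[]" l' "[]"] by (simp add: list_stop_def)

lemma set_enc_list: "set (enc_list l) \<subseteq> {c_a, c_v, c_accent, c_lpar, c_rpar}"
  by (induction l rule: items_induct) (auto simp: enc_index_def)

lemma set_comma_sep: "set (comma_sep (map enc_list ls)) \<subseteq> {c_a, c_v, c_accent, c_lpar, c_rpar, c_comma}"
proof -
  have "set (comma_sep (map enc_list ls)) \<subseteq> insert c_comma (\<Union>l\<in>set ls. set (enc_list l))"
    by (induction ls rule: induct_list012) auto
  then show ?thesis using set_enc_list by blast
qed

lemma set_enc_prime:
  "set (enc_fm (Eq l m)) \<subseteq> A11 - {c_star}" "set (enc_fm (Prd p ls)) \<subseteq> A11 - {c_star}"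
  using set_enc_list[of l] set_enc_list[of m] set_comma_sep[of ls]
  by (auto simp: A11_def enc_index_def)

lemma set_enc_fm: "set (enc_fm F) \<subseteq> A17 - {c_star}"
proof (induction F)
  case (Eq l m)
  then show ?case using set_enc_prime(1)[of l m] by (auto simp: A17_def)
next
  case (Prd p ls)
  then show ?case using set_enc_prime(2)[of p ls] by (auto simp: A17_def)
next
  case (Bin J F G)
  then show ?case by (cases J) (auto simp: A17_def A11_def)
next
  case (Qu Q x F)
  then show ?case by (cases Q) (auto simp: A17_def A11_def enc_index_def)
qed (auto simp: A17_def A11_def)

lemma is_prime_cases:
  assumes "is_prime A P F"
  obtains (Eq) l m where "F = Eq l m" | (Prd) p ls where "F = Prd p ls"
  using assms by (cases F) auto

lemma set_enc_r_formula:
  assumes "r_formula A P F"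
  shows "set (enc_fm F) \<subseteq> A11"
proof -
  have prime: "set (enc_fm E) \<subseteq> A11" if "is_prime A P E" for E
    using that by (rule is_prime_cases) (use set_enc_prime in blast)+
  obtain Fs G where "\<forall>E\<in>set Fs. is_prime A P E" "is_prime A P G" "F = foldr Imp Fs G"
    using assms unfolding r_formula_def by blast
  moreover have "\<forall>E\<in>set Fs. is_prime A P E \<Longrightarrow> set (enc_fm (foldr Imp Fs G)) \<subseteq> A11" if "is_prime A P G" for Fs G
    by (induction Fs) (use prime that in \<open>auto simp: A11_def\<close>)
  ultimately show ?thesis by blast
qed

lemma formula_prime: "is_prime A P F \<Longrightarrow> formula UNIV UNIV F"
  by (cases F) (auto intro: list_terms_mono)

lemma formula_r_formula:
  assumes "r_formula A P F"
  shows "formula UNIV UNIV F"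
proof -
  obtain Fs G where "\<forall>E\<in>set Fs. is_prime A P E" "is_prime A P G" "F = foldr Imp Fs G"
    using assms unfolding r_formula_def by blast
  moreover have "\<forall>E\<in>set Fs. is_prime A P E \<Longrightarrow> formula UNIV UNIV (foldr Imp Fs G)" if "is_prime A P G" for Fs G
    by (induction Fs) (use formula_prime that in auto)
  ultimately show ?thesis by blast
qed

section \<open>Unique readability of statements about recursive systems\<close>

lemma append_Cons_unique:
  "u @ a # r = v @ a # s \<Longrightarrow> a \<notin> set u \<Longrightarrow> a \<notin> set v \<Longrightarrow> u = v \<and> r = s"
proof (induction u arbitrary: v)
  case Nil
  then show ?case by (cases v) auto
next
  case (Cons b u)
  then show ?case by (cases v) auto
qed

lemma tally_inj: "tally k = tally l \<Longrightarrow> k = l"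
  by (auto simp: tally_def split: if_splits dest: arg_cong[of _ _ hd] arg_cong[of _ _ length])

lemma star_notin_tally: "c_star \<notin> set (tally k)"
  by (simp add: tally_def)

text \<open>A star is a stop symbol, so the formulas can be read off one by one. The last formula is
  the only one not followed by a star, which fixes the length of the list.\<close>

lemma basis_unique:
  "concat (map (\<lambda>F. enc_fm F @ [c_star]) B) @ enc_fm F = concat (map (\<lambda>F. enc_fm F @ [c_star]) B') @ enc_fm F' \<Longrightarrow>
    \<forall>G\<in>insert F (set B). formula UNIV UNIV G \<Longrightarrow> \<forall>G\<in>insert F' (set B'). formula UNIV UNIV G \<Longrightarrow>
    B = B' \<and> F = F'"
proof (induction B arbitrary: B')
  case Nil
  then show ?case
    using enc_fm_unique[of F "[]" "hd B'" "c_star # concat (map (\<lambda>F. enc_fm F @ [c_star]) (tl B')) @ enc_fm F'"]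
    by (cases B') (auto simp: fm_stop_def dest: enc_fm_inj)
next
  case (Cons G B)
  show ?case
  proof (cases B')
    case Nil
    then show ?thesis
      using Cons.prems enc_fm_unique[of F' "[]" G "c_star # concat (map (\<lambda>F. enc_fm F @ [c_star]) B) @ enc_fm F"]
      by (auto simp: fm_stop_def)
  next
    case (Cons H C)
    then show ?thesis
      using Cons.prems Cons.IH[of C] enc_fm_unique[of G "c_star # concat (map (\<lambda>F. enc_fm F @ [c_star]) B) @ enc_fm F"
        H "c_star # concat (map (\<lambda>F. enc_fm F @ [c_star]) C) @ enc_fm F'"]
      by (auto simp: fm_stop_def)
  qed
qed

lemma represents_formulas:
  "represents k l B i m s \<Longrightarrow> \<forall>G\<in>insert (Prd i [m]) (set B). formula UNIV UNIV G"
  unfolding represents_def recursive_system_def initial_sys_def by (auto intro: formula_r_formula)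

text \<open>\<open>S11_theorem\<close> asks for some reading of the string under which the formula
  is derivable. Since there is only one reading, a single non-derivation suffices to refute
  it.\<close>

lemma represents_unique:
  assumes r: "represents k l B i m s" and r': "represents k' l' B' i' m' s"
  shows "k = k' \<and> l = l' \<and> B = B' \<and> i = i' \<and> m = m'"
proof -
  let ?w = "\<lambda>B. if B = [] then [c_box, c_star] else concat (map (\<lambda>F. enc_fm F @ [c_star]) B)"
  have "tally k @ c_star # tally l @ c_star # ?w B @ enc_fm (Prd i [m]) =
      tally k' @ c_star # tally l' @ c_star # ?w B' @ enc_fm (Prd i' [m'])"
    using r r' by (simp add: represents_def basis_string_def del: enc_fm.simps)
  then have "tally k = tally k'" "tally l = tally l'"
    and w: "?w B @ enc_fm (Prd i [m]) = ?w B' @ enc_fm (Prd i' [m'])"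
    by (metis append_Cons_unique star_notin_tally)+
  \<comment> \<open>No encoded formula begins with a box, so the box that stands for an empty basis
    cannot be mistaken for a formula.\<close>
  moreover have "B = [] \<longleftrightarrow> B' = []"
  proof (rule ccontr)
    assume "\<not> ?thesis"
    then obtain C F u where "c_box # u = enc_fm F @ C"
      using w by (cases B; cases B') (auto simp del: enc_fm.simps, metis+)
    then show False using enc_fm_hd[of F] by (cases "enc_fm F") auto
  qed
  then have "concat (map (\<lambda>F. enc_fm F @ [c_star]) B) @ enc_fm (Prd i [m]) =
      concat (map (\<lambda>F. enc_fm F @ [c_star]) B') @ enc_fm (Prd i' [m'])"
    using w by (auto simp del: enc_fm.simps split: if_splits)
  from basis_unique[OF this represents_formulas[OF r] represents_formulas[OF r']]
  show ?thesis using calculation tally_inj by auto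
qed

section \<open>Formulas and axioms of an axiomatized system as programs\<close>

text \<open>Decoding by search: the program runs through all lists, encodes each one and asks the
  enumerating system about the result. Injectivity of the encoding turns membership of the string
  into membership of the list.\<close>

lemma RE_of_enc_list:
  assumes "rec_enum A17 (enc_list ` L)" and "L \<subseteq> list_terms UNIV"
  shows "RE L"
proof -
  obtain S q where S: "recursive_system S"
    and q: "\<forall>s\<in>strings A17. s \<in> enc_list ` L \<longleftrightarrow> Prd q [as_list s] \<in> r_derivable S"
    using assms(1) unfolding rec_enum_def by blast
  obtain D where D: "tree_re D" "\<And>t. t \<in> D \<Longrightarrow> of_tree t \<in> r_derivable S"
    "\<And>x. x \<in> r_derivable S \<Longrightarrow> tree_of x \<in> D"
    using RE_r_derivable[OF S] by (rule RE_E) blast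
  obtain E where E: "tree_re E"
    "\<And>a b c. a \<cdot> b \<cdot> c \<in> E \<Longrightarrow> of_tree a \<in> list_terms UNIV \<and> of_tree c = as_list (enc_list (of_tree a)) @ of_tree b"
    "\<And>a b c. a \<in> list_terms UNIV \<and> c = as_list (enc_list a) @ b \<Longrightarrow> tree_of a \<cdot> tree_of b \<cdot> tree_of c \<in> E"
    using RE_enc_list by (rule RE_E3) blast
  have iff: "l \<in> L \<longleftrightarrow> Prd q [as_list (enc_list l)] \<in> r_derivable S" if l: "l \<in> list_terms UNIV" for l
  proof -
    have "enc_list l \<in> strings A17"
      using enc_list_hd[OF list_terms_nonempty[OF l]] set_enc_list[of l]
      by (auto simp: strings_def A17_def A11_def)
    then show ?thesis by (auto simp: bspec[OF q, symmetric] dest: enc_list_inj)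
  qed
  show ?thesis
  proof (rule RE_I[where Os = "[D, E]" and P = "[
      ([Ora 1 (V 0 \<bullet> pNil \<bullet> V 1), Ora 0 (pPrd (K (tree_of q)) (V 1 \<bullet> pNil))], V 0)]"], goal_cases)
    case 2
    then show ?case by (auto simp: closed_def iff dest!: D(2) E(2))
  next
    case (3 X l)
    have "l \<in> list_terms UNIV" using 3(2) assms(2) by blast
    then have "tree_of l \<cdot> Lf \<cdot> tree_of (as_list (enc_list l)) \<in> E"
      "tree_of (2::nat) \<cdot> tree_of q \<cdot> tree_of (as_list (enc_list l)) \<cdot> Lf \<in> D"
      using E(3)[of l "as_list (enc_list l)" "[]"] D(3)[of "Prd q [as_list (enc_list l)]"] iff[of l] 3(2)
      by simp_all
    then show ?case using 3(1) by auto
  qed (use D(1) E(1) in simp)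
qed

lemma RE_of_enc_fm:
  assumes "rec_enum A17 (enc_fm ` B)" and B: "\<And>F. F \<in> B \<Longrightarrow> formula UNIV UNIV F"
  shows "RE B"
proof -
  obtain S q where S: "recursive_system S"
    and q: "\<forall>s\<in>strings A17. s \<in> enc_fm ` B \<longleftrightarrow> Prd q [as_list s] \<in> r_derivable S"
    using assms(1) unfolding rec_enum_def by blast
  obtain D where D: "tree_re D" "\<And>t. t \<in> D \<Longrightarrow> of_tree t \<in> r_derivable S"
    "\<And>x. x \<in> r_derivable S \<Longrightarrow> tree_of x \<in> D"
    using RE_r_derivable[OF S] by (rule RE_E) blast
  obtain E where E: "tree_re E"
    "\<And>a b c. a \<cdot> b \<cdot> c \<in> E \<Longrightarrow> formula UNIV UNIV (of_tree a) \<and> of_tree c = as_list (enc_fm (of_tree a)) @ of_tree b"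
    "\<And>a b c. formula UNIV UNIV a \<and> c = as_list (enc_fm a) @ b \<Longrightarrow> tree_of a \<cdot> tree_of b \<cdot> tree_of c \<in> E"
    using RE_enc_fm by (rule RE_E3) blast
  have iff: "F \<in> B \<longleftrightarrow> Prd q [as_list (enc_fm F)] \<in> r_derivable S" if F: "formula UNIV UNIV F" for F
  proof -
    have "enc_fm F \<in> strings A17"
      using enc_fm_hd[of F] set_enc_fm[of F] by (auto simp: strings_def)
    then show ?thesis using B F by (auto simp: bspec[OF q, symmetric] dest: enc_fm_inj)
  qed
  show ?thesis
  proof (rule RE_I[where Os = "[D, E]" and P = "[
      ([Ora 1 (V 0 \<bullet> pNil \<bullet> V 1), Ora 0 (pPrd (K (tree_of q)) (V 1 \<bullet> pNil))], V 0)]"], goal_cases)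
    case 2
    then show ?case by (auto simp: closed_def iff dest!: D(2) E(2))
  next
    case (3 X F)
    have "tree_of F \<cdot> Lf \<cdot> tree_of (as_list (enc_fm F)) \<in> E"
      "tree_of (2::nat) \<cdot> tree_of q \<cdot> tree_of (as_list (enc_fm F)) \<cdot> Lf \<in> D"
      using E(3)[of F "as_list (enc_fm F)" "[]"] D(3)[of "Prd q [as_list (enc_fm F)]"] iff[of F] B[of F] 3(2)
      by simp_all
    then show ?case using 3(1) by auto
  qed (use D(1) E(1) in simp)
qed

lemma RE_subset_list:
  assumes "RE A"
  shows "RE {xs. set xs \<subseteq> A}"
proof -
  obtain T where T: "tree_re T" "\<And>t. t \<in> T \<Longrightarrow> of_tree t \<in> A" "\<And>x. x \<in> A \<Longrightarrow> tree_of x \<in> T"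
    using assms by (rule RE_E) blast
  show ?thesis
  proof (rule RE_I[where Os = "[T]" and P = "[([], pNil), ([Ora 0 (V 0), Own (V 1)], V 0 \<bullet> V 1)]"], goal_cases)
    case 2
    then show ?case by (auto simp: closed_def dest!: T(2))
  next
    case (3 X xs)
    note r = 3(1)[simplified]
    have "set xs \<subseteq> A" using 3(2) by simp
    then show ?case by (induction xs) (use r T(3) in auto)
  qed (use T(1) in simp)
qed

lemma RE_args_subset:
  assumes "RE L"
  shows "RE {F. args F \<subseteq> L}"
proof -
  obtain T where T: "tree_re T" "\<And>t. t \<in> T \<Longrightarrow> of_tree t \<in> L" "\<And>x. x \<in> L \<Longrightarrow> tree_of x \<in> T"
    using assms by (rule RE_E) blast
  obtain W where W: "tree_re W" "\<And>t. t \<in> W \<Longrightarrow> set (of_tree t) \<subseteq> L"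
    "\<And>x. set x \<subseteq> L \<Longrightarrow> tree_of x \<in> W"
    using RE_subset_list[OF assms] by (rule RE_E1) blast
  show ?thesis
  proof (rule RE_I[where Os = "[T, W]" and P = "[
      ([Ora 0 (V 0), Ora 0 (V 1)], pEq (V 0) (V 1)),
      ([Ora 1 (V 1)], pPrd (V 0) (V 1)),
      ([Own (V 0)], pNeg (V 0)),
      ([Own (V 0), Own (V 1)], pBin (V 2) (V 0) (V 1)),
      ([Own (V 0)], pQu (V 2) (V 1) (V 0))]"], goal_cases)
    case 2
    then show ?case using T(2) W(2) by (auto simp: closed_def)
  next
    case (3 X F)
    note r = 3(1)[simplified]
    have "args F \<subseteq> L" using 3(2) by simp
    then show ?case by (induction F) (use r T(3) W(3) in auto)
  qed (use T(1) W(1) in simp)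
qed

lemma RE_member: "RE {(x :: 'a::tree_coded, xs). x \<in> set xs}"
proof (rule RE_I[where Os = "[]" and P = "[([], V 0 \<bullet> V 0 \<bullet> V 1),
    ([Own (V 0 \<bullet> V 1)], V 0 \<bullet> V 2 \<bullet> V 1)]"], goal_cases)
  case (3 X y)
  note r = 3(1)[simplified]
  have "x \<in> set xs \<Longrightarrow> tree_of x \<cdot> tree_of xs \<in> X" for x :: 'a and xs
    by (induction xs) (use r in auto)
  then show ?case using 3(2) by auto
qed (simp_all add: closed_def)

section \<open>Propositional tautologies\<close>

fun prop_truth :: "(fm \<Rightarrow> bool) \<Rightarrow> fm \<Rightarrow> bool" where
  "prop_truth w (Neg F) \<longleftrightarrow> \<not> prop_truth w F"
| "prop_truth w (Bin J F G) \<longleftrightarrow> conn_eval J (prop_truth w F) (prop_truth w G)"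
| "prop_truth w F \<longleftrightarrow> w F"

fun prop_atoms :: "fm \<Rightarrow> fm list" where
  "prop_atoms (Neg F) = prop_atoms F"
| "prop_atoms (Bin J F G) = prop_atoms F @ prop_atoms G"
| "prop_atoms F = [F]"

abbreviation models :: "(fm \<Rightarrow> bool) \<Rightarrow> (fm \<times> bool) list \<Rightarrow> bool" where
  "models w A \<equiv> \<forall>(F, b)\<in>set A. prop_truth w F = b"

text \<open>Under tag 2 the program evaluates a formula from an assignment of truth values to formulas;
  under tag 3 it splits on the truth value of any formula, starting from the empty assignment.\<close>

lemma RE_tautologies: "RE {F. \<forall>w. prop_truth w F}"
proof -
  obtain T where T: "tree_re T" "\<And>a b. a \<cdot> b \<in> T \<Longrightarrow> (of_tree a :: fm \<times> bool) \<in> set (of_tree b)"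
    "\<And>a b. (a :: fm \<times> bool) \<in> set b \<Longrightarrow> tree_of a \<cdot> tree_of b \<in> T"
    using RE_member by (rule RE_E2) blast
  let ?bool = "\<lambda>b :: bool. K (tree_of b)"
  \<comment> \<open>Soundness refers only to those \<open>w\<close> that agree with the assignment.
    So assignments that are contradictory or that fix the value of a compound formula do no
    harm.\<close>
  define X where "X = {t. let k = of_tree (lft t); u = rgt t in
    if k = (0::nat) then \<forall>w. prop_truth w (of_tree u)
    else if k = 2 then (case of_tree u of (A, F, b) \<Rightarrow> \<forall>w. models w A \<longrightarrow> prop_truth w F = b)
    else (case of_tree u of (A, F) \<Rightarrow> \<forall>w. models w A \<longrightarrow> prop_truth w F)}"
  show ?thesis
  proof (rule RE_I_tag[where Os = "[T]" and tag = "tree_of (0::nat)" and X = X and P = "[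
      ([Ora 0 ((V 1 \<bullet> V 2) \<bullet> V 0)], pTag 2 \<bullet> V 0 \<bullet> V 1 \<bullet> V 2),
      ([Own (pTag 2 \<bullet> V 0 \<bullet> V 1 \<bullet> ?bool True)], pTag 2 \<bullet> V 0 \<bullet> pNeg (V 1) \<bullet> ?bool False),
      ([Own (pTag 2 \<bullet> V 0 \<bullet> V 1 \<bullet> ?bool False)], pTag 2 \<bullet> V 0 \<bullet> pNeg (V 1) \<bullet> ?bool True),
      ([Own (pTag 2 \<bullet> V 0 \<bullet> V 1 \<bullet> ?bool True)], pTag 3 \<bullet> V 0 \<bullet> V 1),
      ([Own (pTag 3 \<bullet> ((V 2 \<bullet> ?bool True) \<bullet> V 0) \<bullet> V 1), Own (pTag 3 \<bullet> ((V 2 \<bullet> ?bool False) \<bullet> V 0) \<bullet> V 1)],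
        pTag 3 \<bullet> V 0 \<bullet> V 1),
      ([Own (pTag 3 \<bullet> pNil \<bullet> V 0)], pTag 0 \<bullet> V 0)] @
      [([Own (pTag 2 \<bullet> V 0 \<bullet> V 1 \<bullet> ?bool a), Own (pTag 2 \<bullet> V 0 \<bullet> V 2 \<bullet> ?bool b)],
        pTag 2 \<bullet> V 0 \<bullet> pBin (K (tree_of J)) (V 1) (V 2) \<bullet> ?bool (conn_eval J a b)).
        J \<leftarrow> [CImp, CIff, CAnd, COr], a \<leftarrow> [True, False], b \<leftarrow> [True, False]]"], goal_cases)
    case 2
    show ?case by (auto simp: closed_def X_def dest!: T(2))
  next
    case (3 t)
    then show ?case by (simp add: X_def)
  next
    case (4 Y F)
    note r = 4(1)[simplified]
    note r1 = r[THEN conjunct1] and r' = r[THEN conjunct2]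
    note r2 = r'[THEN conjunct1] and r' = r'[THEN conjunct2]
    note r3 = r'[THEN conjunct1] and r' = r'[THEN conjunct2]
    note r4 = r'[THEN conjunct1] and r' = r'[THEN conjunct2]
    note r5 = r'[THEN conjunct1] and r' = r'[THEN conjunct2]
    note r6 = r'[THEN conjunct1] and r7 = r'[THEN conjunct2]
    let ?ev = "\<lambda>A F b. tree_of (2::nat) \<cdot> tree_of (A :: (fm \<times> bool) list) \<cdot> tree_of (F :: fm) \<cdot> tree_of (b::bool) \<in> Y"
    let ?sp = "\<lambda>A. tree_of (3::nat) \<cdot> tree_of (A :: (fm \<times> bool) list) \<cdot> tree_of F \<in> Y"
    have ev_mem: "?ev A F b" if "(F, b) \<in> set A" for A F b
      using r1 T(3)[OF that] by simp
    have ev_neg: "?ev A (Neg F) (\<not> b)" if "?ev A F b" for A :: "(fm \<times> bool) list" and F b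
      using r2 r3 that by (cases b) simp_all
    have ev_bin: "?ev A (Bin J F G) (conn_eval J a b)" if "?ev A F a" "?ev A G b"
      for A :: "(fm \<times> bool) list" and J F G a b
      using r7 that by (cases J; cases a; cases b) simp_all
    have ev: "set (map (\<lambda>g. (g, w g)) (prop_atoms F)) \<subseteq> set A \<Longrightarrow> ?ev A F (prop_truth w F)" for A F w
    proof (induction F)
      case (Neg F)
      then show ?case using ev_neg by simp
    next
      case (Bin J F G)
      then show ?case using ev_bin by simp
    next
      case (Eq l m)
      then show ?case using ev_mem[of "Eq l m" "w (Eq l m)" A] by simp
    next
      case (Prd p ls)
      then show ?case using ev_mem[of "Prd p ls" "w (Prd p ls)" A] by simp
    next
      case (Qu Q x F)
      then show ?case using ev_mem[of "Qu Q x F" "w (Qu Q x F)" A] by simp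
    qed
    have sp_leaf: "?sp A" if "?ev A F True" for A
      using r4 that by simp
    have sp_split: "?sp A" if "?sp ((g, True) # A)" "?sp ((g, False) # A)" for A g
      using r5[rule_format, OF exI[of _ "tree_of g"], of "tree_of A" "tree_of F"] that by simp
    \<comment> \<open>Atoms are removed one at a time by a split. Distinctness ensures that the
      update \<open>w(g := c)\<close> affects the pair of \<open>g\<close> only.\<close>
    have sp: "distinct gs \<Longrightarrow> (\<And>w. ?sp (map (\<lambda>g. (g, w g)) gs @ A)) \<Longrightarrow> ?sp A" for gs A
    proof (induction gs arbitrary: A)
      case (Cons g gs)
      have "?sp (map (\<lambda>g. (g, w g)) gs @ A)" for w
      proof -
        have "?sp ((g, c) # map (\<lambda>g. (g, w g)) gs @ A)" for c
        proof -
          have "map (\<lambda>h. (h, (w(g := c)) h)) (g # gs) = (g, c) # map (\<lambda>g. (g, w g)) gs"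
            using Cons.prems(1) by auto
          then show ?thesis using Cons.prems(2)[of "w(g := c)"] by (simp only: append_Cons)
        qed
        then show ?thesis using sp_split by blast
      qed
      then show ?case using Cons.IH[of A] Cons.prems(1) by simp
    qed simp
    have "?sp (map (\<lambda>g. (g, w g)) (remdups (prop_atoms F)) @ [])" for w
      using ev[of w F "map (\<lambda>g. (g, w g)) (remdups (prop_atoms F)) @ []"] 4(2) by (intro sp_leaf) simp
    then have "?sp []" by (rule sp[rotated]) simp
    then show ?case using r6 by simp
  qed (use T(1) in simp)
qed

instance item :: countable by countable_datatype
instance conn :: countable by countable_datatype
instance quant :: countable by countable_datatype
instance fm :: countable by countable_datatype

text \<open>Propositional variables are numbers, so an atom becomes a variable through a numbering
  of all formulas. Injectivity of the numbering makes \<open>F\<close> an instance of its own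
  skeleton.\<close>

fun prop_skeleton :: "fm \<Rightarrow> pform" where
  "prop_skeleton (Neg F) = PNeg (prop_skeleton F)"
| "prop_skeleton (Bin J F G) = PBin J (prop_skeleton F) (prop_skeleton G)"
| "prop_skeleton F = PVar (to_nat F)"

text \<open>Replaces the search for a schema and a substitution by a property of the formula alone.
  One direction evaluates the schema by the truth values of the inserted formulas, the other takes
  the skeleton as schema.\<close>

lemma tautology_instances:
  "{F. \<exists>\<sigma> a. F = prop_inst \<sigma> a \<and> (\<forall>v. prop_eval v a)} = {F. \<forall>w. prop_truth w F}"
proof (intro set_eqI iffI; clarify)
  fix w \<sigma> a
  assume "\<forall>v. prop_eval v a"
  moreover have "prop_truth w (prop_inst \<sigma> a) = prop_eval (\<lambda>n. prop_truth w (\<sigma> n)) a"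
    by (induction a) auto
  ultimately show "prop_truth w (prop_inst \<sigma> a)" by simp
next
  fix F
  assume "\<forall>w. prop_truth w F"
  moreover have "prop_eval v (prop_skeleton F) = prop_truth (\<lambda>G. v (to_nat G)) F" for v
    by (induction F) auto
  moreover have "prop_inst from_nat (prop_skeleton F) = F"
    by (induction F) auto
  ultimately show "\<exists>\<sigma> a. F = prop_inst \<sigma> a \<and> (\<forall>v. prop_eval v a)" by metis
qed

lemma RE_axioms:
  assumes "mA M = UNIV" "mP M = UNIV" "RE (mB M)"
  shows "RE (axioms_of M)"
proof -
  obtain S where S: "tree_re S"
    "\<And>a b c d. a \<cdot> b \<cdot> c \<cdot> d \<in> S \<Longrightarrow> of_tree d = sbF (of_tree a) (of_tree b) (of_tree c)"
    "\<And>a b c d. d = sbF a b c \<Longrightarrow> tree_of a \<cdot> tree_of b \<cdot> tree_of c \<cdot> tree_of d \<in> S"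
    using RE_sbF by (rule RE_E4) blast
  have S': "of_tree a \<notin> free (of_tree b)" if "b \<cdot> (tree_of [Cst 0]) \<cdot> a \<cdot> b \<in> S" for a b
    using S(2)[OF that] sbF_Cst_idem_iff by (metis of_tree_tree_of)
  note S' = S'[simplified]
  have S'': "tree_of F \<cdot> (tree_of [Cst 0]) \<cdot> tree_of x \<cdot> tree_of F \<in> S" if "x \<notin> free F" for x F
    by (rule S(3)) (metis that sbF_Cst_idem_iff)
  define Q where "Q = {Imp (Qu QAll x F) F | x F. True} \<union>
    {Imp (Qu QAll x (Imp F G)) (Imp F (Qu QAll x G)) | x F G. x \<notin> free F} \<union>
    {Bin CIff (Neg (Qu QAll x (Neg F))) (Qu QEx x F) | x F. True}"
  let ?all = "pQu (K (tree_of QAll))"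
  have "RE Q"
  proof (rule RE_I[where Os = "[S]" and P = "[
      ([], pImp (?all (V 0) (V 1)) (V 1)),
      ([Ora 0 (V 1 \<bullet> K (tree_of [Cst 0]) \<bullet> V 0 \<bullet> V 1)],
        pImp (?all (V 0) (pImp (V 1) (V 2))) (pImp (V 1) (?all (V 0) (V 2)))),
      ([], pBin (K (tree_of CIff)) (pNeg (?all (V 0) (pNeg (V 1)))) (pQu (K (tree_of QEx)) (V 0) (V 1)))]"], goal_cases)
    case 2
    then show ?case by (auto simp: closed_def Q_def dest!: S')
  next
    case (3 X F)
    then show ?case using S'' by (auto simp: Q_def)
  qed (use S(1) in simp)
  then have "RE ({F. \<exists>\<sigma> a. F = prop_inst \<sigma> a \<and> (\<forall>v. prop_eval v a)} \<union> (eq_axioms UNIV UNIV \<union> (Q \<union> mB M)))"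
    unfolding tautology_instances using assms(3)
    by (intro RE_Un RE_tautologies RE_eq_axioms RE_UNIV)
  moreover have "axioms_of M = {F. \<exists>\<sigma> a. F = prop_inst \<sigma> a \<and> (\<forall>v. prop_eval v a)} \<union> (eq_axioms UNIV UNIV \<union> (Q \<union> mB M))"
    (is "_ = ?A")
  proof (intro set_eqI iffI)
    show "F \<in> ?A" if "F \<in> axioms_of M" for F
      using that
    proof cases
      case (taut a \<sigma>)
      then show ?thesis by blast
    qed (use assms in \<open>auto simp: Q_def\<close>)
    show "F \<in> axioms_of M" if "F \<in> ?A" for F
      using that assms by (auto simp: Q_def intro: axioms_of.intros)
  qed
  ultimately show ?thesis by simp
qed

section \<open>The induction rule and provability as programs\<close>

lemma RE_length_eq: "RE {(xs :: 'a::tree_coded list, ys :: 'b::tree_coded list). length xs = length ys}"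
proof (rule RE_I[where Os = "[]" and P = "[([], K Lf \<bullet> K Lf),
    ([Own (V 0 \<bullet> V 1)], (V 2 \<bullet> V 0) \<bullet> V 3 \<bullet> V 1)]"], goal_cases)
  case (3 X z)
  note r = 3(1)[simplified]
  have "length xs = length ys \<Longrightarrow> tree_of xs \<cdot> tree_of ys \<in> X" for xs :: "'a list" and ys :: "'b list"
    by (induction xs ys rule: list_induct2) (use r in auto)
  then show ?case using 3(2) by auto
qed (simp_all add: closed_def)

lemma RE_length_neq: "RE {(xs :: 'a::tree_coded list, ys :: 'b::tree_coded list). length xs \<noteq> length ys}"
proof (rule RE_I[where Os = "[]" and P = "[([], K Lf \<bullet> V 0 \<bullet> V 1), ([], (V 0 \<bullet> V 1) \<bullet> K Lf),
    ([Own (V 0 \<bullet> V 1)], (V 2 \<bullet> V 0) \<bullet> V 3 \<bullet> V 1)]"], goal_cases)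
  case (3 X z)
  note r = 3(1)[simplified]
  have "length xs \<noteq> length ys \<Longrightarrow> tree_of xs \<cdot> tree_of ys \<in> X" for xs :: "'a list" and ys :: "'b list"
  proof (induction xs arbitrary: ys)
    case Nil
    then show ?case using r by (cases ys) auto
  next
    case (Cons x xs)
    then show ?case using r by (cases ys) auto
  qed
  then show ?case using 3(2) by auto
qed (simp_all add: closed_def)

lemma RE_map_Var: "RE {(xs, ls). ls = map (\<lambda>x. [Var x]) xs}"
proof (rule RE_I[where Os = "[]" and P = "[([], pNil \<bullet> pNil),
    ([Own (V 0 \<bullet> V 1)], (V 2 \<bullet> V 0) \<bullet> (pVar (V 2) \<bullet> pNil) \<bullet> V 1)]"], goal_cases)
  case (3 X z)
  note r = 3(1)[simplified]
  have "tree_of xs \<cdot> tree_of (map (\<lambda>x. [Var x]) xs) \<in> X" for xs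
    by (induction xs) (use r in auto)
  then show ?case using 3(2) by auto
qed (simp_all add: closed_def)

lemma RE_distinct: "RE {xs :: nat list. distinct xs}"
proof -
  obtain N where N: "tree_re N" "\<And>a b. a \<cdot> b \<in> N \<Longrightarrow> (of_tree a :: nat) \<noteq> of_tree b"
    "\<And>a b :: nat. a \<noteq> b \<Longrightarrow> tree_of a \<cdot> tree_of b \<in> N"
    using RE_neq by (rule RE_E2) blast
  have "RE {(x :: nat, xs). x \<notin> set xs}"
  proof (rule RE_I[where Os = "[N]" and P = "[([], V 0 \<bullet> pNil),
      ([Ora 0 (V 0 \<bullet> V 1), Own (V 0 \<bullet> V 2)], V 0 \<bullet> V 1 \<bullet> V 2)]"], goal_cases)
    case 2
    then show ?case using N(2) by (auto simp: closed_def)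
  next
    case (3 X z)
    note r = 3(1)[simplified]
    have "x \<notin> set xs \<Longrightarrow> tree_of x \<cdot> tree_of xs \<in> X" for x :: nat and xs
      by (induction xs) (use r N(3) in auto)
    then show ?case using 3(2) by auto
  qed (use N(1) in simp)
  then obtain M where M: "tree_re M" "\<And>a b. a \<cdot> b \<in> M \<Longrightarrow> (of_tree a :: nat) \<notin> set (of_tree b)"
    "\<And>a b. (a :: nat) \<notin> set b \<Longrightarrow> tree_of a \<cdot> tree_of b \<in> M"
    by (rule RE_E2) blast
  show ?thesis
  proof (rule RE_I[where Os = "[M]" and P = "[([], pNil), ([Ora 0 (V 0 \<bullet> V 1), Own (V 1)], V 0 \<bullet> V 1)]"], goal_cases)
    case 2
    then show ?case using M(2) by (auto simp: closed_def)
  next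
    case (3 X xs)
    note r = 3(1)[simplified]
    have "distinct xs" using 3(2) by simp
    then show ?case by (induction xs) (use r M(3) in auto)
  qed (use M(1) in simp)
qed

text \<open>\<open>zip\<close> stops at the shorter list; hence the two base clauses, one for each
  list being exhausted.\<close>

lemma RE_fold_sbF: "RE {(xs, ls, G, H). H = fold (\<lambda>(x, l) H. sbF H l x) (zip xs ls) G}"
proof -
  obtain S where S: "tree_re S"
    "\<And>a b c d. a \<cdot> b \<cdot> c \<cdot> d \<in> S \<Longrightarrow> of_tree d = sbF (of_tree a) (of_tree b) (of_tree c)"
    "\<And>a b c d. d = sbF a b c \<Longrightarrow> tree_of a \<cdot> tree_of b \<cdot> tree_of c \<cdot> tree_of d \<in> S"
    using RE_sbF by (rule RE_E4) blast
  show ?thesis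
  proof (rule RE_I[where Os = "[S]" and P = "[([], pNil \<bullet> V 0 \<bullet> V 1 \<bullet> V 1), ([], V 0 \<bullet> pNil \<bullet> V 1 \<bullet> V 1),
      ([Ora 0 (V 4 \<bullet> V 1 \<bullet> V 0 \<bullet> V 5), Own (V 2 \<bullet> V 3 \<bullet> V 5 \<bullet> V 6)],
        (V 0 \<bullet> V 2) \<bullet> (V 1 \<bullet> V 3) \<bullet> V 4 \<bullet> V 6)]"], goal_cases)
    case 2
    then show ?case using S(2) by (auto simp: closed_def)
  next
    case (3 X z)
    note r = 3(1)[simplified]
    have "tree_of xs \<cdot> tree_of ls \<cdot> tree_of G \<cdot> tree_of (fold (\<lambda>(x, l) H. sbF H l x) (zip xs ls) G) \<in> X"
      for xs ls G
    proof (induction xs arbitrary: ls G)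
      case Nil
      then show ?case using r by auto
    next
      case (Cons x xs)
      show ?case
      proof (cases ls)
        case Nil
        then show ?thesis using r by auto
      next
        case ls: (Cons l ks)
        then show ?thesis using r S(3)[OF refl, of G l x] Cons[of ks "sbF G l x"] by auto
      qed
    qed
    then show ?case using 3(2) by auto
  qed (use S(1) in simp)
qed

text \<open>The condition for leaving \<open>Prd\<close> untouched is a negated conjunction and is
  split into two clauses, one for a different predicate and one for a different arity.\<close>

lemma RE_ind_inst: "RE {(p, xs, G, F, H). H = ind_inst p xs G F}"
proof -
  obtain N where N: "tree_re N" "\<And>a b. a \<cdot> b \<in> N \<Longrightarrow> (of_tree a :: nat) \<noteq> of_tree b"
    "\<And>a b :: nat. a \<noteq> b \<Longrightarrow> tree_of a \<cdot> tree_of b \<in> N"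
    using RE_neq by (rule RE_E2) blast
  obtain E where E: "tree_re E"
    "\<And>a b. a \<cdot> b \<in> E \<Longrightarrow> length (of_tree a :: item list list) = length (of_tree b :: nat list)"
    "\<And>a b. length (a :: item list list) = length (b :: nat list) \<Longrightarrow> tree_of a \<cdot> tree_of b \<in> E"
    using RE_length_eq by (rule RE_E2) blast
  obtain D where D: "tree_re D"
    "\<And>a b. a \<cdot> b \<in> D \<Longrightarrow> length (of_tree a :: item list list) \<noteq> length (of_tree b :: nat list)"
    "\<And>a b. length (a :: item list list) \<noteq> length (b :: nat list) \<Longrightarrow> tree_of a \<cdot> tree_of b \<in> D"
    using RE_length_neq by (rule RE_E2) blast
  obtain S where S: "tree_re S"
    "\<And>a b c d. a \<cdot> b \<cdot> c \<cdot> d \<in> S \<Longrightarrow>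
      of_tree d = fold (\<lambda>(x, l) H. sbF H l x) (zip (of_tree a) (of_tree b)) (of_tree c)"
    "\<And>a b c d. d = fold (\<lambda>(x, l) H. sbF H l x) (zip a b) c \<Longrightarrow>
      tree_of a \<cdot> tree_of b \<cdot> tree_of c \<cdot> tree_of d \<in> S"
    using RE_fold_sbF by (rule RE_E4) blast
  show ?thesis
  proof (rule RE_I[where Os = "[N, E, D, S]" and P = "[
      ([], V 0 \<bullet> V 1 \<bullet> V 2 \<bullet> pEq (V 3) (V 4) \<bullet> pEq (V 3) (V 4)),
      ([Ora 1 (V 3 \<bullet> V 1), Ora 3 (V 1 \<bullet> V 3 \<bullet> V 2 \<bullet> V 4)], V 0 \<bullet> V 1 \<bullet> V 2 \<bullet> pPrd (V 0) (V 3) \<bullet> V 4),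
      ([Ora 0 (V 4 \<bullet> V 0)], V 0 \<bullet> V 1 \<bullet> V 2 \<bullet> pPrd (V 4) (V 3) \<bullet> pPrd (V 4) (V 3)),
      ([Ora 2 (V 3 \<bullet> V 1)], V 0 \<bullet> V 1 \<bullet> V 2 \<bullet> pPrd (V 4) (V 3) \<bullet> pPrd (V 4) (V 3)),
      ([Own (V 0 \<bullet> V 1 \<bullet> V 2 \<bullet> V 3 \<bullet> V 4)], V 0 \<bullet> V 1 \<bullet> V 2 \<bullet> pNeg (V 3) \<bullet> pNeg (V 4)),
      ([Own (V 0 \<bullet> V 1 \<bullet> V 2 \<bullet> V 3 \<bullet> V 4), Own (V 0 \<bullet> V 1 \<bullet> V 2 \<bullet> V 5 \<bullet> V 6)],
        V 0 \<bullet> V 1 \<bullet> V 2 \<bullet> pBin (V 7) (V 3) (V 5) \<bullet> pBin (V 7) (V 4) (V 6)),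
      ([Own (V 0 \<bullet> V 1 \<bullet> V 2 \<bullet> V 3 \<bullet> V 4)], V 0 \<bullet> V 1 \<bullet> V 2 \<bullet> pQu (V 5) (V 6) (V 3) \<bullet> pQu (V 5) (V 6) (V 4))]"],
      goal_cases)
    case 1
    show ?case using N(1) E(1) D(1) S(1) by simp
  next
    case 2
    then show ?case by (auto simp: closed_def dest!: N(2) E(2) D(2) S(2))
  next
    case (3 X z)
    note r = 3(1)[simplified]
    have "tree_of p \<cdot> tree_of xs \<cdot> tree_of G \<cdot> tree_of F \<cdot> tree_of (ind_inst p xs G F) \<in> X" for p xs G F
    proof (induction F)
      case (Prd q ls)
      then show ?case using r N(3)[of q p] E(3)[of ls xs] D(3)[of ls xs] S(3)[OF refl, of xs ls G] by auto
    qed (use r in auto)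
    then show ?case using 3(2) by auto
  qed
qed

text \<open>Positive description of the basis R-axioms that contribute no premise to the induction
  rule. The program follows the implications to the conclusion and accepts anything but
  \<open>p\<close> with the arity in question.\<close>

lemma RE_no_r_conclusion:
  "RE {(p, xs :: nat list, F). \<forall>ls. r_conclusion F = Prd p ls \<longrightarrow> length ls \<noteq> length xs}"
proof -
  obtain N where N: "tree_re N" "\<And>a b. a \<cdot> b \<in> N \<Longrightarrow> (of_tree a :: nat) \<noteq> of_tree b"
    "\<And>a b :: nat. a \<noteq> b \<Longrightarrow> tree_of a \<cdot> tree_of b \<in> N"
    using RE_neq by (rule RE_E2) blast
  obtain D where D: "tree_re D"
    "\<And>a b. a \<cdot> b \<in> D \<Longrightarrow> length (of_tree a :: item list list) \<noteq> length (of_tree b :: nat list)"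
    "\<And>a b. length (a :: item list list) \<noteq> length (b :: nat list) \<Longrightarrow> tree_of a \<cdot> tree_of b \<in> D"
    using RE_length_neq by (rule RE_E2) blast
  show ?thesis
  proof (rule RE_I[where Os = "[N, D]" and P = "[
      ([], V 0 \<bullet> V 1 \<bullet> pEq (V 2) (V 3)),
      ([Ora 0 (V 2 \<bullet> V 0)], V 0 \<bullet> V 1 \<bullet> pPrd (V 2) (V 3)),
      ([Ora 1 (V 3 \<bullet> V 1)], V 0 \<bullet> V 1 \<bullet> pPrd (V 2) (V 3)),
      ([], V 0 \<bullet> V 1 \<bullet> pNeg (V 2)),
      ([], V 0 \<bullet> V 1 \<bullet> pBin (K (tree_of CIff)) (V 2) (V 3)),
      ([], V 0 \<bullet> V 1 \<bullet> pBin (K (tree_of CAnd)) (V 2) (V 3)),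
      ([], V 0 \<bullet> V 1 \<bullet> pBin (K (tree_of COr)) (V 2) (V 3)),
      ([Own (V 0 \<bullet> V 1 \<bullet> V 3)], V 0 \<bullet> V 1 \<bullet> pImp (V 2) (V 3)),
      ([], V 0 \<bullet> V 1 \<bullet> pQu (V 2) (V 3) (V 4))]"], goal_cases)
    case 1
    show ?case using N(1) D(1) by simp
  next
    case 2
    then show ?case by (auto simp: closed_def dest!: N(2) D(2))
  next
    case (3 X z)
    note r = 3(1)[simplified]
    have "\<forall>ls. r_conclusion F = Prd p ls \<longrightarrow> length ls \<noteq> length xs \<Longrightarrow>
        tree_of p \<cdot> tree_of xs \<cdot> tree_of F \<in> X" for p and xs :: "nat list" and F
    proof (induction F)
      case (Prd q ls)
      then show ?case using r N(3)[of q p] D(3)[of ls xs] by auto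
    next
      case (Bin J F G)
      then show ?case using r by (cases J) simp_all
    qed (use r in auto)
    then show ?case using 3(2) by auto
  qed
qed

lemma RE_avoid:
  assumes "finite W"
  shows "RE {F. var_fm F \<inter> W = {}}"
  using assms
proof (induction W rule: finite_induct)
  case empty
  then show ?case by (simp add: RE_UNIV)
next
  case (insert x W)
  obtain T where T: "tree_re T" "\<And>a b. a \<cdot> b \<in> T \<Longrightarrow> of_tree a \<notin> var_fm (of_tree b)"
    "\<And>a b. a \<notin> var_fm b \<Longrightarrow> tree_of a \<cdot> tree_of b \<in> T"
    using RE_notin_var by (rule RE_E2) blast
  have "RE {F. x \<notin> var_fm F}"
  proof (rule RE_I[where Os = "[T]" and P = "[([Ora 0 (K (tree_of x) \<bullet> V 0)], V 0)]"], goal_cases)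
    case 2
    then show ?case using T(2) by (fastforce simp: closed_def)
  next
    case (3 X F)
    then show ?case using T(3)[of x F] by auto
  qed (use T(1) in simp)
  from RE_Int[OF this insert.IH] show ?case
    by (rule back_subst[of RE]) auto
qed

lemma finite_var_fm: "finite (var_fm F)"
proof -
  have "finite (var_list l)" for l
    by (induction l rule: items_induct) (auto simp: var_list_def)
  then show ?thesis by (induction F) auto
qed

text \<open>Tag 0 stands for provability. Under tag 2 the program checks the premises of the induction
  rule along the list of basis R-axioms.\<close>

lemma RE_provable:
  assumes M: "mathematical_system M" and AP: "mA M = UNIV" "mP M = UNIV"
    and L: "restricted_arglists M L" and REs: "RE (mB M)" "RE L"
  shows "RE (provable M L)"
proof -
  \<comment> \<open>All symbols belong to \<open>M\<close> and all members of \<open>L\<close> are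
    well-formed, so only the argument lists remain to be checked.\<close>
  have FI: "formula_in M L F \<longleftrightarrow> args F \<subseteq> L" for F
  proof -
    have "args F \<subseteq> L \<Longrightarrow> formula UNIV UNIV F"
      by (induction F) (use L AP in \<open>auto simp: restricted_arglists_def\<close>)
    then show ?thesis by (auto simp: formula_in_def AP)
  qed
  define W where "W = (\<Union>F\<in>set (rB (mS M)). var_fm F)"
  \<comment> \<open>The variables of \<open>xs\<close> and \<open>G\<close> are just those of the
    formula that the rule appends. The condition thus becomes a test of this one formula against the
    fixed finite set \<open>W\<close>.\<close>
  have W: "(\<forall>F\<in>set (rB (mS M)). var_fm F \<inter> (set xs \<union> var_fm G) = {}) \<longleftrightarrow>
      var_fm (Imp (Prd p (map (\<lambda>x. [Var x]) xs)) G) \<inter> W = {}" for p xs G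
    by (auto simp: W_def var_list_def)
  have "RE (axioms_of M \<inter> {F. args F \<subseteq> L})"
    by (intro RE_Int RE_axioms RE_args_subset AP REs)
  then obtain AX where AX: "tree_re AX"
    "\<And>t. t \<in> AX \<Longrightarrow> of_tree t \<in> axioms_of M \<inter> {F. args F \<subseteq> L}"
    "\<And>F. F \<in> axioms_of M \<inter> {F. args F \<subseteq> L} \<Longrightarrow> tree_of F \<in> AX"
    by (rule RE_E) blast
  obtain LL where LL: "tree_re LL" "\<And>t. t \<in> LL \<Longrightarrow> of_tree t \<in> L" "\<And>l. l \<in> L \<Longrightarrow> tree_of l \<in> LL"
    using REs(2) by (rule RE_E) blast
  obtain C where C: "tree_re C"
    "\<And>a b c. a \<cdot> b \<cdot> c \<in> C \<Longrightarrow> CF (of_tree a) (of_tree b) (of_tree c)"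
    "\<And>a b c. CF a b c \<Longrightarrow> tree_of a \<cdot> tree_of b \<cdot> tree_of c \<in> C"
    using RE_CF by (rule RE_E3) blast
  obtain S where S: "tree_re S"
    "\<And>a b c d. a \<cdot> b \<cdot> c \<cdot> d \<in> S \<Longrightarrow> of_tree d = sbF (of_tree a) (of_tree b) (of_tree c)"
    "\<And>a b c d. d = sbF a b c \<Longrightarrow> tree_of a \<cdot> tree_of b \<cdot> tree_of c \<cdot> tree_of d \<in> S"
    using RE_sbF by (rule RE_E4) blast
  obtain A where A: "tree_re A" "\<And>t. t \<in> A \<Longrightarrow> args (of_tree t) \<subseteq> L" "\<And>F. args F \<subseteq> L \<Longrightarrow> tree_of F \<in> A"
    using RE_args_subset[OF REs(2)] by (rule RE_E1) blast
  have "RE (rP (mS M))"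
    using M by (intro RE_finite) (simp add: mathematical_system_def recursive_system_def)
  then obtain Q where Q: "tree_re Q" "\<And>t. t \<in> Q \<Longrightarrow> of_tree t \<in> rP (mS M)"
    "\<And>p. p \<in> rP (mS M) \<Longrightarrow> tree_of p \<in> Q"
    by (rule RE_E) blast
  obtain D where D: "tree_re D" "\<And>t. t \<in> D \<Longrightarrow> distinct (of_tree t :: nat list)"
    "\<And>xs :: nat list. distinct xs \<Longrightarrow> tree_of xs \<in> D"
    using RE_distinct by (rule RE_E1) blast
  obtain Z where Z: "tree_re Z"
    "\<And>a b. a \<cdot> b \<in> Z \<Longrightarrow> of_tree b = map (\<lambda>x. [Var x]) (of_tree a)"
    "\<And>a b. b = map (\<lambda>x. [Var x]) a \<Longrightarrow> tree_of a \<cdot> tree_of b \<in> Z"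
    using RE_map_Var by (rule RE_E2) blast
  have "RE {F. var_fm F \<inter> W = {}}"
    by (intro RE_avoid) (simp add: W_def finite_var_fm)
  then obtain N where N: "tree_re N" "\<And>t. t \<in> N \<Longrightarrow> var_fm (of_tree t) \<inter> W = {}"
    "\<And>F. var_fm F \<inter> W = {} \<Longrightarrow> tree_of F \<in> N"
    by (rule RE_E1) blast
  obtain I where I: "tree_re I"
    "\<And>a b c d e. a \<cdot> b \<cdot> c \<cdot> d \<cdot> e \<in> I \<Longrightarrow> of_tree e = ind_inst (of_tree a) (of_tree b) (of_tree c) (of_tree d)"
    "\<And>a b c d e. e = ind_inst a b c d \<Longrightarrow> tree_of a \<cdot> tree_of b \<cdot> tree_of c \<cdot> tree_of d \<cdot> tree_of e \<in> I"
    using RE_ind_inst by (rule RE_E5) blast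
  obtain R where R: "tree_re R"
    "\<And>a b c. a \<cdot> b \<cdot> c \<in> R \<Longrightarrow>
      \<forall>ls. r_conclusion (of_tree c) = Prd (of_tree a) ls \<longrightarrow> length ls \<noteq> length (of_tree b :: nat list)"
    "\<And>a b c. \<forall>ls. r_conclusion c = Prd a ls \<longrightarrow> length ls \<noteq> length (b :: nat list) \<Longrightarrow>
      tree_of a \<cdot> tree_of b \<cdot> tree_of c \<in> R"
    using RE_no_r_conclusion by (rule RE_E3) blast
  define ok where "ok = (\<lambda>(p, xs :: nat list, G, Fs). \<forall>F\<in>set Fs. \<forall>ls. r_conclusion F = Prd p ls \<longrightarrow>
    length ls = length xs \<longrightarrow> ind_inst p xs G F \<in> provable M L)"
  define X where "X = {t. if of_tree (lft t) = (0::nat) then of_tree (rgt t) \<in> provable M L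
    else ok (of_tree (rgt t))}"
  have ok_Nil: "ok (p, xs, G, [])" for p xs G
    by (simp add: ok_def)
  have ok_Cons: "ok (p, xs, G, F # Fs) \<longleftrightarrow> ok (p, xs, G, Fs) \<and>
      (\<forall>ls. r_conclusion F = Prd p ls \<longrightarrow> length ls = length xs \<longrightarrow> ind_inst p xs G F \<in> provable M L)" for p xs G F Fs
    by (auto simp: ok_def)
  have induction: "Imp (Prd p (map (\<lambda>x. [Var x]) xs)) G \<in> provable M L"
    if "p \<in> rP (mS M)" "distinct xs" "args G \<subseteq> L"
      "var_fm (Imp (Prd p (map (\<lambda>x. [Var x]) xs)) G) \<inter> W = {}" "ok (p, xs, G, rB (mS M))" for p xs G
  proof (rule provable.induction)
    show "var_fm F \<inter> (set xs \<union> var_fm G) = {}" if "F \<in> set (rB (mS M))" for F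
      using iffD2[OF W \<open>var_fm _ \<inter> W = {}\<close>] that by blast
  qed (use that in \<open>auto simp: FI ok_def\<close>)
  let ?pr = "\<lambda>p. pTag 0 \<bullet> p"
  show ?thesis
  proof (rule RE_I_tag[where Os = "[AX, LL, C, S, A, Q, D, Z, N, I, R]" and tag = "tree_of (0::nat)" and X = X and P = "[
      ([Ora 0 (V 0)], ?pr (V 0)),
      ([Own (?pr (V 0)), Own (?pr (pImp (V 0) (V 1)))], ?pr (V 1)),
      ([Own (?pr (V 0)), Ora 1 (V 1), Ora 2 (V 0 \<bullet> V 1 \<bullet> V 2), Ora 3 (V 0 \<bullet> V 1 \<bullet> V 2 \<bullet> V 3)], ?pr (V 3)),
      ([Own (?pr (V 0))], ?pr (pQu (K (tree_of QAll)) (V 1) (V 0))),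
      ([Ora 5 (V 0), Ora 6 (V 1), Ora 4 (V 2), Ora 7 (V 1 \<bullet> V 3), Ora 8 (pImp (pPrd (V 0) (V 3)) (V 2)),
        Own (pTag 2 \<bullet> V 0 \<bullet> V 1 \<bullet> V 2 \<bullet> K (tree_of (rB (mS M))))], ?pr (pImp (pPrd (V 0) (V 3)) (V 2))),
      ([], pTag 2 \<bullet> V 0 \<bullet> V 1 \<bullet> V 2 \<bullet> pNil),
      ([Ora 10 (V 0 \<bullet> V 1 \<bullet> V 3), Own (pTag 2 \<bullet> V 0 \<bullet> V 1 \<bullet> V 2 \<bullet> V 4)],
        pTag 2 \<bullet> V 0 \<bullet> V 1 \<bullet> V 2 \<bullet> V 3 \<bullet> V 4),
      ([Ora 9 (V 0 \<bullet> V 1 \<bullet> V 2 \<bullet> V 3 \<bullet> V 5), Own (?pr (V 5)), Own (pTag 2 \<bullet> V 0 \<bullet> V 1 \<bullet> V 2 \<bullet> V 4)],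
        pTag 2 \<bullet> V 0 \<bullet> V 1 \<bullet> V 2 \<bullet> V 3 \<bullet> V 4)]"], goal_cases)
    case 1
    show ?case using AX(1) LL(1) C(1) S(1) A(1) Q(1) D(1) Z(1) N(1) I(1) R(1) by simp
  next
    case 2
    show ?case
      unfolding closed_def X_def
    proof (simp, (intro conjI allI impI; (elim conjE)?), goal_cases)
      case (1 v)
      then show ?case using AX(2)[of "v 0"] by (auto simp: FI intro: provable.ax)
    next
      case (2 v)
      then show ?case by (rule provable.mp)
    next
      case (3 v)
      then show ?case using provable.subst LL(2) C(2) S(2) by metis
    next
      case (4 v)
      then show ?case by (rule provable.gen)
    next
      case (5 v)
      then show ?case
        using induction[of "of_tree (v 0)" "of_tree (v 1)" "of_tree (v 2)"] Q(2) D(2) A(2) Z(2) N(2)[OF 5(5)] by simp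
    next
      case (6 v)
      then show ?case by (simp add: ok_Nil)
    next
      case (7 v)
      then show ?case using R(2)[OF 7(1)] by (simp add: ok_Cons)
    next
      case (8 v)
      then show ?case using I(2)[OF 8(1)] by (simp add: ok_Cons)
    qed
  next
    case (3 t)
    then show ?case by (simp add: X_def)
  next
    case (4 Y F)
    note r = 4(1)[simplified]
    note r1 = r[THEN conjunct1] and r' = r[THEN conjunct2]
    note r2 = r'[THEN conjunct1] and r' = r'[THEN conjunct2]
    note r3 = r'[THEN conjunct1] and r' = r'[THEN conjunct2]
    note r4 = r'[THEN conjunct1] and r' = r'[THEN conjunct2]
    note r5 = r'[THEN conjunct1] and r' = r'[THEN conjunct2]
    note r6 = r'[THEN conjunct1] and r' = r'[THEN conjunct2]
    note r7 = r'[THEN conjunct1] and r8 = r'[THEN conjunct2]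
    from 4(2) show ?case
    proof (induction rule: provable.induct)
      case (ax F)
      then show ?case using r1 AX(3)[of F] by (simp add: FI)
    next
      case (mp F G)
      then show ?case using r2[rule_format, of "tree_of F" "tree_of G"] by simp
    next
      case (subst F l x)
      then show ?case
        using r3[rule_format, OF conjI[OF _ conjI[OF _ conjI[OF _ S(3)[OF refl]]]]]
          LL(3) C(3) by blast
    next
      case (gen F x)
      then show ?case using r4 by simp
    next
      case (induction p xs G)
      \<comment> \<open>Generalized from the basis to any list of basis R-axioms, so that the
        induction follows the recursion of the clauses under tag 2.\<close>
      have "tree_of (2::nat) \<cdot> tree_of p \<cdot> tree_of xs \<cdot> tree_of G \<cdot> tree_of Fs \<in> Y" if "set Fs \<subseteq> set (rB (mS M))" for Fs
        using that
      proof (induction Fs)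
        case Nil
        then show ?case using r6 by simp
      next
        case (Cons F Fs)
        show ?case
        proof (cases "\<exists>ls. r_conclusion F = Prd p ls \<and> length ls = length xs")
          case True
          then have "tree_of (0::nat) \<cdot> tree_of (ind_inst p xs G F) \<in> Y"
            using induction.IH[of F] Cons.prems by auto
          then show ?thesis
            using r8[rule_format, OF exI, OF conjI[OF I(3)[OF refl]], of p xs G F "tree_of Fs"] Cons by simp
        next
          case False
          then have "tree_of p \<cdot> tree_of xs \<cdot> tree_of F \<in> R" by (intro R(3)) blast
          then show ?thesis
            using r7[rule_format, of "tree_of p" "tree_of xs" "tree_of F" "tree_of G" "tree_of Fs"] Cons by simp
        qed
      qed
      from this[of "rB (mS M)"]
      have "tree_of (2::nat) \<cdot> tree_of p \<cdot> tree_of xs \<cdot> tree_of G \<cdot> tree_of (rB (mS M)) \<in> Y" by simp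
      moreover have "tree_of (Imp (Prd p (map (\<lambda>x. [Var x]) xs)) G) \<in> N"
        using induction(4) by (intro N(3) iffD1[OF W]) blast
      ultimately show ?case
        using induction(1-3) r5[rule_format, of "tree_of p" "tree_of xs" "tree_of G" "tree_of (map (\<lambda>x. [Var x]) xs)"]
          Q(3)[of p] D(3)[of xs] A(3)[of G] Z(3)[OF refl, of xs] by (simp add: FI)
    qed
  qed
qed

section \<open>Interpretations of recursive systems\<close>

text \<open>Simultaneous substitution, used in two roles: as evaluation in the model whose elements
  are item lists, and in \<open>sb_all\<close> to instantiate all variables of a formula.\<close>

fun ev_item :: "(nat \<Rightarrow> item list) \<Rightarrow> item \<Rightarrow> item list" where
  "ev_item v (Cst a) = [Cst a]"
| "ev_item v (Var x) = v x"
| "ev_item v (Op f l) = [Op f (concat (map (ev_item v) l))]"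

definition ev :: "(nat \<Rightarrow> item list) \<Rightarrow> item list \<Rightarrow> item list" where
  "ev v l = concat (map (ev_item v) l)"

lemma ev_simps [simp]:
  "ev v [] = []" "ev v (i # l) = ev_item v i @ ev v l" "ev v (l @ m) = ev v l @ ev v m"
  by (simp_all add: ev_def)

lemma ev_item_Op [simp]: "ev_item v (Op f l) = [Op f (ev v l)]"
  by (simp add: ev_def)

declare ev_item.simps(3) [simp del]

lemma var_list_simps [simp]:
  "var_list [] = {}" "var_list (i # l) = var_item i \<union> var_list l"
  "var_list (l @ m) = var_list l \<union> var_list m"
  by (auto simp: var_list_def)

lemma var_item_Op [simp]: "var_item (Op f l) = var_list l"
  by (simp add: var_list_def)

declare var_item.simps(3) [simp del]

lemma ev_cong: "\<forall>x\<in>var_list l. v x = w x \<Longrightarrow> ev v l = ev w l"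
  by (induction l rule: items_induct) auto

lemma ev_Var [simp]: "ev (\<lambda>x. [Var x]) l = l"
  by (induction l rule: items_induct) auto

lemma ev_ground: "var_list l = {} \<Longrightarrow> ev v l = l"
  using ev_cong[of l v "\<lambda>x. [Var x]"] by simp

lemma ev_sbL: "ev v (sbL l m x) = ev (v(x := ev v m)) l"
  by (induction l rule: items_induct) auto

text \<open>Equality is identity of the evaluated lists. R-formulas contain no quantifiers; the
  constant value in the last case makes \<open>sat_sbF\<close> true of every formula without a
  condition on bound variables.\<close>

fun sat :: "(nat \<Rightarrow> item list list \<Rightarrow> bool) \<Rightarrow> (nat \<Rightarrow> item list) \<Rightarrow> fm \<Rightarrow> bool" where
  "sat I v (Eq l m) \<longleftrightarrow> ev v l = ev v m"
| "sat I v (Prd p ls) \<longleftrightarrow> I p (map (ev v) ls)"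
| "sat I v (Neg F) \<longleftrightarrow> \<not> sat I v F"
| "sat I v (Bin J F G) \<longleftrightarrow> conn_eval J (sat I v F) (sat I v G)"
| "sat I v (Qu Q x F) \<longleftrightarrow> True"

lemma sat_sbF: "sat I v (sbF F m x) \<longleftrightarrow> sat I (v(x := ev v m)) F"
  by (induction F) (simp_all add: ev_sbL comp_def fun_upd_def)

lemma sat_foldr_Imp: "sat I v (foldr Imp Fs G) \<longleftrightarrow> ((\<forall>E\<in>set Fs. sat I v E) \<longrightarrow> sat I v G)"
  by (induction Fs) auto

lemma sat_eq_axioms:
  assumes "F \<in> eq_axioms A P"
  shows "sat I v F"
  using assms
proof cases
  case (eq_subst l m x y)
  then show ?thesis by (auto simp: ev_sbL)
next
  case (eq_pred p xs ys)
  have "length xs = length ys \<Longrightarrow> \<forall>E\<in>set (map2 (\<lambda>x y. Eq [Var x] [Var y]) xs ys). sat I v E \<Longrightarrow>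
      map v xs = map v ys"
    by (induction xs ys rule: list_induct2) auto
  then show ?thesis using eq_pred by (simp add: sat_foldr_Imp comp_def)
qed simp

text \<open>A substitution merely changes the valuation, so validity under all valuations passes
  through the substitution rule. The equality axioms hold however \<open>I\<close> interprets the
  predicates.\<close>

lemma r_derivable_sound:
  assumes "F \<in> r_derivable S" "\<And>F v. F \<in> set (rB S) \<Longrightarrow> sat I v F"
  shows "sat I v F"
  using assms by (induction arbitrary: v rule: r_derivable.induct) (auto simp: sat_eq_axioms sat_sbF)

section \<open>Ground instances of derivable formulas\<close>

fun sb_all :: "(nat \<Rightarrow> item list) \<Rightarrow> fm \<Rightarrow> fm" where
  "sb_all v (Eq l m) = Eq (ev v l) (ev v m)"
| "sb_all v (Prd p ls) = Prd p (map (ev v) ls)"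
| "sb_all v (Neg F) = Neg (sb_all v F)"
| "sb_all v (Bin J F G) = Bin J (sb_all v F) (sb_all v G)"
| "sb_all v (Qu Q x F) = Qu Q x F"

fun quantifier_free :: "fm \<Rightarrow> bool" where
  "quantifier_free (Neg F) \<longleftrightarrow> quantifier_free F"
| "quantifier_free (Bin J F G) \<longleftrightarrow> quantifier_free F \<and> quantifier_free G"
| "quantifier_free (Qu Q x F) \<longleftrightarrow> False"
| "quantifier_free F \<longleftrightarrow> True"

lemma sb_all_cong: "\<forall>x\<in>var_fm F. v x = w x \<Longrightarrow> sb_all v F = sb_all w F"
  by (induction F) (auto intro!: ev_cong)

lemma sb_all_Var: "sb_all (\<lambda>x. [Var x]) F = F"
  by (induction F) (auto simp: map_idI)

lemma sbL_ground: "var_list l = {} \<Longrightarrow> sbL l m x = l"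
  by (induction l rule: items_induct) auto

text \<open>The calculus replaces one variable at a time. Since the inserted lists are ground, later
  steps leave them unchanged and the steps add up to the simultaneous substitution.\<close>

lemma r_derivable_sb_all:
  assumes F: "F \<in> r_derivable S" "quantifier_free F"
    and g: "\<And>x. g x \<in> list_terms (rA S)" "\<And>x. var_list (g x) = {}"
  shows "sb_all g F \<in> r_derivable S"
proof -
  \<comment> \<open>Intermediate stage: the variables in \<open>X\<close> have been replaced
    already, the others stand for themselves.\<close>
  define v where "v X = (\<lambda>x. if x \<in> X then g x else [Var x])" for X
  have "sb_all (v X) F \<in> r_derivable S" if "finite X" for X
    using that
  proof (induction X rule: finite_induct)
    case empty
    then show ?case using F by (simp add: v_def sb_all_Var)
  next
    case (insert x X)
    have ev: "ev (v (insert x X)) l = sbL (ev (v X) l) (g x) x" for l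
    proof (induction l rule: items_induct)
      case (Var y l)
      then show ?case using insert.hyps by (auto simp: v_def sbL_ground g)
    qed auto
    have "quantifier_free H \<Longrightarrow> sb_all (v (insert x X)) H = sbF (sb_all (v X) H) (g x) x" for H
      by (induction H) (auto simp: ev)
    then show ?case using r_derivable.subst[OF insert.IH g(1)[of x], of x] F(2) by simp
  qed
  from this[OF finite_var_fm[of F]] sb_all_cong[of F "v (var_fm F)" g] show ?thesis
    by (simp add: v_def)
qed

lemma r_derivable_foldr_mp:
  "foldr Imp Fs G \<in> r_derivable S \<Longrightarrow> \<forall>E\<in>set Fs. E \<in> r_derivable S \<Longrightarrow> G \<in> r_derivable S"
  by (induction Fs) (auto intro: r_derivable.mp)

section \<open>Programs as recursive systems\<close>

text \<open>The left subtree is enclosed by the operation symbol, and the right one follows as the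
  tail of the list; the same symbol as a constant marks a leaf and keeps all lists nonempty. A
  variable at the end of a pattern can therefore stand for a whole right subtree.\<close>

fun tree_list :: "tree \<Rightarrow> item list" where
  "tree_list Lf = [Cst 0]"
| "tree_list (s \<cdot> t) = Op 0 (tree_list s) # tree_list t"

fun pat_list :: "pat \<Rightarrow> item list" where
  "pat_list (V i) = [Var i]"
| "pat_list (K t) = tree_list t"
| "pat_list (p \<bullet> q) = Op 0 (pat_list p) # pat_list q"

text \<open>Reads every list as a tree, so that the clauses also hold of lists that represent no tree.\<close>

function list_tree :: "item list \<Rightarrow> tree" where
  "list_tree [] = Lf"
| "list_tree (Cst a # l) = list_tree l"
| "list_tree (Var x # l) = list_tree l"
| "list_tree (Op f k # l) = list_tree k \<cdot> list_tree l"
  by pat_completeness auto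
termination by (relation "measure (size_list size)") auto

lemma list_tree_tree_list [simp]: "list_tree (tree_list t) = t"
  by (induction t) auto

lemma var_list_tree_list [simp]: "var_list (tree_list t) = {}"
  by (induction t) auto

lemma ev_tree_list [simp]: "ev v (tree_list t) = tree_list t"
  by (simp add: ev_ground)

lemma list_terms_Cons: "[i] \<in> list_terms A \<Longrightarrow> l \<in> list_terms A \<Longrightarrow> i # l \<in> list_terms A"
  using list_terms.conc[of "[i]" A l] by simp

lemma tree_list_terms: "0 \<in> A \<Longrightarrow> tree_list t \<in> list_terms A"
  by (induction t) (auto intro: list_terms.cst list_terms.op list_terms_Cons)

lemma pat_list_terms: "0 \<in> A \<Longrightarrow> pat_list p \<in> list_terms A"
  by (induction p) (auto intro: list_terms.var list_terms.op list_terms_Cons tree_list_terms)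

lemma list_tree_ev_pat_list: "list_tree (ev v (pat_list p)) = inst (\<lambda>i. list_tree (v i)) p"
  by (induction p) auto

lemma ev_pat_list: "ev (\<lambda>i. tree_list (v i)) (pat_list p) = tree_list (inst v p)"
  by (induction p) auto

text \<open>The value at \<open>Ora\<close> is a dummy: \<open>clause_fms\<close> keeps only clauses
  without oracle premises.\<close>

fun prem_fm :: "prem \<Rightarrow> fm" where
  "prem_fm (Own p) = Prd 0 [pat_list p]"
| "prem_fm (Ora j p) = Prd 0 [pat_list p]"

definition clause_fm :: "clause \<Rightarrow> fm" where
  "clause_fm = (\<lambda>(ps, c). foldr Imp (map prem_fm ps) (Prd 0 [pat_list c]))"

text \<open>Predicate 0 holds of the trees that the program accepts, predicate 1 relates the code of a
  string to the string itself, predicate 2 collects the strings whose code is accepted under the tag.\<close>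

definition clause_fms :: "clause list \<Rightarrow> tree \<Rightarrow> fm list" where
  "clause_fms P tag =
    map clause_fm (filter (\<lambda>(ps, c). \<forall>j p. Ora j p \<notin> set ps) P) @
    map (\<lambda>a. Prd 1 [tree_list (tree_of [Cst a]), [Cst a]]) [0..<17] @
    map (\<lambda>a. Imp (Prd 1 [[Var 0], [Var 1]])
      (Prd 1 [Op 0 (tree_list (tree_of (Cst a))) # [Var 0], [Cst a, Var 1]])) [0..<17] @
    [Imp (Prd 1 [[Var 0], [Var 1]]) (Imp (Prd 0 [Op 0 (tree_list tag) # [Var 0]]) (Prd 2 [[Var 1]]))]"

lemma set_clause_fms:
  "set (clause_fms P tag) = clause_fm ` {(ps, c) \<in> set P. \<forall>j p. Ora j p \<notin> set ps} \<union>
    (\<lambda>a. Prd 1 [tree_list (tree_of [Cst a]), [Cst a]]) ` {..<17} \<union>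
    (\<lambda>a. Imp (Prd 1 [[Var 0], [Var 1]])
      (Prd 1 [Op 0 (tree_list (tree_of (Cst a))) # [Var 0], [Cst a, Var 1]])) ` {..<17} \<union>
    {Imp (Prd 1 [[Var 0], [Var 1]]) (Imp (Prd 0 [Op 0 (tree_list tag) # [Var 0]]) (Prd 2 [[Var 1]]))}"
  unfolding clause_fms_def set_append set_map set_upt set_filter atLeast0LessThan
  by (simp add: split_def Un_assoc)

lemma A17_eq: "A17 = {..<17}"
  by (auto simp: A17_def A11_def) presburger

lemma r_formula_Imp: "is_prime A P F \<Longrightarrow> r_formula A P G \<Longrightarrow> r_formula A P (Imp F G)"
  unfolding r_formula_def by (metis foldr.simps(2) comp_apply set_ConsD)

lemma r_formula_prime: "is_prime A P F \<Longrightarrow> r_formula A P F"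
  unfolding r_formula_def by (intro exI[of _ "[]"]) auto

lemma recursive_system_clause_fms: "recursive_system (initial_sys 17 3 (clause_fms P tag))"
proof -
  have "r_formula {..<17} {..<3} (foldr Imp (map prem_fm ps) (Prd 0 [pat_list c]))" for ps c
  proof (induction ps)
    case (Cons q ps)
    then show ?case by (cases q) (auto intro!: r_formula_Imp simp: pat_list_terms)
  qed (auto intro!: r_formula_prime simp: pat_list_terms)
  then have "r_formula {..<17} {..<3} F" if "F \<in> set (clause_fms P tag)" for F
    using that unfolding set_clause_fms
    by (elim UnE imageE)
      (auto simp: clause_fm_def list_terms.cst list_terms.var list_terms.op tree_list_terms
        list_terms_Cons[of _ _ "_ # _"] list_terms_Cons[of _ _ "tree_list _"] r_formula_Imp r_formula_prime)
  then show ?thesis by (simp add: recursive_system_def initial_sys_def)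
qed

text \<open>The basis formulas hold under all valuations in an interpretation where predicate 2
  means acceptance under the tag, so nothing beyond that can be derived.\<close>

lemma clause_fms_sound:
  assumes "Prd 2 [l] \<in> r_derivable (initial_sys 17 3 (clause_fms P tag))" "var_list l = {}"
  shows "tag \<cdot> tree_of l \<in> ind [] P"
proof -
  \<comment> \<open>Variables may receive arbitrary lists, so predicate 0 reads its argument through
    \<open>list_tree\<close>, and predicate 1 compares the first argument with the code of any item
    list as second argument, not only of a string.\<close>
  define I where "I p ls = (if p = (0::nat) then list_tree (hd ls) \<in> ind [] P
    else if p = 1 then list_tree (hd ls) = tree_of (ls ! 1) else tag \<cdot> tree_of (hd ls) \<in> ind [] P)" for p ls
  have "sat I v (clause_fm (ps, c))" if c: "(ps, c) \<in> set P" and no: "\<forall>j p. Ora j p \<notin> set ps" for v ps c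
  proof -
    have "prem_holds [] (ind [] P) (\<lambda>i. list_tree (v i)) q" if "q \<in> set ps" "sat I v (prem_fm q)" for q
    proof (cases q)
      case (Own p)
      then show ?thesis using that by (simp add: I_def list_tree_ev_pat_list)
    next
      case (Ora j p)
      then show ?thesis using that no by blast
    qed
    then show ?thesis
      using closedD[OF closed_ind c] by (auto simp: clause_fm_def sat_foldr_Imp I_def list_tree_ev_pat_list)
  qed
  then have "sat I v F" if "F \<in> set (clause_fms P tag)" for F v
    using that unfolding set_clause_fms by (elim UnE imageE) (auto simp: I_def)
  then have "sat I (\<lambda>x. [Var x]) (Prd 2 [l])"
    by (intro r_derivable_sound[OF assms(1)]) (simp add: initial_sys_def)
  then show ?thesis using assms(2) by (simp add: I_def)
qed

text \<open>Each step of the program is simulated by a ground instance of its clause. The string is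
  then linked to its code symbol by symbol, which finally yields predicate 2.\<close>

lemma clause_fms_complete:
  assumes "tag \<cdot> tree_of (as_list s) \<in> ind [] P" "s \<in> strings A17"
  shows "Prd 2 [as_list s] \<in> r_derivable (initial_sys 17 3 (clause_fms P tag))"
proof -
  let ?D = "r_derivable (initial_sys 17 3 (clause_fms P tag))"
  have basis: "F \<in> set (clause_fms P tag) \<Longrightarrow> F \<in> ?D" for F
    by (rule r_derivable.basis) (simp add: initial_sys_def)
  have sb: "sb_all g F \<in> ?D"
    if "F \<in> set (clause_fms P tag)" "quantifier_free F" "\<And>x. g x \<in> list_terms {..<17}" "\<And>x. var_list (g x) = {}" for g F
    using r_derivable_sb_all[OF basis[OF that(1)] that(2), of g] that(3,4) by (simp add: initial_sys_def)
  have "closed [] P {t. Prd 0 [tree_list t] \<in> ?D}"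
    unfolding closed_def
  proof (clarify)
    fix ps c v
    assume c: "(ps, c) \<in> set P" and h: "\<forall>q\<in>set ps. prem_holds [] {t. Prd 0 [tree_list t] \<in> ?D} v q"
    \<comment> \<open>With no oracles an \<open>Ora\<close> premise fails, so a clause that fires
      has passed the filter.\<close>
    have no: "\<forall>j p. Ora j p \<notin> set ps" using h by force
    let ?g = "\<lambda>i. tree_list (v i)"
    have qf: "quantifier_free (foldr Imp (map prem_fm qs) (Prd 0 [pat_list c]))" for qs
    proof (induction qs)
      case (Cons q qs)
      then show ?case by (cases q) auto
    qed simp
    have prem: "sb_all ?g (prem_fm q) \<in> ?D" if "q \<in> set ps" for q
      using bspec[OF h that] by (cases q) (auto simp: ev_pat_list)
    have "sb_all ?g (clause_fm (ps, c)) \<in> ?D"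
      using c no by (intro sb) (auto simp: set_clause_fms clause_fm_def qf tree_list_terms)
    moreover have "sb_all ?g (foldr Imp Fs G) = foldr Imp (map (sb_all ?g) Fs) (sb_all ?g G)" for Fs G
      by (induction Fs) auto
    ultimately have "foldr Imp (map (sb_all ?g) (map prem_fm ps)) (Prd 0 [tree_list (inst v c)]) \<in> ?D"
      by (simp add: clause_fm_def ev_pat_list)
    moreover have "\<forall>E\<in>set (map (sb_all ?g) (map prem_fm ps)). E \<in> ?D"
      using prem by auto
    ultimately show "Prd 0 [tree_list (inst v c)] \<in> ?D"
      by (rule r_derivable_foldr_mp)
  qed
  from subsetD[OF ind_least[OF this] assms(1)]
  have P: "Prd 0 [tree_list (tag \<cdot> tree_of (as_list s))] \<in> ?D" by simp
  have str: "as_list s \<in> list_terms {..<17}" "var_list (as_list s) = {}"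
    if "s \<noteq> []" "set s \<subseteq> {..<17}" for s
    using that
  proof (induction s rule: list_nonempty_induct)
    case (cons a s)
    {
      case 1
      then show ?case using cons list_terms_Cons[OF list_terms.cst[of a]] by simp
    next
      case 2
      then show ?case using cons by simp
    }
  qed (simp_all add: list_terms.cst)
  have s: "s \<noteq> []" "set s \<subseteq> {..<17}" using assms(2) by (auto simp: strings_def A17_eq)
  \<comment> \<open>Strings are nonempty, hence the recursion starts with single symbols and not
    with the empty list.\<close>
  then have conv: "Prd 1 [tree_list (tree_of (as_list s)), as_list s] \<in> ?D"
  proof (induction s rule: list_nonempty_induct)
    case (single a)
    then show ?case by (intro basis) (auto simp: set_clause_fms)
  next
    case (cons a s)
    let ?g = "\<lambda>x. if x = (0::nat) then tree_list (tree_of (as_list s)) else as_list s"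
    have "sb_all ?g (Imp (Prd 1 [[Var 0], [Var 1]])
        (Prd 1 [Op 0 (tree_list (tree_of (Cst a))) # [Var 0], [Cst a, Var 1]])) \<in> ?D"
      using cons str[of s] by (intro sb) (auto simp: set_clause_fms tree_list_terms)
    then have imp: "Imp (Prd 1 [tree_list (tree_of (as_list s)), as_list s])
        (Prd 1 [tree_list (tree_of (as_list (a # s))), as_list (a # s)]) \<in> ?D" by simp
    show ?case by (rule r_derivable.mp[OF _ imp]) (use cons in simp)
  qed
  let ?g = "\<lambda>x. if x = (0::nat) then tree_list (tree_of (as_list s)) else as_list s"
  have "sb_all ?g (Imp (Prd 1 [[Var 0], [Var 1]]) (Imp (Prd 0 [Op 0 (tree_list tag) # [Var 0]]) (Prd 2 [[Var 1]]))) \<in> ?D"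
    using s str[of s] by (intro sb) (auto simp: set_clause_fms tree_list_terms)
  then have "Imp (Prd 1 [tree_list (tree_of (as_list s)), as_list s])
      (Imp (Prd 0 [tree_list (tag \<cdot> tree_of (as_list s))]) (Prd 2 [as_list s])) \<in> ?D" by simp
  then show ?thesis using r_derivable.mp[OF P r_derivable.mp[OF conv]] by blast
qed

text \<open>The 17 constants are the alphabet, the 3 predicates those of \<open>clause_fms\<close>.
  Only the basis \<open>B\<close> depends on \<open>R\<close>, so the number of the deciding
  predicate is known in advance.\<close>

lemma recursive_system_of_RE:
  assumes "RE R"
  obtains B where "recursive_system (initial_sys 17 3 B)"
    "\<And>s. s \<in> strings A17 \<Longrightarrow>
      Prd 2 [as_list s] \<in> r_derivable (initial_sys 17 3 B) \<longleftrightarrow> as_list s \<in> R"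
proof -
  obtain T where T: "tree_re T" "\<And>t. t \<in> T \<Longrightarrow> of_tree t \<in> R" "\<And>x. x \<in> R \<Longrightarrow> tree_of x \<in> T"
    using assms by (rule RE_E) blast
  obtain P tag where P: "T = {t. tag \<cdot> t \<in> ind [] P}"
    using T(1) unfolding tree_re_def by blast
  have ground: "var_list (as_list s) = {}" for s by (induction s) auto
  have mem: "as_list s \<in> R \<longleftrightarrow> tag \<cdot> tree_of (as_list s) \<in> ind [] P" for s
    using T(2)[of "tree_of (as_list s)"] T(3)[of "as_list s"] by (auto simp: P)
  show thesis
  proof (rule that[OF recursive_system_clause_fms])
    show "Prd 2 [as_list s] \<in> r_derivable (initial_sys 17 3 (clause_fms P tag)) \<longleftrightarrow> as_list s \<in> R"
      if "s \<in> strings A17" for s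
      unfolding mem using clause_fms_sound[OF _ ground] clause_fms_complete[OF _ that] by blast
  qed
qed

section \<open>Enumerability and incompleteness\<close>

lemma args_sbF:
  "args F \<subseteq> L \<Longrightarrow> (\<forall>l\<in>L. \<forall>m\<in>L. \<forall>x. sbL l m x \<in> L) \<Longrightarrow> m \<in> L \<Longrightarrow> args (sbF F m x) \<subseteq> L"
  by (induction F) auto

lemma formula_sbF:
  "formula A P F \<Longrightarrow> m \<in> list_terms A \<Longrightarrow> formula A P (sbF F m x)"
proof (induction F)
  have sb: "l \<in> list_terms A \<Longrightarrow> m \<in> list_terms A \<Longrightarrow> sbL l m x \<in> list_terms A" for l
    by (induction rule: list_terms.induct) (auto simp: list_terms.intros)
  {
    case (Eq k l)
    then show ?case by (simp add: sb)
  next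
    case (Prd p ls)
    then show ?case using sb by auto
  }
qed auto

lemma formula_in_sbF:
  assumes "restricted_arglists M L" "formula_in M L F" "m \<in> L"
  shows "formula_in M L (sbF F m x)"
proof -
  have "m \<in> list_terms (mA M)" and L: "\<forall>l\<in>L. \<forall>m\<in>L. \<forall>x. sbL l m x \<in> L"
    using assms by (auto simp: restricted_arglists_def)
  then show ?thesis
    using assms(2) formula_sbF args_sbF[OF _ L assms(3)] by (simp add: formula_in_def)
qed

lemma provable_formula_in:
  assumes M: "mathematical_system M" and L: "restricted_arglists M L" and "F \<in> provable M L"
  shows "formula_in M L F"
  using assms(3)
proof (induction rule: provable.induct)
  case (subst F l x)
  then show ?case using formula_in_sbF[OF L] by blast
next
  case (induction p xs G)
  have "p \<in> mP M" using M induction(1) by (auto simp: mathematical_system_def)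
  moreover have "\<forall>x. [Var x] \<in> L" using L by (simp add: restricted_arglists_def)
  ultimately show ?case using induction(3) by (auto simp: formula_in_def list_terms.var)
qed (auto simp: formula_in_def)

lemma provable_ex_falso:
  assumes M: "mathematical_system M" and L: "restricted_arglists M L"
    and F: "F \<in> provable M L" "Neg F \<in> provable M L" and H: "formula_in M L H"
  shows "H \<in> provable M L"
proof -
  have "prop_inst (\<lambda>n. if n = 0 then F else H) (PBin CImp (PNeg (PVar 0)) (PBin CImp (PVar 0) (PVar 1))) \<in> axioms_of M"
    by (rule axioms_of.taut) simp
  moreover have "formula_in M L (Imp (Neg F) (Imp F H))"
    using provable_formula_in[OF M L F(1)] H by (simp add: formula_in_def)
  ultimately have "Imp (Neg F) (Imp F H) \<in> provable M L"
    by (intro provable.ax) simp_all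
  then show ?thesis
    using provable.mp[OF F(1) provable.mp[OF F(2)]] by blast
qed

lemma RE_enc_fm_image:
  assumes "RE Q" "\<And>F. F \<in> Q \<Longrightarrow> formula UNIV UNIV F"
  shows "RE ((\<lambda>F. as_list (enc_fm F)) ` Q)"
proof -
  obtain T where T: "tree_re T" "\<And>t. t \<in> T \<Longrightarrow> of_tree t \<in> Q" "\<And>F. F \<in> Q \<Longrightarrow> tree_of F \<in> T"
    using assms(1) by (rule RE_E) blast
  obtain E where E: "tree_re E"
    "\<And>a b c. a \<cdot> b \<cdot> c \<in> E \<Longrightarrow> formula UNIV UNIV (of_tree a) \<and> of_tree c = as_list (enc_fm (of_tree a)) @ of_tree b"
    "\<And>a b c. formula UNIV UNIV a \<and> c = as_list (enc_fm a) @ b \<Longrightarrow> tree_of a \<cdot> tree_of b \<cdot> tree_of c \<in> E"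
    using RE_enc_fm by (rule RE_E3) blast
  show ?thesis
  proof (rule RE_I[where Os = "[T, E]" and P = "[([Ora 0 (V 0), Ora 1 (V 0 \<bullet> pNil \<bullet> V 1)], V 1)]"], goal_cases)
    case 2
    then show ?case by (auto simp: closed_def dest!: T(2) E(2))
  next
    case (3 X l)
    then obtain F where F: "F \<in> Q" "l = as_list (enc_fm F)" by blast
    have "tree_of F \<cdot> Lf \<cdot> tree_of l \<in> E"
      using E(3)[of F l "[]"] F assms(2) by simp
    then show ?case using 3(1) T(3)[OF F(1)] by auto
  qed (use T(1) E(1) in simp)
qed

text \<open>Here \<open>y\<close> occurs twice: as it stands, in the place of an R-basis string, and
  encoded, as the argument of predicate \<open>p\<close>. If \<open>y\<close> is an R-basis string,
  the result is the statement that \<open>p\<close> applies to \<open>y\<close> in the system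
  described by \<open>y\<close> itself.\<close>

lemma RE_refuted_diagonal:
  assumes "RE Q"
  shows "RE {y. y \<in> list_terms UNIV \<and> Neg (sbF G (y @ as_list (enc_fm (Prd p [y]))) x) \<in> Q}"
proof -
  obtain T where T: "tree_re T" "\<And>t. t \<in> T \<Longrightarrow> of_tree t \<in> Q" "\<And>F. F \<in> Q \<Longrightarrow> tree_of F \<in> T"
    using assms(1) by (rule RE_E) blast
  obtain E where E: "tree_re E"
    "\<And>a b c. a \<cdot> b \<cdot> c \<in> E \<Longrightarrow> formula UNIV UNIV (of_tree a) \<and> of_tree c = as_list (enc_fm (of_tree a)) @ of_tree b"
    "\<And>a b c. formula UNIV UNIV a \<and> c = as_list (enc_fm a) @ b \<Longrightarrow> tree_of a \<cdot> tree_of b \<cdot> tree_of c \<in> E"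
    using RE_enc_fm by (rule RE_E3) blast
  obtain A where A: "tree_re A"
    "\<And>a b c. a \<cdot> b \<cdot> c \<in> A \<Longrightarrow> (of_tree c :: item list) = of_tree a @ of_tree b"
    "\<And>a b c :: item list. c = a @ b \<Longrightarrow> tree_of a \<cdot> tree_of b \<cdot> tree_of c \<in> A"
    using RE_append by (rule RE_E3) blast
  obtain S where S: "tree_re S"
    "\<And>a b c d. a \<cdot> b \<cdot> c \<cdot> d \<in> S \<Longrightarrow> of_tree d = sbF (of_tree a) (of_tree b) (of_tree c)"
    "\<And>a b c d. d = sbF a b c \<Longrightarrow> tree_of a \<cdot> tree_of b \<cdot> tree_of c \<cdot> tree_of d \<in> S"
    using RE_sbF by (rule RE_E4) blast
  show ?thesis
  proof (rule RE_I[where Os = "[T, E, A, S]" and P = "[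
      ([Ora 1 (pPrd (K (tree_of p)) (V 0 \<bullet> pNil) \<bullet> pNil \<bullet> V 1), Ora 2 (V 0 \<bullet> V 1 \<bullet> V 2),
        Ora 3 (K (tree_of G) \<bullet> V 2 \<bullet> K (tree_of x) \<bullet> V 3), Ora 0 (pNeg (V 3))], V 0)]"], goal_cases)
    case 2
    then show ?case by (auto simp: closed_def simp del: enc_fm.simps dest!: T(2) E(2) A(2) S(2))
  next
    case (3 X y)
    let ?z = "as_list (enc_fm (Prd p [y]))"
    have y: "y \<in> list_terms UNIV" "Neg (sbF G (y @ ?z) x) \<in> Q" using 3(2) by auto
    have "tree_of (Prd p [y]) \<cdot> Lf \<cdot> tree_of ?z \<in> E"
      using E(3)[of "Prd p [y]" ?z "[]"] y by simp
    then show ?case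
      using 3(1) A(3)[OF refl, of y ?z] S(3)[OF refl, of G "y @ ?z" x] T(3)[OF y(2)]
      by (auto simp del: enc_fm.simps)
  qed (use T(1) E(1) A(1) S(1) in simp)
qed

lemma as_list_strings:
  "s \<in> strings A \<Longrightarrow> as_list s \<in> list_terms A" "var_list (as_list s) = {}"
proof -
  show "var_list (as_list s) = {}" by (induction s) auto
  assume "s \<in> strings A"
  then have "s \<noteq> []" "set s \<subseteq> A" by (auto simp: strings_def)
  then show "as_list s \<in> list_terms A"
  proof (induction s rule: list_nonempty_induct)
    case (cons a s)
    then show ?case using list_terms_Cons[OF list_terms.cst[of a]] by simp
  qed (simp add: list_terms.cst)
qed

lemma basis_string_A11:
  assumes "recursive_system (initial_sys k l B)"
  shows "basis_string k l B \<in> strings A11"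
proof -
  have "set (enc_fm F) \<subseteq> A11" if "F \<in> set B" for F
    using that assms set_enc_r_formula[of "{..<k}" "{..<l}" F] by (auto simp: recursive_system_def initial_sys_def)
  then show ?thesis
    by (auto simp: basis_string_def strings_def tally_def A11_def split: if_splits)
qed

lemma represents_A11:
  assumes "represents k l B i m s"
  shows "s \<in> strings A11"
  using assms basis_string_A11[of k l B] set_enc_prime(2)[of i "[m]"]
  by (auto simp: represents_def strings_def simp del: enc_fm.simps)

lemma S11_theorem_iff:
  assumes "represents k l B i m s"
  shows "S11_theorem s \<longleftrightarrow>
    is_prime {..<k} {..<l} (Prd i [m]) \<and> Prd i [m] \<in> r_derivable (initial_sys k l B)"
  using assms represents_unique[OF assms] unfolding S11_theorem_def by metis

theorem mainTheorem19:
  fixes M :: math_sys and L :: "item list set"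
  assumes "mathematical_system M"
    and "restricted_arglists M L"
    and "axiomatized M L"
  shows "rec_enum A17 (enc_fm ` provable M L) \<and>
    (as_list ` strings A11 \<subseteq> L \<longrightarrow>
      (\<forall>G x. formula_in M L G \<and> free G = {x} \<and>
         (\<forall>s\<in>strings A11. S11_theorem s \<longrightarrow> sbF G (as_list s) x \<in> provable M L) \<and>
         (\<forall>s\<in>strings A11. S11_statement s \<and> \<not> S11_theorem s \<longrightarrow>
            sbF G (as_list s) x \<notin> provable M L) \<longrightarrow>
         (\<exists>s\<in>strings A11. S11_statement s \<and>
            sbF G (as_list s) x \<notin> provable M L \<and>
            Neg (sbF G (as_list s) x) \<notin> provable M L)))"
proof (intro conjI impI allI)
  have AP: "mA M = UNIV" "mP M = UNIV"
    and re: "rec_enum A17 (enc_fm ` mB M)" "rec_enum A17 (enc_list ` L)"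
    using assms(3) by (simp_all add: axiomatized_def)
  have "RE (mB M)"
    using assms(1) by (intro RE_of_enc_fm re) (simp add: mathematical_system_def AP)
  moreover have "RE L"
    using assms(2) by (intro RE_of_enc_list re) (simp add: restricted_arglists_def AP)
  ultimately have RE: "RE (provable M L)"
    by (intro RE_provable assms AP)
  have wf: "formula UNIV UNIV F" if "F \<in> provable M L" for F
    using provable_formula_in[OF assms(1,2) that] by (simp add: formula_in_def AP)
  show "rec_enum A17 (enc_fm ` provable M L)"
  proof -
    obtain B where B: "recursive_system (initial_sys 17 3 B)"
      "\<And>s. s \<in> strings A17 \<Longrightarrow> Prd 2 [as_list s] \<in> r_derivable (initial_sys 17 3 B) \<longleftrightarrow>
        as_list s \<in> (\<lambda>F. as_list (enc_fm F)) ` provable M L"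
      using recursive_system_of_RE[OF RE_enc_fm_image[OF RE wf]] by blast
    have "as_list s \<in> (\<lambda>F. as_list (enc_fm F)) ` provable M L \<longleftrightarrow> s \<in> enc_fm ` provable M L" for s
    proof -
      have "as_list s = as_list t \<longleftrightarrow> s = t" for t
        by (simp add: inj_map_eq_map inj_def)
      then show ?thesis by (simp add: image_iff)
    qed
    moreover have "enc_fm F \<in> strings A17" for F
      using enc_fm_hd[of F] set_enc_fm[of F] by (auto simp: strings_def)
    ultimately show ?thesis
      unfolding rec_enum_def using B
      by (intro conjI exI[of _ "initial_sys 17 3 B"] exI[of _ 2]) (auto simp: initial_sys_def A17_eq)
  qed
  fix G x
  assume A11L: "as_list ` strings A11 \<subseteq> L"
  assume G: "formula_in M L G \<and> free G = {x} \<and>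
    (\<forall>s\<in>strings A11. S11_theorem s \<longrightarrow> sbF G (as_list s) x \<in> provable M L) \<and>
    (\<forall>s\<in>strings A11. S11_statement s \<and> \<not> S11_theorem s \<longrightarrow> sbF G (as_list s) x \<notin> provable M L)"
  \<comment> \<open>The diagonal set is formed with predicate 2, the one that the new system will
    use to recognize it. Hence the statements in question concern the system's own predicate as soon
    as \<open>y\<close> is its R-basis string.\<close>
  obtain B where B: "recursive_system (initial_sys 17 3 B)"
    "\<And>s. s \<in> strings A17 \<Longrightarrow> Prd 2 [as_list s] \<in> r_derivable (initial_sys 17 3 B) \<longleftrightarrow>
      as_list s \<in> {y. y \<in> list_terms UNIV \<and> Neg (sbF G (y @ as_list (enc_fm (Prd 2 [y]))) x) \<in> provable M L}"
    using recursive_system_of_RE[OF RE_refuted_diagonal[OF RE]] by blast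
  define y where "y = basis_string 17 3 B"
  define s where "s = y @ enc_fm (Prd 2 [as_list y])"
  have yA: "y \<in> strings A11" unfolding y_def by (rule basis_string_A11[OF B(1)])
  then have y17: "y \<in> strings A17" "y \<in> strings UNIV" by (auto simp: strings_def A17_def)
  have rep: "represents 17 3 B 2 (as_list y) s"
    using B(1) as_list_strings(1)[OF y17(2)] as_list_strings(2)[of y]
    by (simp add: represents_def s_def y_def del: enc_fm.simps)
  have sA: "s \<in> strings A11" by (rule represents_A11[OF rep])
  have stmt: "S11_statement s" using rep unfolding S11_statement_def by blast
  \<comment> \<open>The string uses only the 17 constants of the system and \<open>2 < 3\<close>, so
    the formula is over the symbols of the system, as a theorem requires.\<close>
  have "as_list y \<in> list_terms {..<17}"
    using as_list_strings(1)[OF y17(1)] by (simp add: A17_eq)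
  then have theorem_iff: "S11_theorem s \<longleftrightarrow> Prd 2 [as_list y] \<in> r_derivable (initial_sys 17 3 B)"
    by (simp add: S11_theorem_iff[OF rep])
  also have "\<dots> \<longleftrightarrow> Neg (sbF G (as_list s) x) \<in> provable M L"
    using B(2)[OF y17(1)] as_list_strings(1)[OF y17(2)] by (simp add: s_def del: enc_fm.simps)
  finally have diag: "S11_theorem s \<longleftrightarrow> Neg (sbF G (as_list s) x) \<in> provable M L" .
  have "\<not> S11_theorem s"
  proof
    assume "S11_theorem s"
    then have contra: "sbF G (as_list s) x \<in> provable M L" "Neg (sbF G (as_list s) x) \<in> provable M L"
      using G sA diag by blast+
    \<comment> \<open>The system without symbols and axioms has no theorems: even the constant
      \<open>Cst 0\<close> lies outside its language. The instance of \<open>G\<close> at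
      \<open>s0\<close> is therefore an unprovable formula of \<open>[M; L]\<close>, which
      contradicts ex falso.\<close>
    define s0 where "s0 = basis_string 0 0 [] @ enc_fm (Prd 0 [[Cst 0]])"
    have rep0: "represents 0 0 [] 0 [Cst 0] s0"
      by (simp add: represents_def s0_def recursive_system_def initial_sys_def list_terms.cst del: enc_fm.simps)
    have "S11_statement s0" using rep0 unfolding S11_statement_def by blast
    moreover have "s0 \<in> strings A11" "\<not> S11_theorem s0"
      using represents_A11[OF rep0] S11_theorem_iff[OF rep0] by auto
    ultimately have "sbF G (as_list s0) x \<notin> provable M L" "formula_in M L (sbF G (as_list s0) x)"
      using G A11L formula_in_sbF[OF assms(2)] by blast+
    then show False
      using provable_ex_falso[OF assms(1,2) contra] by blast
  qed
  \<comment> \<open>The instance itself is unprovable by the hypothesis on statements that are no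
    theorems, and its negation is unprovable by \<open>diag\<close>.\<close>
  then show "\<exists>s\<in>strings A11. S11_statement s \<and> sbF G (as_list s) x \<notin> provable M L \<and>
      Neg (sbF G (as_list s) x) \<notin> provable M L"
    using G sA stmt diag by blast
qed

end
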